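(* Let $p\equiv 11\pmod{12}$ be a prime, let $L=(\mathbb{Z}^5,q)$ be a quadratic lattice in the genus of $L_5=(\mathbb{Z}^5,q_5)$, with Gram matrix $G_q$ (so $q(x)=x^{t}G_qx$), and put $F=2G_q\oplus(-2)$, so that $\det F=-2^{10}p^2$ and $v^{t}Fv=2\bigl(q(x)-z^2\bigr)$ for $v=(x,z)\in\mathbb{Z}^5\times\mathbb{Z}$. Then: (a) A nonzero vector $v=(x,z)\in\mathbb{Z}^5\times\mathbb{Z}$ is isotropic for $F$ if and only if $q(x)=z^2$; in that case $z\neq 0$. (b) If moreover (i.e. $v=(x,z)$ is isotropic for $F$ and) $\gcd(v)=1$, then $\gcd(x)=1$, so that $x$ is a witness for $N=|z|$. (c) Every totally isotropic subspace of $(\mathbb{Q}^6,F)$ has dimension at most $1$. (d) $F$ has an isotropic vector; hence every class of the genus of $L_5$ has a witness.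
   Context: Here $$q_5(x_0,x_1,x_2,x_3,x_4)=x_0^2+4x_1^2+4x_1x_3+4x_2^2+4x_2x_4+(p+1)x_3^2+(p+1)x_4^2 .$$ A quadratic lattice $(\mathbb{Z}^5,q)$ lies in the genus of $L_5$ if $q$ is positive definite and, for every prime $\nu$, $q$ and $q_5$ agree up to a change of variables in $\mathrm{GL}_5(\mathbb{Z}_\nu)$. For a quadratic form $q$, $G_q$ is the symmetric matrix with $q(x)=x^{t}G_qx$. For an integer vector, $\gcd$ denotes the gcd of its coordinates; $x$ is primitive if $\gcd(x)=1$. A vector $v$ is isotropic for $F$ if $v\neq 0$ and $v^{t}Fv=0$; a subspace is totally isotropic if the form $v\mapsto v^{t}Fv$ vanishes on it. A witness for $L$ is a primitive $x\in\mathbb{Z}^5$ with $q(x)=N^2$ for some integer $N\geq 1$; it is then called a witness for $N$. *)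

theory Defs
  imports "HOL-Analysis.Determinants" "HOL-Algebra.IntRing" "HOL-Library.Numeral_Type"
begin

text \<open>
  An integral quadratic form in variables indexed by \<^typ>\<open>'n\<close> is given by integer coefficients
  \<open>c i j\<close> and stands for the polynomial \<open>\<Sum>i j. c i j x\<^sub>i x\<^sub>j\<close>. The array \<open>c\<close> need not be symmetric,
  so forms with odd mixed coefficients are included; only \<open>c i j + c j i\<close> matters for \<open>i \<noteq> j\<close>.
\<close>

type_synonym 'n qform = "'n \<Rightarrow> 'n \<Rightarrow> int"

definition qf_eval :: "('n::finite) qform \<Rightarrow> 'a::comm_ring_1 ^ 'n \<Rightarrow> 'a" where
  "qf_eval c x = (\<Sum>i\<in>UNIV. \<Sum>j\<in>UNIV. of_int (c i j) * (x $ i * x $ j))"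

definition pos_def :: "('n::finite) qform \<Rightarrow> bool" where
  "pos_def c \<longleftrightarrow> (\<forall>x :: real ^ 'n. x \<noteq> 0 \<longrightarrow> qf_eval c x > 0)"

definition q5 :: "nat \<Rightarrow> 5 qform" where
  "q5 p i j =
    (if (i, j) = (0, 0) then 1
     else if (i, j) \<in> {(1, 1), (1, 3), (2, 2), (2, 4)} then 4
     else if (i, j) \<in> {(3, 3), (4, 4)} then int p + 1
     else 0)"

lemma UNIV_5: "(UNIV :: 5 set) = {0, 1, 2, 3, 4}"
proof (rule card_subset_eq [symmetric])
  show "card {0, 1, 2, 3, 4 :: 5} = card (UNIV :: 5 set)" by simp
qed simp_all

lemma qf_eval_q5:
  "qf_eval (q5 p) x =
     (x $ 0)^2 + 4 * (x $ 1)^2 + 4 * (x $ 1) * (x $ 3) + 4 * (x $ 2)^2 + 4 * (x $ 2) * (x $ 4)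
     + (of_nat p + 1) * (x $ 3)^2 + (of_nat p + 1) * (x $ 4)^2"
proof -
  have d: "(0::5) \<noteq> 1" "(0::5) \<noteq> 2" "(0::5) \<noteq> 3" "(0::5) \<noteq> 4" "(1::5) \<noteq> 2" "(1::5) \<noteq> 3"
    "(1::5) \<noteq> 4" "(2::5) \<noteq> 3" "(2::5) \<noteq> 4" "(3::5) \<noteq> 4"
    by simp_all
  have sum5: "(\<Sum>i\<in>UNIV. f i) = f 0 + f 1 + f 2 + f 3 + f 4" for f :: "5 \<Rightarrow> 'a"
    unfolding UNIV_5 using d by (simp add: add.assoc del: eq_numeral_iff_iszero)
  show ?thesis
    unfolding qf_eval_def sum5 q5_def
    by (simp add: d d [symmetric] add.commute [of 1 "of_nat p :: 'a"] power2_eq_square mult.assoc del: eq_numeral_iff_iszero)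
qed


text \<open>
  The ring of \<open>\<nu>\<close>-adic integers as the inverse limit of the rings \<open>\<int>/\<nu>\<^sup>n\<int>\<close>: its elements are the
  coherent sequences of residues \<open>a n \<in> {0..<\<nu>\<^sup>n}\<close>, with componentwise operations.
\<close>

definition padic_int :: "nat \<Rightarrow> (nat \<Rightarrow> int) ring" where
  "padic_int \<nu> =
    \<lparr>carrier = {a. \<forall>n. a n \<in> {0..<int \<nu> ^ n} \<and> a (Suc n) mod int \<nu> ^ n = a n},
     mult = (\<lambda>a b n. (a n * b n) mod int \<nu> ^ n),
     one = (\<lambda>n. 1 mod int \<nu> ^ n),
     zero = (\<lambda>n. 0),
     add = (\<lambda>a b n. (a n + b n) mod int \<nu> ^ n)\<rparr>"

lemma cring_padic_int:
  assumes "\<nu> > 0"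
  shows "cring (padic_int \<nu>)"
proof -
  let ?Z = "padic_int \<nu>"
  have red: "a n mod int \<nu> ^ n = a n" if "a \<in> carrier ?Z" for a n
    using that by (auto simp: padic_int_def)
  have step: "a (Suc n) mod int \<nu> ^ n = a n mod int \<nu> ^ n" if "a \<in> carrier ?Z" for a n
    using that red [OF that] by (simp add: padic_int_def)
  have memI: "(\<lambda>n. f n mod int \<nu> ^ n) \<in> carrier ?Z"
    if "\<And>n. f (Suc n) mod int \<nu> ^ n = f n mod int \<nu> ^ n" for f
  proof -
    have "f (Suc n) mod int \<nu> ^ Suc n mod int \<nu> ^ n = f n mod int \<nu> ^ n" for n
      using that [of n] by (metis mod_mod_cancel le_imp_power_dvd Suc_n_not_le_n nat_le_linear)
    then show ?thesis using assms by (simp add: padic_int_def)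
  qed
  have ops: "(a \<oplus>\<^bsub>?Z\<^esub> b) = (\<lambda>n. (a n + b n) mod int \<nu> ^ n)"
    "(a \<otimes>\<^bsub>?Z\<^esub> b) = (\<lambda>n. (a n * b n) mod int \<nu> ^ n)"
    "\<one>\<^bsub>?Z\<^esub> = (\<lambda>n. 1 mod int \<nu> ^ n)" "\<zero>\<^bsub>?Z\<^esub> = (\<lambda>n. 0)" for a b
    by (simp_all add: padic_int_def)
  show ?thesis
  proof (rule cringI)
    show "abelian_group ?Z"
    proof (rule abelian_groupI)
      fix a b assume ab: "a \<in> carrier ?Z" "b \<in> carrier ?Z"
      show "a \<oplus>\<^bsub>?Z\<^esub> b \<in> carrier ?Z"
        unfolding ops by (intro memI mod_add_cong step ab)
      show "a \<oplus>\<^bsub>?Z\<^esub> b = b \<oplus>\<^bsub>?Z\<^esub> a"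
        unfolding ops by (simp add: add.commute)
      fix c
      show "a \<oplus>\<^bsub>?Z\<^esub> b \<oplus>\<^bsub>?Z\<^esub> c = a \<oplus>\<^bsub>?Z\<^esub> (b \<oplus>\<^bsub>?Z\<^esub> c)"
        unfolding ops by (simp add: mod_simps add.assoc)
    next
      show "\<zero>\<^bsub>?Z\<^esub> \<in> carrier ?Z" using assms by (simp add: padic_int_def)
    next
      fix a assume a: "a \<in> carrier ?Z"
      show "\<zero>\<^bsub>?Z\<^esub> \<oplus>\<^bsub>?Z\<^esub> a = a" unfolding ops using red [OF a] by simp
      have "(\<lambda>n. (- a n) mod int \<nu> ^ n) \<in> carrier ?Z"
        by (intro memI mod_minus_cong step a)
      then show "\<exists>b\<in>carrier ?Z. b \<oplus>\<^bsub>?Z\<^esub> a = \<zero>\<^bsub>?Z\<^esub>"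
        by (rule rev_bexI) (simp add: ops mod_simps)
    qed
  next
    show "Group.comm_monoid ?Z"
    proof (rule comm_monoidI)
      fix a b assume ab: "a \<in> carrier ?Z" "b \<in> carrier ?Z"
      show "a \<otimes>\<^bsub>?Z\<^esub> b \<in> carrier ?Z"
        unfolding ops by (intro memI mod_mult_cong step ab)
      show "a \<otimes>\<^bsub>?Z\<^esub> b = b \<otimes>\<^bsub>?Z\<^esub> a"
        unfolding ops by (simp add: mult.commute)
      fix c
      show "a \<otimes>\<^bsub>?Z\<^esub> b \<otimes>\<^bsub>?Z\<^esub> c = a \<otimes>\<^bsub>?Z\<^esub> (b \<otimes>\<^bsub>?Z\<^esub> c)"
        unfolding ops by (simp add: mod_simps mult.assoc)
    next
      show "\<one>\<^bsub>?Z\<^esub> \<in> carrier ?Z" unfolding ops by (rule memI) simp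
    next
      fix a assume a: "a \<in> carrier ?Z"
      show "\<one>\<^bsub>?Z\<^esub> \<otimes>\<^bsub>?Z\<^esub> a = a" unfolding ops using red [OF a] by (simp add: mod_simps)
    qed
  next
    fix a b c
    show "(a \<oplus>\<^bsub>?Z\<^esub> b) \<otimes>\<^bsub>?Z\<^esub> c = a \<otimes>\<^bsub>?Z\<^esub> c \<oplus>\<^bsub>?Z\<^esub> b \<otimes>\<^bsub>?Z\<^esub> c"
      unfolding ops by (simp add: mod_simps distrib_right)
  qed
qed



definition qf_eval_ring :: "('r, 'm) ring_scheme \<Rightarrow> ('n::finite) qform \<Rightarrow> ('n \<Rightarrow> 'r) \<Rightarrow> 'r" where
  "qf_eval_ring R c x =
     (\<Oplus>\<^bsub>R\<^esub>i\<in>UNIV. \<Oplus>\<^bsub>R\<^esub>j\<in>UNIV. [c i j] \<cdot>\<^bsub>R\<^esub> (x i \<otimes>\<^bsub>R\<^esub> x j))"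

definition mat_vec_ring ::
  "('r, 'm) ring_scheme \<Rightarrow> ('n::finite \<Rightarrow> 'n \<Rightarrow> 'r) \<Rightarrow> ('n \<Rightarrow> 'r) \<Rightarrow> 'n \<Rightarrow> 'r" where
  "mat_vec_ring R U x = (\<lambda>i. \<Oplus>\<^bsub>R\<^esub>j\<in>UNIV. U i j \<otimes>\<^bsub>R\<^esub> x j)"

definition mat_mult_ring ::
  "('r, 'm) ring_scheme \<Rightarrow> ('n::finite \<Rightarrow> 'n \<Rightarrow> 'r) \<Rightarrow> ('n \<Rightarrow> 'n \<Rightarrow> 'r) \<Rightarrow> 'n \<Rightarrow> 'n \<Rightarrow> 'r" where
  "mat_mult_ring R U V = (\<lambda>i j. \<Oplus>\<^bsub>R\<^esub>k\<in>UNIV. U i k \<otimes>\<^bsub>R\<^esub> V k j)"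

definition mat_one_ring :: "('r, 'm) ring_scheme \<Rightarrow> 'n \<Rightarrow> 'n \<Rightarrow> 'r" where
  "mat_one_ring R = (\<lambda>i j. if i = j then \<one>\<^bsub>R\<^esub> else \<zero>\<^bsub>R\<^esub>)"

definition GL_ring :: "('r, 'm) ring_scheme \<Rightarrow> ('n::finite \<Rightarrow> 'n \<Rightarrow> 'r) set" where
  "GL_ring R = {U. (\<forall>i j. U i j \<in> carrier R) \<and>
     (\<exists>V. (\<forall>i j. V i j \<in> carrier R) \<and>
        mat_mult_ring R U V = mat_one_ring R \<and> mat_mult_ring R V U = mat_one_ring R)}"

definition equivalent_over ::
  "('r, 'm) ring_scheme \<Rightarrow> ('n::finite) qform \<Rightarrow> 'n qform \<Rightarrow> bool" where
  "equivalent_over R c d \<longleftrightarrow>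
     (\<exists>U\<in>GL_ring R. \<forall>x. (\<forall>i. x i \<in> carrier R) \<longrightarrow>
        qf_eval_ring R c (mat_vec_ring R U x) = qf_eval_ring R d x)"

definition genus :: "('n::finite) qform \<Rightarrow> 'n qform set" where
  "genus d = {c. pos_def c \<and>
     (\<forall>\<nu>::nat. Factorial_Ring.prime \<nu> \<longrightarrow> equivalent_over (padic_int \<nu>) c d)}"

definition genus_classes :: "('n::finite) qform \<Rightarrow> 'n qform set set" where
  "genus_classes d =
     genus d // {(b, c). b \<in> genus d \<and> c \<in> genus d \<and> equivalent_over int_ring b c}"


definition quad :: "'a::comm_ring_1 ^ 'n ^ 'n \<Rightarrow> 'a ^ 'n \<Rightarrow> 'a" where
  "quad A v = (\<Sum>i\<in>UNIV. v $ i * (A *v v) $ i)"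

definition isotropic :: "'a::comm_ring_1 ^ 'n ^ 'n \<Rightarrow> 'a ^ 'n \<Rightarrow> bool" where
  "isotropic A v \<longleftrightarrow> v \<noteq> 0 \<and> quad A v = 0"

definition totally_isotropic :: "'a::field ^ 'n ^ 'n \<Rightarrow> ('a ^ 'n) set \<Rightarrow> bool" where
  "totally_isotropic A W \<longleftrightarrow> vec.subspace W \<and> (\<forall>v\<in>W. quad A v = 0)"

text \<open>Vectors and matrices on a direct sum are indexed by the sum of the index types; in particular
  \<open>\<int>\<^sup>5 \<times> \<int>\<close> becomes \<^typ>\<open>int ^ (5 + 1)\<close>.\<close>

definition join :: "'a ^ 'n \<Rightarrow> 'a \<Rightarrow> 'a ^ ('n + 1)" where
  "join x z = (\<chi> k. case k of Inl i \<Rightarrow> x $ i | Inr _ \<Rightarrow> z)"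

definition direct_sum_mat ::
  "'a::zero ^ 'm ^ 'm \<Rightarrow> 'a ^ 'n ^ 'n \<Rightarrow> 'a ^ ('m + 'n) ^ ('m + 'n)" where
  "direct_sum_mat A B = (\<chi> k l. case (k, l) of
       (Inl i, Inl j) \<Rightarrow> A $ i $ j
     | (Inr i, Inr j) \<Rightarrow> B $ i $ j
     | _ \<Rightarrow> 0)"

definition rat_vec :: "int ^ 'n \<Rightarrow> rat ^ 'n" where
  "rat_vec x = (\<chi> i. of_int (x $ i))"

definition gcd_vec :: "int ^ 'n \<Rightarrow> int" where
  "gcd_vec x = Gcd (range (\<lambda>i. x $ i))"

definition witness_for :: "('n::finite) qform \<Rightarrow> int \<Rightarrow> int ^ 'n \<Rightarrow> bool" where
  "witness_for c N x \<longleftrightarrow> gcd_vec x = 1 \<and> N \<ge> 1 \<and> qf_eval c x = N ^ 2"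

definition witness :: "('n::finite) qform \<Rightarrow> int ^ 'n \<Rightarrow> bool" where
  "witness c x \<longleftrightarrow> (\<exists>N. witness_for c N x)"

end

theory Submission
  imports Defs "Jordan_Normal_Form.Determinant"
begin

text \<open>
  Clearing denominators, (d) says that the positive definite \<open>q\<close> represents a nonzero square over
  \<open>\<int>\<close>. Local equivalence at the primes dividing the discriminant gives, by the Chinese remainder
  theorem, an integer matrix \<open>U\<close> with \<open>q \<circ> U \<equiv> q5\<close> modulo a high power of the discriminant. Gluing the
  lattices of \<open>q\<close> and \<open>- q5\<close> along the isomorphism of discriminant groups induced by \<open>U\<close> yields an
  even unimodular lattice of rank 10 and signature \<open>(5, 5)\<close>. Hermite's reduction bound shows that such
  a lattice is hyperbolic, without any appeal to the Hasse principle: in an anisotropic one, short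
  vectors of norm \<open>\<plusminus>2\<close> could be split off orthogonally, all of the same sign, until their number
  contradicts the signature. By definiteness, a totally isotropic subspace of dimension 5 is the
  graph of a rational isometry from \<open>q5\<close> to \<open>q\<close>, and \<open>q5\<close> represents 1.
\<close>

section \<open>Determinants of matrices given by their entries\<close>

text \<open>The rank 10 = 5 + 5 is what makes the elementary argument possible. Hermite's bound on
  the least absolute value of a form of rank n and determinant +-1 is (4/3)^((n-1)/2), which is
  below 4 exactly for n \<le> 10, and an even value below 4 in absolute value is 0 or +-2. Splitting
  off a vector of norm +-2 doubles the determinant but lowers the rank, and the bound survives long
  enough to produce six orthogonal vectors of one sign, too many for signature (5, 5). Gluing
  presupposes that \<open>q\<close> and \<open>q5\<close> have the same determinant; this, too, has
  to be drawn from the local equivalences, which relate the two determinants at first only up to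
  squares of units. Signatures are certified by integer linear equations, and denominators are
  cleared by working with \<open>D\<close> times the glued lattice, where the form takes values
  divisible by D^2.\<close>

hide_const (open) Determinant.det Matrix.mat Matrix.vec Matrix.row Matrix.rows Matrix.col
no_notation vec_index (infixl "$" 100)

text \<open>Matrices are functions on the naturals with the size passed separately, because the
  inductions below change the size and reach lower right blocks by shifting indices.\<close>

definition fdet :: "nat \<Rightarrow> (nat \<Rightarrow> nat \<Rightarrow> 'a::comm_ring_1) \<Rightarrow> 'a" where
  "fdet n A = Determinant.det (Matrix.mat n n (\<lambda>(i, j). A i j))"

lemma fdet_cong:
  assumes "\<And>i j. i < n \<Longrightarrow> j < n \<Longrightarrow> A i j = B i j"
  shows "fdet n A = fdet n B"
  unfolding fdet_def by (intro arg_cong[of _ _ Determinant.det] eq_matI) (auto simp: assms)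

lemma fdet_leibniz:
  "fdet n A = (\<Sum>p | p permutes {0..<n}. of_int (sign p) * (\<Prod>i = 0..<n. A i (p i)))"
  unfolding fdet_def by (subst det_def'[of _ n]) (auto intro!: sum.cong prod.cong simp: permutes_in_image)

lemma fdet_mult: "fdet n (\<lambda>i j. \<Sum>k<n. A i k * B k j) = fdet n A * fdet n B"
proof -
  let ?M = "\<lambda>A. Matrix.mat n n (\<lambda>(i, j). A i j)"
  have "?M (\<lambda>i j. \<Sum>k<n. A i k * B k j) = ?M A * ?M B"
    by (rule eq_matI) (auto simp: scalar_prod_def atLeast0LessThan)
  then show ?thesis
    unfolding fdet_def by (simp add: det_mult[where n = n])
qed

lemma fdet_transpose: "fdet n (\<lambda>i j. A j i) = fdet n A"
proof -
  let ?M = "\<lambda>A. Matrix.mat n n (\<lambda>(i, j). A i j)"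
  have "?M (\<lambda>i j. A j i) = (?M A)\<^sup>T"
    by (rule eq_matI) auto
  then show ?thesis
    unfolding fdet_def by (simp add: det_transpose[where n = n])
qed

lemma fdet_id [simp]: "fdet n (\<lambda>i j. if i = j then 1 else 0) = 1"
proof -
  have "Matrix.mat n n (\<lambda>(i, j). if i = j then 1 else 0) = 1\<^sub>m n"
    by (rule eq_matI) auto
  then show ?thesis unfolding fdet_def by (metis det_one)
qed

lemma fdet_scale: "fdet n (\<lambda>i j. c * A i j) = c ^ n * fdet n A"
proof -
  let ?M = "\<lambda>A. Matrix.mat n n (\<lambda>(i, j). A i j)"
  have "?M (\<lambda>i j. c * A i j) = c \<cdot>\<^sub>m ?M A"
    by (rule eq_matI) auto
  then show ?thesis by (simp add: fdet_def)
qed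

lemma fdet_block_upper:
  fixes A :: "nat \<Rightarrow> nat \<Rightarrow> 'a::idom"
  assumes "\<And>i j. i < m \<Longrightarrow> j < n \<Longrightarrow> A (n + i) j = 0"
  shows "fdet (n + m) A = fdet n A * fdet m (\<lambda>i j. A (n + i) (n + j))"
proof -
  let ?A1 = "Matrix.mat n n (\<lambda>(i, j). A i j)" and ?A2 = "Matrix.mat n m (\<lambda>(i, j). A i (n + j))"
  let ?A4 = "Matrix.mat m m (\<lambda>(i, j). A (n + i) (n + j))"
  have "Matrix.mat (n + m) (n + m) (\<lambda>(i, j). A i j) = four_block_mat ?A1 ?A2 (0\<^sub>m m n) ?A4"
  proof (rule eq_matI)
    fix i j assume "i < dim_row (four_block_mat ?A1 ?A2 (0\<^sub>m m n) ?A4)"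
      "j < dim_col (four_block_mat ?A1 ?A2 (0\<^sub>m m n) ?A4)"
    then show "Matrix.mat (n + m) (n + m) (\<lambda>(i, j). A i j) $$ (i, j)
        = four_block_mat ?A1 ?A2 (0\<^sub>m m n) ?A4 $$ (i, j)"
      using assms[of "i - n" j] by auto
  qed auto
  then show ?thesis
    unfolding fdet_def by (simp add: det_four_block_mat_lower_left_zero[where n = n and m = m])
qed

lemma fdet_1 [simp]: "fdet (Suc 0) A = A 0 0"
  by (simp add: fdet_def det_single)

lemma fdet_Suc_upper:
  fixes A :: "nat \<Rightarrow> nat \<Rightarrow> 'a::idom"
  assumes "\<And>i. i < n \<Longrightarrow> A (Suc i) 0 = 0"
  shows "fdet (Suc n) A = A 0 0 * fdet n (\<lambda>i j. A (Suc i) (Suc j))"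
  using fdet_block_upper[of n 1 A] assms by simp

lemma fdet_Suc_lower:
  fixes A :: "nat \<Rightarrow> nat \<Rightarrow> 'a::idom"
  assumes "\<And>j. j < n \<Longrightarrow> A 0 (Suc j) = 0"
  shows "fdet (Suc n) A = A 0 0 * fdet n (\<lambda>i j. A (Suc i) (Suc j))"
  using fdet_Suc_upper[of n "\<lambda>i j. A j i"] assms
  by (simp add: fdet_transpose[of _ "\<lambda>i j. A (Suc i) (Suc j)"] fdet_transpose[of _ A])

text \<open>Stand-in for the inverse over a ring: \<open>C\<close> inverts \<open>A\<close> up to
  the factor \<open>fdet n A\<close>.\<close>

lemma fdet_adjugate:
  obtains C where
    "\<And>i j. i < n \<Longrightarrow> j < n \<Longrightarrow> (\<Sum>k<n. A i k * C k j) = (if i = j then fdet n A else 0)"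
    "\<And>i j. i < n \<Longrightarrow> j < n \<Longrightarrow> (\<Sum>k<n. C i k * A k j) = (if i = j then fdet n A else 0)"
proof -
  let ?M = "Matrix.mat n n (\<lambda>(i, j). A i j)"
  define C where "C = (\<lambda>i j. adj_mat ?M $$ (i, j))"
  have adj: "adj_mat ?M \<in> carrier_mat n n" "?M * adj_mat ?M = fdet n A \<cdot>\<^sub>m 1\<^sub>m n"
    "adj_mat ?M * ?M = fdet n A \<cdot>\<^sub>m 1\<^sub>m n"
    using adj_mat[of ?M n] by (auto simp: fdet_def)
  have "(\<Sum>k<n. A i k * C k j) = (?M * adj_mat ?M) $$ (i, j)" if "i < n" "j < n" for i j
    using that adj(1) by (simp add: scalar_prod_def atLeast0LessThan C_def)
  moreover have "(\<Sum>k<n. C i k * A k j) = (adj_mat ?M * ?M) $$ (i, j)" if "i < n" "j < n" for i j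
    using that adj(1) by (simp add: scalar_prod_def atLeast0LessThan C_def)
  ultimately show thesis
    using that[of C] adj(2,3) by simp
qed

lemma fdet_zero_kernel:
  fixes A :: "nat \<Rightarrow> nat \<Rightarrow> 'a::idom"
  assumes "fdet n A = 0"
  obtains y j where "j < n" "y j \<noteq> 0" "\<And>i. i < n \<Longrightarrow> (\<Sum>j<n. A i j * y j) = 0"
proof -
  let ?M = "Matrix.mat n n (\<lambda>(i, j). A i j)"
  have "?M \<in> carrier_mat n n" by simp
  from det_0_iff_vec_prod_zero[OF this] assms obtain v where v: "v \<in> carrier_vec n"
      "v \<noteq> 0\<^sub>v n" "?M *\<^sub>v v = 0\<^sub>v n"
    by (auto simp: fdet_def)
  from v(1,2) obtain j where j: "j < n" "vec_index v j \<noteq> 0"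
    by (metis carrier_vecD eq_vecI index_zero_vec)
  show thesis
  proof (rule that[of j "vec_index v"])
    fix i assume i: "i < n"
    then have "(\<Sum>j<n. A i j * vec_index v j) = vec_index (?M *\<^sub>v v) i"
      using v(1) by (simp add: scalar_prod_def atLeast0LessThan)
    then show "(\<Sum>j<n. A i j * vec_index v j) = 0" using v(3) i by simp
  qed (use j in auto)
qed

lemma underdetermined_system:
  fixes a :: "nat \<Rightarrow> nat \<Rightarrow> 'a::idom"
  obtains y j where "j \<le> m" "y j \<noteq> 0" "\<And>i. i < m \<Longrightarrow> (\<Sum>j\<le>m. a i j * y j) = 0"
proof -
  \<comment> \<open>The m equations are padded with a zero row to a square system. Its determinant
    vanishes, since in that row the product of \<open>A\<close> with its adjugate has the diagonal
    entry 0.\<close>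
  define A where "A i j = (if i < m then a i j else 0)" for i j
  have "fdet (Suc m) A = 0"
  proof (rule ccontr)
    assume ne: "fdet (Suc m) A \<noteq> 0"
    obtain C where "\<And>i j. i < Suc m \<Longrightarrow> j < Suc m \<Longrightarrow>
        (\<Sum>k<Suc m. A i k * C k j) = (if i = j then fdet (Suc m) A else 0)"
      by (rule fdet_adjugate[of "Suc m" A]) blast
    from this[of m m] ne show False by (simp add: A_def)
  qed
  then obtain y j where "j < Suc m" "y j \<noteq> 0" "\<And>i. i < Suc m \<Longrightarrow> (\<Sum>j<Suc m. A i j * y j) = 0"
    by (rule fdet_zero_kernel) blast
  moreover from this(3) have "(\<Sum>j\<le>m. a i j * y j) = 0" if "i < m" for i
    using that by (metis (no_types, lifting) A_def lessThan_Suc_atMost less_SucI sum.cong)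
  ultimately show thesis using that[of j y] by auto
qed

section \<open>Integral bilinear forms\<close>

definition form :: "nat \<Rightarrow> (nat \<Rightarrow> nat \<Rightarrow> int) \<Rightarrow> (nat \<Rightarrow> int) \<Rightarrow> (nat \<Rightarrow> int) \<Rightarrow> int" where
  "form n A x y = (\<Sum>i<n. \<Sum>j<n. x i * A i j * y j)"

definition mulv :: "nat \<Rightarrow> (nat \<Rightarrow> nat \<Rightarrow> int) \<Rightarrow> (nat \<Rightarrow> int) \<Rightarrow> nat \<Rightarrow> int" where
  "mulv n P x i = (\<Sum>k<n. P i k * x k)"

text \<open>The matrix S^T A S. The number of columns of \<open>S\<close> is left open, so the same
  notion serves for changes of basis and for sublattices of smaller rank.\<close>

definition gram :: "nat \<Rightarrow> (nat \<Rightarrow> nat \<Rightarrow> int) \<Rightarrow> (nat \<Rightarrow> nat \<Rightarrow> int) \<Rightarrow> nat \<Rightarrow> nat \<Rightarrow> int" where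
  "gram n A S i j = form n A (\<lambda>k. S k i) (\<lambda>k. S k j)"

text \<open>Stated for vectors rather than entries, so that it passes to \<open>gram\<close> at
  once.\<close>

definition even_form :: "nat \<Rightarrow> (nat \<Rightarrow> nat \<Rightarrow> int) \<Rightarrow> bool" where
  "even_form n A \<longleftrightarrow> (\<forall>x y. form n A x y = form n A y x) \<and> (\<forall>x. even (form n A x x))"

definition unim :: "nat \<Rightarrow> (nat \<Rightarrow> nat \<Rightarrow> int) \<Rightarrow> bool" where
  "unim n P \<longleftrightarrow> \<bar>fdet n P\<bar> = 1"

lemma form_cong:
  assumes "\<And>i. i < n \<Longrightarrow> x i = x' i" "\<And>i. i < n \<Longrightarrow> y i = y' i"
    and "\<And>i j. i < n \<Longrightarrow> j < n \<Longrightarrow> A i j = A' i j"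
  shows "form n A x y = form n A' x' y'"
  unfolding form_def by (intro sum.cong) (auto simp: assms)

lemma form_add_left: "form n A (\<lambda>i. x i + x' i) y = form n A x y + form n A x' y"
  by (simp add: form_def sum.distrib algebra_simps)

lemma form_add_right: "form n A x (\<lambda>i. y i + y' i) = form n A x y + form n A x y'"
  by (simp add: form_def sum.distrib algebra_simps)

lemma form_scale_left: "form n A (\<lambda>i. c * x i) y = c * form n A x y"
  by (simp add: form_def sum_distrib_left algebra_simps)

lemma form_scale_right: "form n A x (\<lambda>i. c * y i) = c * form n A x y"
  by (simp add: form_def sum_distrib_left algebra_simps)

lemma form_zero_left [simp]: "form n A (\<lambda>i. 0) y = 0"
  by (simp add: form_def)

lemma form_zero_right [simp]: "form n A x (\<lambda>i. 0) = 0"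
  by (simp add: form_def)

lemma form_sum_left: "form n A (\<lambda>i. \<Sum>k\<in>K. f k i) y = (\<Sum>k\<in>K. form n A (f k) y)"
  by (induction K rule: infinite_finite_induct) (simp_all add: form_add_left)

lemma form_sum_right: "form n A x (\<lambda>i. \<Sum>k\<in>K. f k i) = (\<Sum>k\<in>K. form n A x (f k))"
  by (induction K rule: infinite_finite_induct) (simp_all add: form_add_right)

lemma form_gram: "form k (gram n A S) x y = form n A (mulv k S x) (mulv k S y)"
proof -
  have "mulv k S z = (\<lambda>i. \<Sum>l<k. z l * S i l)" for z
    by (simp add: fun_eq_iff mulv_def mult.commute)
  then have "form n A (mulv k S x) (mulv k S y)
      = (\<Sum>l<k. x l * (\<Sum>m<k. y m * form n A (\<lambda>i. S i l) (\<lambda>i. S i m)))"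
    by (simp add: form_sum_left form_sum_right form_scale_left form_scale_right sum_distrib_left)
  then show ?thesis
    by (simp add: form_def[of k] gram_def sum_distrib_left mult_ac)
qed

lemma gram_gram: "gram k (gram n A P) Q = gram n A (\<lambda>i j. \<Sum>l<k. P i l * Q l j)"
  by (intro ext) (simp add: gram_def[of k] form_gram gram_def[of n A "\<lambda>i j. \<Sum>l<k. P i l * Q l j"] mulv_def[abs_def])

lemma fdet_gram: "fdet n (gram n A P) = (fdet n P)\<^sup>2 * fdet n A"
proof -
  have "gram n A P = (\<lambda>i j. \<Sum>k<n. P k i * (\<Sum>l<n. A k l * P l j))"
    by (intro ext) (simp add: gram_def form_def sum_distrib_left mult_ac)
  then have "fdet n (gram n A P) = fdet n (\<lambda>i j. P j i) * (fdet n A * fdet n P)"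
    by (simp only: fdet_mult[of n "\<lambda>i j. P j i"] fdet_mult)
  then show ?thesis
    by (simp add: fdet_transpose[of n P] power2_eq_square)
qed

lemma even_form_gram: "even_form n A \<Longrightarrow> even_form k (gram n A S)"
  by (simp add: even_form_def form_gram)

lemma form_Suc:
  "form (Suc n) A x y = x 0 * A 0 0 * y 0 + x 0 * (\<Sum>j<n. A 0 (Suc j) * y (Suc j))
     + (\<Sum>i<n. x (Suc i) * A (Suc i) 0) * y 0
     + form n (\<lambda>i j. A (Suc i) (Suc j)) (\<lambda>i. x (Suc i)) (\<lambda>j. y (Suc j))"
proof -
  have *: "f 0 0 + (\<Sum>j<n. f 0 (Suc j)) + (\<Sum>i<n. f (Suc i) 0 + (\<Sum>j<n. f (Suc i) (Suc j)))
     = f 0 0 + (\<Sum>j<n. f 0 (Suc j)) + (\<Sum>i<n. f (Suc i) 0) + (\<Sum>i<n. \<Sum>j<n. f (Suc i) (Suc j))"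
    for f :: "nat \<Rightarrow> nat \<Rightarrow> int"
    by (simp add: sum.distrib)
  show ?thesis
    unfolding form_def sum.lessThan_Suc_shift sum_distrib_left sum_distrib_right mult.assoc[symmetric]
    by (rule *[of "\<lambda>i j. x i * A i j * y j"])
qed

definition unit :: "nat \<Rightarrow> nat \<Rightarrow> int" where
  "unit i k = (if k = i then 1 else 0)"

lemma sum_unit: "i < n \<Longrightarrow> (\<Sum>k<n. unit i k * f k) = f i"
  "i < n \<Longrightarrow> (\<Sum>k<n. f k * unit i k) = f i"
  by (simp_all add: unit_def if_distrib[of "\<lambda>z. z * _"] if_distrib[of "\<lambda>z. _ * z"] cong: if_cong)

lemma form_unit: "i < n \<Longrightarrow> j < n \<Longrightarrow> form n A (unit i) (unit j) = A i j"
  by (simp add: form_def sum_unit mult.assoc flip: sum_distrib_left)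

lemma form_symmetric_iff:
  "(\<forall>x y. form n A x y = form n A y x) \<longleftrightarrow> (\<forall>i<n. \<forall>j<n. A i j = A j i)"
proof
  assume "\<forall>x y. form n A x y = form n A y x"
  then show "\<forall>i<n. \<forall>j<n. A i j = A j i" by (metis form_unit)
next
  assume *: "\<forall>i<n. \<forall>j<n. A i j = A j i"
  show "\<forall>x y. form n A x y = form n A y x"
  proof (intro allI)
    fix x y
    have "form n A x y = (\<Sum>j<n. \<Sum>i<n. x i * A i j * y j)"
      unfolding form_def by (rule sum.swap)
    also have "\<dots> = form n A y x"
      unfolding form_def by (intro sum.cong) (use * in auto)
    finally show "form n A x y = form n A y x" .
  qed
qed

section \<open>Unimodular matrices with a prescribed first column\<close>

lemma unim_id: "unim n (\<lambda>i j. if i = j then 1 else 0)"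
  by (simp add: unim_def)

lemma unim_mult: "unim n P \<Longrightarrow> unim n Q \<Longrightarrow> unim n (\<lambda>i j. \<Sum>k<n. P i k * Q k j)"
  by (simp add: unim_def fdet_mult abs_mult)

text \<open>The block matrix diag(1, Q): a change of basis that keeps the first basis vector and
  mixes the others among themselves.\<close>

definition block1 :: "(nat \<Rightarrow> nat \<Rightarrow> int) \<Rightarrow> nat \<Rightarrow> nat \<Rightarrow> int" where
  "block1 Q i j = (case i of 0 \<Rightarrow> (if j = 0 then 1 else 0)
     | Suc i' \<Rightarrow> (case j of 0 \<Rightarrow> 0 | Suc j' \<Rightarrow> Q i' j'))"

lemma block1_simps [simp]: "block1 Q 0 0 = 1" "block1 Q 0 (Suc j) = 0" "block1 Q (Suc i) 0 = 0"
  "block1 Q (Suc i) (Suc j) = Q i j"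
  by (simp_all add: block1_def)

lemma unim_block1: "unim n Q \<Longrightarrow> unim (Suc n) (block1 Q)"
  by (simp add: unim_def fdet_Suc_upper)

text \<open>The first column of E = X Y is the sum of columns 0 and \<open>Suc j\<close> of
  \<open>X\<close>, that is e_0 + ((t - 1) e_0 + e_(j+1)). Both factors are triangular with unit
  diagonal.\<close>

lemma shear_column:
  assumes "j < n"
  obtains E where "unim (Suc n) E" "E 0 0 = t" "\<And>i. i < n \<Longrightarrow> E (Suc i) 0 = (if i = j then 1 else 0)"
proof -
  define X where "X i k = (if i = 0 \<and> k = Suc j then t - 1 else if i = k then 1 else 0)" for i k :: nat
  define Y where "Y i k = (if i = Suc j \<and> k = 0 then 1 else if i = k then 1 else 0 :: int)" for i k :: nat
  have X: "unim (Suc n) X" unfolding unim_def by (subst fdet_Suc_upper) (auto simp: X_def)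
  have Y: "unim (Suc n) Y" unfolding unim_def by (subst fdet_Suc_lower) (auto simp: Y_def)
  define E where "E i k = (\<Sum>l<Suc n. X i l * Y l k)" for i k
  have Y0: "Y l 0 = unit 0 l + unit (Suc j) l" for l
    by (auto simp: Y_def unit_def)
  have "E i 0 = X i 0 + X i (Suc j)" for i
    unfolding E_def Y0 distrib_left sum.distrib using assms by (subst (1 2) sum_unit) auto
  moreover have "unim (Suc n) E"
    unfolding E_def[abs_def] by (rule unim_mult[OF X Y])
  ultimately show thesis
    by (intro that[of E]) (auto simp: X_def)
qed

text \<open>Lifts a basis vector of the lattice modulo its first basis vector. The new coordinate
  \<open>t\<close> stays free, which Hermite's argument exploits.\<close>

lemma unim_cons_column:
  assumes "unim (Suc n) Q"
  obtains R where "unim (Suc (Suc n)) R" "R 0 0 = t" "\<And>i. i \<le> n \<Longrightarrow> R (Suc i) 0 = Q i 0"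
proof -
  obtain E where E: "unim (Suc (Suc n)) E" "E 0 0 = t"
    "\<And>i. i < Suc n \<Longrightarrow> E (Suc i) 0 = (if i = 0 then 1 else 0)"
    using shear_column[of 0 "Suc n" t] by auto
  let ?R = "\<lambda>i j. \<Sum>k<Suc (Suc n). block1 Q i k * E k j"
  have "?R 0 0 = t" using E by (simp add: sum.lessThan_Suc_shift del: sum.lessThan_Suc)
  moreover have "?R (Suc i) 0 = (\<Sum>k<Suc n. Q i k * unit 0 k)" for i
    unfolding sum.lessThan_Suc_shift[of _ "Suc n"]
    by (simp add: unit_def E(3) del: sum.lessThan_Suc)
  ultimately show thesis
    using unim_mult[OF unim_block1[OF assms] E(1)] by (intro that[of ?R]) (simp_all add: sum_unit del: sum.lessThan_Suc)
qed

text \<open>The Schur complement S is multiplied by the pivot a = \<open>A 0 0\<close> to stay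
  integral. The columns of \<open>E\<close> are e_0 and the vectors a e_j - A_0j e_0 orthogonal to
  it; they have Gram matrix diag(a, a S), whence a^(2n) det A = a^(n+1) det S.\<close>

lemma fdet_schur:
  fixes A :: "nat \<Rightarrow> nat \<Rightarrow> int"
  assumes sym: "\<And>i j. i \<le> n \<Longrightarrow> j \<le> n \<Longrightarrow> A i j = A j i" and a: "A 0 0 \<noteq> 0"
  shows "A 0 0 * fdet n (\<lambda>i j. A 0 0 * A (Suc i) (Suc j) - A 0 (Suc i) * A 0 (Suc j))
    = A 0 0 ^ n * fdet (Suc n) A"
proof -
  let ?a = "A 0 0"
  define S where "S i j = ?a * A (Suc i) (Suc j) - A 0 (Suc i) * A 0 (Suc j)" for i j
  define E where "E k j = (case j of 0 \<Rightarrow> (if k = 0 then 1 else 0)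
     | Suc j \<Rightarrow> (case k of 0 \<Rightarrow> - A 0 (Suc j) | Suc k \<Rightarrow> ?a * unit j k))" for k j
  have detE: "fdet (Suc n) E = ?a ^ n"
  proof -
    have "fdet (Suc n) E = fdet n (\<lambda>i j. ?a * (if i = j then 1 else 0))"
      by (simp add: fdet_Suc_upper E_def unit_def)
    then show ?thesis by (simp only: fdet_scale fdet_id)
  qed
  have E_simps: "E 0 0 = 1" "E (Suc k) 0 = 0" "E 0 (Suc j) = - A 0 (Suc j)" "E (Suc k) (Suc j) = ?a * unit j k" for j k
    by (simp_all add: E_def)
  have G0: "gram (Suc n) A E 0 (Suc j) = 0" if "j < n" for j
    using that by (simp add: gram_def form_Suc E_simps sum_unit mult.left_commute flip: sum_distrib_left)
  have GS: "gram (Suc n) A E (Suc i) (Suc j) = ?a * S i j" if "i < n" "j < n" for i j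
  proof -
    have "(\<Sum>k<n. ?a * unit i k * A (Suc k) 0) = ?a * A 0 (Suc i)"
      using that sym[of "Suc i" 0] by (simp add: sum_unit mult.assoc flip: sum_distrib_left)
    moreover have "(\<Sum>k<n. A 0 (Suc k) * (?a * unit j k)) = ?a * A 0 (Suc j)"
      using that by (simp add: sum_unit mult.left_commute flip: sum_distrib_left)
    ultimately show ?thesis
      using that unfolding gram_def form_Suc E_simps form_scale_left form_scale_right
      by (simp add: form_unit S_def algebra_simps)
  qed
  have "fdet (Suc n) (gram (Suc n) A E) = gram (Suc n) A E 0 0 * fdet n (\<lambda>i j. gram (Suc n) A E (Suc i) (Suc j))"
    by (intro fdet_Suc_lower G0)
  also have "gram (Suc n) A E 0 0 = ?a"
    by (simp add: gram_def form_Suc E_simps)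
  also have "fdet n (\<lambda>i j. gram (Suc n) A E (Suc i) (Suc j)) = fdet n (\<lambda>i j. ?a * S i j)"
    by (intro fdet_cong GS)
  finally have "(?a ^ n)\<^sup>2 * fdet (Suc n) A = ?a * (?a ^ n * fdet n S)"
    by (simp add: fdet_gram detE fdet_scale)
  then have "?a ^ n * (?a * fdet n S) = ?a ^ n * (?a ^ n * fdet (Suc n) A)"
    by (simp only: power2_eq_square mult_ac)
  then show ?thesis
    using a by (simp add: S_def[abs_def])
qed

lemma exists_small_residue:
  fixes a b :: int
  assumes "a \<noteq> 0"
  obtains t where "2 * \<bar>a * t + b\<bar> \<le> \<bar>a\<bar>"
proof -
  have pos: "\<exists>t. 2 * \<bar>c * t + b\<bar> \<le> c" if "c > 0" for c
  proof -
    \<comment> \<open>Rounds -b / c to a nearest integer.\<close>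
    define t where "t = - ((2 * b + c) div (2 * c))"
    have eq: "2 * b + c = (2 * c) * ((2 * b + c) div (2 * c)) + (2 * b + c) mod (2 * c)"
      by simp
    have r: "0 \<le> (2 * b + c) mod (2 * c)" "(2 * b + c) mod (2 * c) < 2 * c"
      using that by simp_all
    have "2 * (c * t + b) = (2 * b + c) mod (2 * c) - c"
      using eq by (simp add: t_def algebra_simps)
    then have "2 * \<bar>c * t + b\<bar> \<le> c" using r by (simp add: abs_if split: if_splits)
    then show ?thesis by blast
  qed
  show thesis
  proof (cases "a > 0")
    case True
    then show ?thesis using pos[of a] that by auto
  next
    case False
    then obtain t where "2 * \<bar>(- a) * t + b\<bar> \<le> - a" using pos[of "- a"] assms by auto
    then show ?thesis using that[of "- t"] False by simp
  qed
qed

section \<open>Hermite reduction\<close>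

lemma form_cons_diag:
  "form (Suc n) A (case_nat t w) (case_nat t w) = A 0 0 * t\<^sup>2 + t * (\<Sum>j<n. A 0 (Suc j) * w j)
     + t * (\<Sum>j<n. A (Suc j) 0 * w j) + form n (\<lambda>i j. A (Suc i) (Suc j)) w w"
  by (simp add: form_Suc power2_eq_square algebra_simps)

text \<open>With N = n + 1 this is |a| \<le> (4/3)^((N-1)/2) |det|^(1/N), raised to the power N.
  Absolute values make the classical argument work for indefinite forms: if the least |a| over all
  bases is not 0, a vector that is short for the scaled Schur complement, lifted with a small
  component along the first basis vector, gives a^2 \<le> a^2/4 + |c|. The induction adds up the
  exponents to triangular numbers.\<close>

lemma hermite_reduction:
  assumes "\<And>i j. i \<le> n \<Longrightarrow> j \<le> n \<Longrightarrow> A i j = A j i"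
  shows "\<exists>P. unim (Suc n) P \<and>
    \<bar>gram (Suc n) A P 0 0\<bar> ^ Suc n * 3 ^ (\<Sum>{..n}) \<le> 4 ^ (\<Sum>{..n}) * \<bar>fdet (Suc n) A\<bar>"
  using assms
proof (induction n arbitrary: A)
  case 0
  have "gram (Suc 0) A (\<lambda>i j. if i = j then 1 else 0) 0 0 = A 0 0"
    by (simp add: gram_def form_def)
  then show ?case
    by (intro exI[of _ "\<lambda>i j. if i = j then 1 else 0"]) (auto simp: unim_id)
next
  case (Suc n)
  define N where "N = Suc (Suc n)"
  have sym: "\<forall>x y. form N A x y = form N A y x"
    unfolding form_symmetric_iff using Suc.prems by (auto simp: N_def)
  let ?f = "\<lambda>P. nat \<bar>gram N A P 0 0\<bar>"
  \<comment> \<open>A basis whose first vector has the least absolute norm exists by well-ordering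
    of the naturals.\<close>
  obtain P where P: "unim N P" and min: "\<And>Q. unim N Q \<Longrightarrow> ?f P \<le> ?f Q"
    using ex_has_least_nat[of "unim N" _ ?f] unim_id by blast
  define B where "B = gram N A P"
  define a where "a = B 0 0"
  have Bsym: "B i j = B j i" for i j
    unfolding B_def gram_def using sym by blast
  have Bmin: "\<bar>a\<bar> \<le> \<bar>gram N B Q 0 0\<bar>" if "unim N Q" for Q
    using min[OF unim_mult[OF P that]] by (simp add: B_def gram_gram a_def)
  have detB: "\<bar>fdet N B\<bar> = \<bar>fdet N A\<bar>"
  proof -
    have "(fdet N P)\<^sup>2 = 1" using P by (metis power2_abs power_one unim_def)
    then show ?thesis by (simp add: B_def fdet_gram)
  qed
  show ?case
  proof (cases "a = 0")
    case True
    then show ?thesis using P unfolding N_def[symmetric] by (intro exI[of _ P]) (auto simp: a_def B_def N_def)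
  next
    case a: False
    define C where "C i j = a * B (Suc i) (Suc j) - B 0 (Suc i) * B 0 (Suc j)" for i j
    have "a * fdet (Suc n) C = a ^ Suc n * fdet N B"
      unfolding C_def[abs_def] a_def N_def by (rule fdet_schur) (use Bsym a in \<open>auto simp: a_def\<close>)
    then have detC: "fdet (Suc n) C = a ^ n * fdet N B"
      using a by simp
    have "C i j = C j i" for i j unfolding C_def using Bsym by (simp add: mult.commute)
    then obtain Q where Q: "unim (Suc n) Q" and bound:
      "\<bar>gram (Suc n) C Q 0 0\<bar> ^ Suc n * 3 ^ (\<Sum>{..n}) \<le> 4 ^ (\<Sum>{..n}) * \<bar>fdet (Suc n) C\<bar>"
      using Suc.IH[of C] by blast
    define w where "w k = Q k 0" for k
    define b where "b = (\<Sum>j<Suc n. B 0 (Suc j) * w j)"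
    define c where "c = gram (Suc n) C Q 0 0"
    let ?B' = "\<lambda>i j. B (Suc i) (Suc j)"
    have c_eq: "c = a * form (Suc n) ?B' w w - b\<^sup>2"
    proof -
      have "c = (\<Sum>i<Suc n. \<Sum>j<Suc n. a * (w i * ?B' i j * w j) - (B 0 (Suc i) * w i) * (B 0 (Suc j) * w j))"
        unfolding c_def gram_def form_def C_def w_def by (intro sum.cong) (auto simp: algebra_simps)
      also have "\<dots> = a * form (Suc n) ?B' w w - b * b"
        unfolding sum_subtractf form_def b_def sum_product by (simp only: sum_distrib_left)
      finally show ?thesis by (simp add: power2_eq_square)
    qed
    obtain t where t: "2 * \<bar>a * t + b\<bar> \<le> \<bar>a\<bar>" using exists_small_residue[OF a] by blast
    obtain R where R: "unim N R" "R 0 0 = t" "\<And>i. i \<le> n \<Longrightarrow> R (Suc i) 0 = Q i 0"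
      unfolding N_def using unim_cons_column[OF Q] by blast
    have "gram N B R 0 0 = form N B (case_nat t w) (case_nat t w)"
      unfolding gram_def by (rule form_cong) (auto simp: R w_def N_def less_Suc_eq_le split: nat.split)
    also have "\<dots> = a * t\<^sup>2 + 2 * t * b + form (Suc n) ?B' w w"
      unfolding N_def form_cons_diag Bsym[of "Suc _" 0] a_def b_def by simp
    \<comment> \<open>Completing the square: \<open>a\<close> times the norm of the lifted vector
      splits into a part along the first basis vector and the Schur part \<open>c\<close>.\<close>
    finally have "a * gram N B R 0 0 = (a * t + b)\<^sup>2 + c"
      by (simp add: c_eq power2_eq_square algebra_simps)
    then have "\<bar>a\<bar> * \<bar>gram N B R 0 0\<bar> \<le> (a * t + b)\<^sup>2 + \<bar>c\<bar>"
      by (metis abs_mult abs_triangle_ineq abs_power2)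
    moreover have "\<bar>a\<bar> * \<bar>a\<bar> \<le> \<bar>a\<bar> * \<bar>gram N B R 0 0\<bar>"
      by (intro mult_left_mono Bmin R) auto
    moreover have "4 * (a * t + b)\<^sup>2 \<le> a\<^sup>2"
    proof -
      have "(2 * \<bar>a * t + b\<bar>)\<^sup>2 \<le> \<bar>a\<bar>\<^sup>2" by (intro power_mono t) auto
      then show ?thesis by (simp add: power_mult_distrib)
    qed
    ultimately have key: "3 * \<bar>a\<bar>\<^sup>2 \<le> 4 * \<bar>c\<bar>"
      by (simp add: power2_eq_square)
    let ?T = "\<Sum>{..n}"
    \<comment> \<open>\<open>\<bar>a\<bar> ^ n\<close> is the factor between the determinants of
      \<open>C\<close> and \<open>B\<close>; it is carried along and cancelled at the end.\<close>
    have s1: "\<bar>a\<bar> ^ n * (\<bar>a\<bar> ^ N * 3 ^ (\<Sum>{..Suc n})) = (3 * \<bar>a\<bar>\<^sup>2) ^ Suc n * 3 ^ ?T"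
    proof -
      have "x ^ n * (x ^ N * (3 ^ Suc n * z)) = (3 * x\<^sup>2) ^ Suc n * z" for x z :: int
        unfolding N_def by (simp add: power_mult_distrib power_add power2_eq_square mult_ac)
      moreover have "3 ^ (\<Sum>{..Suc n}) = 3 ^ Suc n * (3 :: int) ^ ?T"
        by (simp add: power_add)
      ultimately show ?thesis by presburger
    qed
    have s2: "(3 * \<bar>a\<bar>\<^sup>2) ^ Suc n * 3 ^ ?T \<le> (4 * \<bar>c\<bar>) ^ Suc n * 3 ^ ?T"
      by (intro mult_right_mono power_mono key) auto
    have s3: "(4 * \<bar>c\<bar>) ^ Suc n * 3 ^ ?T = 4 ^ Suc n * (\<bar>c\<bar> ^ Suc n * 3 ^ ?T)"
      by (simp only: power_mult_distrib mult.assoc)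
    have s4: "4 ^ Suc n * (\<bar>c\<bar> ^ Suc n * 3 ^ ?T) \<le> 4 ^ Suc n * (4 ^ ?T * \<bar>fdet (Suc n) C\<bar>)"
      unfolding c_def by (intro mult_left_mono bound) auto
    have s5: "4 ^ Suc n * (4 ^ ?T * \<bar>fdet (Suc n) C\<bar>) = \<bar>a\<bar> ^ n * (4 ^ (\<Sum>{..Suc n}) * \<bar>fdet N A\<bar>)"
      by (simp add: detC abs_mult power_abs detB power_add mult_ac)
    have "\<bar>a\<bar> ^ n * (\<bar>a\<bar> ^ N * 3 ^ (\<Sum>{..Suc n})) \<le> \<bar>a\<bar> ^ n * (4 ^ (\<Sum>{..Suc n}) * \<bar>fdet N A\<bar>)"
      using s1 s2 s3 s4 s5 by linarith
    then have "\<bar>a\<bar> ^ N * 3 ^ (\<Sum>{..Suc n}) \<le> 4 ^ (\<Sum>{..Suc n}) * \<bar>fdet N A\<bar>"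
      using a by (subst (asm) mult_le_cancel_left_pos) auto
    then show ?thesis using P unfolding a_def B_def N_def by blast
  qed
qed

section \<open>Primitive vectors and splitting off a vector from a lattice\<close>

lemma row_reduction:
  obtains Q where "unim (Suc n) Q" "\<And>j. 0 < j \<Longrightarrow> j \<le> n \<Longrightarrow> (\<Sum>k\<le>n. r k * Q k j) = 0"
proof (cases "\<forall>k\<le>n. r k = 0")
  case True
  then show thesis by (intro that[of "\<lambda>i j. if i = j then 1 else 0"] unim_id) auto
next
  case False
  let ?N = "Suc n"
  let ?v = "\<lambda>Q j. \<Sum>k<?N. r k * Q k j"
  let ?ok = "\<lambda>Q. unim ?N Q \<and> ?v Q 0 \<noteq> 0"
  have v_mult: "?v (\<lambda>i j. \<Sum>l<?N. Q i l * E l j) j = (\<Sum>l<?N. ?v Q l * E l j)" for Q E j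
    unfolding sum_distrib_left sum_distrib_right by (subst sum.swap) (simp add: mult.assoc)
  have shear: "\<exists>Q'. unim ?N Q' \<and> ?v Q' 0 = ?v Q 0 * t + ?v Q (Suc j)"
    if Q: "unim ?N Q" and j: "j < n" for Q t j
  proof -
    obtain E where E: "unim ?N E" "E 0 0 = t" "\<And>i. i < n \<Longrightarrow> E (Suc i) 0 = (if i = j then 1 else 0)"
      using shear_column[OF j] by metis
    have "(\<Sum>l<?N. s l * E l 0) = s 0 * t + s (Suc j)" for s :: "nat \<Rightarrow> int"
    proof -
      have "(\<Sum>i<n. s (Suc i) * E (Suc i) 0) = (\<Sum>i<n. s (Suc i) * unit j i)"
        by (intro sum.cong) (auto simp: E unit_def)
      then show ?thesis
        using j by (simp add: sum.lessThan_Suc_shift sum_unit E del: sum.lessThan_Suc)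
    qed
    then have "?v (\<lambda>i j. \<Sum>l<?N. Q i l * E l j) 0 = ?v Q 0 * t + ?v Q (Suc j)"
      unfolding v_mult .
    then show ?thesis
      by (intro exI[of _ "\<lambda>i j. \<Sum>l<?N. Q i l * E l j"] conjI unim_mult Q E(1))
  qed
  have v_id: "?v (\<lambda>i j. if i = j then 1 else 0) j = r j" if "j < ?N" for j
  proof -
    have "?v (\<lambda>i j. if i = j then 1 else 0) j = (\<Sum>k<?N. r k * unit j k)"
      by (simp add: unit_def)
    then show ?thesis using that by (simp only: sum_unit)
  qed
  have "\<exists>Q. ?ok Q"
  proof (cases "r 0 = 0")
    case True
    with False obtain j where "j < n" "r (Suc j) \<noteq> 0" by (metis Suc_le_lessD not0_implies_Suc)
    then show ?thesis using shear[OF unim_id, of j 0] True v_id[of 0] v_id[of "Suc j"] by auto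
  next
    case False
    then show ?thesis using v_id[of 0] by (intro exI[of _ "\<lambda>i j. if i = j then 1 else 0"] conjI unim_id) simp
  qed
  \<comment> \<open>Euclid's algorithm as a minimality argument: a first entry of least nonzero
    absolute value divides the other entries, since a remainder could be moved into its place and
    would be smaller.\<close>
  then obtain Q where Q: "unim ?N Q" "?v Q 0 \<noteq> 0"
    and min: "\<And>Q'. ?ok Q' \<Longrightarrow> nat \<bar>?v Q 0\<bar> \<le> nat \<bar>?v Q' 0\<bar>"
    using ex_has_least_nat[of ?ok _ "\<lambda>Q. nat \<bar>?v Q 0\<bar>"] by blast
  have dvd: "?v Q 0 dvd ?v Q (Suc j)" if j: "j < n" for j
  proof (rule ccontr)
    assume nd: "\<not> ?v Q 0 dvd ?v Q (Suc j)"
    define m where "m = ?v Q (Suc j) mod ?v Q 0"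
    have m: "m \<noteq> 0" "\<bar>m\<bar> < \<bar>?v Q 0\<bar>"
      using nd Q(2) unfolding m_def by (auto simp: dvd_eq_mod_eq_0 abs_mod_less)
    have "m = ?v Q 0 * - (?v Q (Suc j) div ?v Q 0) + ?v Q (Suc j)"
      using mult_div_mod_eq[of "?v Q 0" "?v Q (Suc j)"] unfolding m_def by linarith
    then obtain Q' where "unim ?N Q'" "?v Q' 0 = m"
      using shear[OF Q(1) j] by metis
    with min[of Q'] m show False by auto
  qed
  define E where "E i j = (if i = 0 \<and> j \<noteq> 0 then - (?v Q j div ?v Q 0) else if i = j then 1 else 0)"
    for i j :: nat
  have E: "unim ?N E" unfolding unim_def by (subst fdet_Suc_upper) (auto simp: E_def)
  show thesis
  proof (rule that[of "\<lambda>i j. \<Sum>l<?N. Q i l * E l j"])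
    fix j assume "0 < j" "j \<le> n"
    then obtain i where i: "j = Suc i" "i < n" by (metis Suc_le_lessD gr0_implies_Suc)
    have "(\<Sum>l<n. ?v Q (Suc l) * E (Suc l) j) = (\<Sum>l<n. ?v Q (Suc l) * unit i l)"
      by (intro sum.cong) (auto simp: E_def i unit_def)
    then have "?v (\<lambda>i j. \<Sum>l<?N. Q i l * E l j) j = ?v Q 0 * E 0 j + ?v Q j"
      unfolding v_mult using i sum.lessThan_Suc_shift[of "\<lambda>l. ?v Q l * E l j" n]
      by (simp only: sum_unit)
    also have "\<dots> = 0"
      using dvd[OF i(2)] i by (simp add: E_def)
    finally show "(\<Sum>k\<le>n. r k * (\<Sum>l<?N. Q k l * E l j)) = 0"
      by (simp only: lessThan_Suc_atMost)
  qed (rule unim_mult[OF Q(1) E])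
qed

lemma form_mulv_right_zero:
  assumes "\<And>j. j < k \<Longrightarrow> form n A w (\<lambda>i. S i j) = 0"
  shows "form n A w (mulv k S y) = 0"
proof -
  have "mulv k S y = (\<lambda>i. \<Sum>l<k. y l * S i l)"
    by (simp add: fun_eq_iff mulv_def mult.commute)
  then show ?thesis by (simp add: form_sum_right form_scale_right assms)
qed

lemma mulv_zero_imp:
  assumes "fdet n P \<noteq> 0" "\<And>i. i < n \<Longrightarrow> mulv n P x i = 0" "i < n"
  shows "x i = 0"
proof -
  obtain C where C: "\<And>i j. i < n \<Longrightarrow> j < n \<Longrightarrow> (\<Sum>k<n. C i k * P k j) = (if i = j then fdet n P else 0)"
    using fdet_adjugate[of n P] by metis
  have "0 = (\<Sum>k<n. C i k * mulv n P x k)" using assms(2) by simp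
  also have "\<dots> = (\<Sum>j<n. (\<Sum>k<n. C i k * P k j) * x j)"
    unfolding mulv_def sum_distrib_left sum_distrib_right by (subst sum.swap) (simp add: mult.assoc)
  also have "\<dots> = (\<Sum>j<n. fdet n P * (unit i j * x j))"
    by (intro sum.cong) (auto simp: C assms(3) unit_def)
  also have "\<dots> = fdet n P * x i"
    by (simp add: sum_unit assms(3) flip: sum_distrib_left)
  finally show ?thesis using assms(1) by simp
qed

lemma form_nondegenerate:
  assumes "fdet n A \<noteq> 0" "\<And>y. form n A y x = 0" "i < n"
  shows "x i = 0"
proof (rule mulv_zero_imp[OF assms(1) _ assms(3)])
  fix k assume "k < n"
  then have "form n A (unit k) x = mulv n A x k"
    by (simp add: form_def mulv_def sum_unit mult.assoc flip: sum_distrib_left)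
  then show "mulv n A x k = 0" using assms(2) by simp
qed

lemma unim_column_nonzero:
  assumes "unim (Suc n) P"
  obtains i where "i \<le> n" "P i 0 \<noteq> 0"
proof -
  have "mulv (Suc n) P (unit 0) i = P i 0" for i
    unfolding mulv_def by (rule sum_unit) simp
  moreover have "fdet (Suc n) P \<noteq> 0" using assms by (auto simp: unim_def)
  ultimately show thesis
    using mulv_zero_imp[of "Suc n" P "unit 0" 0] that by (force simp: unit_def less_Suc_eq_le)
qed

text \<open>Row reduction of x as a row gives x^T Q = (g, 0, ..., 0), so x is g times the first row
  of the inverse of \<open>Q\<close>. With d = det Q = +-1 that inverse is d times the adjugate
  \<open>C\<close>, and the sign moves into the factor g.\<close>

lemma primitive_extension:
  assumes "i\<^sub>0 \<le> n" "x i\<^sub>0 \<noteq> 0"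
  obtains P g where "unim (Suc n) P" "g \<noteq> 0" "\<And>i. i \<le> n \<Longrightarrow> x i = g * P i 0"
proof -
  let ?N = "Suc n"
  obtain Q where Q: "unim ?N Q" and Qx: "\<And>j. 0 < j \<Longrightarrow> j \<le> n \<Longrightarrow> (\<Sum>k\<le>n. x k * Q k j) = 0"
    using row_reduction[of n x] by metis
  define d where "d = fdet ?N Q"
  have d: "d * d = 1" using Q unfolding unim_def d_def by (metis abs_mult_self_eq mult_1)
  obtain C where C: "\<And>i j. i < ?N \<Longrightarrow> j < ?N \<Longrightarrow> (\<Sum>k<?N. Q i k * C k j) = (if i = j then d else 0)"
    unfolding d_def using fdet_adjugate[of ?N Q] by metis
  define g where "g = (\<Sum>k\<le>n. x k * Q k 0)"
  have x: "x i * d = g * C 0 i" if "i \<le> n" for i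
  proof -
    have "x i * d = (\<Sum>k<?N. x k * (\<Sum>j<?N. Q k j * C j i))"
    proof -
      have "(\<Sum>k<?N. x k * (\<Sum>j<?N. Q k j * C j i)) = (\<Sum>k<?N. x k * (unit i k * d))"
        by (intro sum.cong refl) (use that in \<open>simp add: C unit_def del: sum.lessThan_Suc\<close>)
      also have "\<dots> = x i * d"
        using that sum_unit(1)[of i ?N "\<lambda>k. x k * d"] by (simp only: mult.left_commute less_Suc_eq_le)
      finally show ?thesis ..
    qed
    also have "\<dots> = (\<Sum>j<?N. (\<Sum>k<?N. x k * Q k j) * C j i)"
      unfolding sum_distrib_left sum_distrib_right by (subst sum.swap) (simp only: mult.assoc)
    also have "\<dots> = g * C 0 i + (\<Sum>j<n. (\<Sum>k<?N. x k * Q k (Suc j)) * C (Suc j) i)"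
      unfolding sum.lessThan_Suc_shift[of _ n] g_def lessThan_Suc_atMost[symmetric]
      by (simp add: sum.lessThan_Suc_shift del: sum.lessThan_Suc)
    also have "(\<Sum>j<n. (\<Sum>k<?N. x k * Q k (Suc j)) * C (Suc j) i) = 0"
      using Qx by (intro sum.neutral) (simp add: lessThan_Suc_atMost)
    finally show ?thesis by simp
  qed
  have "fdet ?N Q * fdet ?N C = d ^ ?N"
  proof -
    have "fdet ?N Q * fdet ?N C = fdet ?N (\<lambda>i j. d * (if i = j then 1 else 0))"
      unfolding fdet_mult[symmetric] by (rule fdet_cong) (simp add: C del: sum.lessThan_Suc)
    then show ?thesis by (simp only: fdet_scale fdet_id mult_1_right)
  qed
  moreover have "\<bar>d\<bar> = 1" using Q by (simp add: unim_def d_def)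
  ultimately have "\<bar>fdet ?N C\<bar> = 1"
    by (metis abs_mult d_def mult_1 power_abs power_one)
  then have P: "unim ?N (\<lambda>i j. C j i)"
    by (simp add: unim_def fdet_transpose[of ?N C])
  have x': "x i = (g * d) * C 0 i" if "i \<le> n" for i
    using x[OF that] d by (metis mult.assoc mult.commute mult_1)
  have "g * d \<noteq> 0" using x'[of i\<^sub>0] assms by auto
  then show thesis using that[OF P _ x'] by simp
qed

lemma gram_block1:
  "gram (Suc n) A (block1 Q) 0 0 = A 0 0"
  "gram (Suc n) A (block1 Q) 0 (Suc j) = (\<Sum>k<n. A 0 (Suc k) * Q k j)"
  by (simp_all add: gram_def form_Suc)

text \<open>An isotropic vector, made the first basis vector, is paired with a second one so that
  the remaining basis vectors span a lattice isometric to its orthogonal complement modulo itself.\<close>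

lemma isotropic_splitting:
  fixes n :: nat
  defines "N \<equiv> Suc (Suc n)"
  assumes even: "even_form N A" and det: "\<bar>fdet N A\<bar> = 1"
    and x: "i\<^sub>0 < N" "x i\<^sub>0 \<noteq> 0" "form N A x x = 0"
  obtains P where "unim N P" "gram N A P 0 0 = 0" "\<And>j. j < n \<Longrightarrow> gram N A P 0 (Suc (Suc j)) = 0"
    "\<bar>fdet n (\<lambda>i j. gram N A P (Suc (Suc i)) (Suc (Suc j)))\<bar> = 1"
proof -
  obtain P1 g where P1: "unim N P1" and g: "g \<noteq> 0" and gx: "\<And>i. i < N \<Longrightarrow> x i = g * P1 i 0"
    using primitive_extension[of i\<^sub>0 "Suc n" x] x unfolding N_def less_Suc_eq_le by metis
  let ?B1 = "gram N A P1"
  have "form N A x x = form N A (\<lambda>i. g * P1 i 0) (\<lambda>i. g * P1 i 0)"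
    by (rule form_cong) (auto simp: gx)
  then have B1: "?B1 0 0 = 0"
    using x(3) g by (simp add: form_scale_left form_scale_right gram_def)
  \<comment> \<open>Acts on all basis vectors but the first and leaves at most one of them with a
    nonzero pairing with it.\<close>
  obtain Q where Q: "unim (Suc n) Q"
    and Qr: "\<And>j. 0 < j \<Longrightarrow> j \<le> n \<Longrightarrow> (\<Sum>k\<le>n. ?B1 0 (Suc k) * Q k j) = 0"
    using row_reduction[of n "\<lambda>k. ?B1 0 (Suc k)"] by metis
  define P where "P i j = (\<Sum>k<N. P1 i k * block1 Q k j)" for i j
  define B where "B = gram N A P"
  have B_eq: "B = gram N ?B1 (block1 Q)"
    by (simp add: B_def P_def[abs_def] gram_gram)
  have P: "unim N P"
    unfolding P_def[abs_def] N_def by (rule unim_mult[OF P1[unfolded N_def] unim_block1[OF Q]])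
  have B00: "B 0 0 = 0"
    unfolding B_eq N_def gram_block1 using B1 by (simp add: N_def)
  have B0: "B 0 (Suc (Suc j)) = 0" if "j < n" for j
    unfolding B_eq N_def gram_block1 using Qr[of "Suc j"] that by (simp add: N_def lessThan_Suc_atMost)
  have Bsym: "B i j = B j i" for i j
    using even unfolding B_def gram_def even_form_def by blast
  define d where "d = fdet N B"
  have d: "\<bar>d\<bar> = 1"
    using P det unfolding d_def B_def fdet_gram unim_def by (simp add: abs_mult power_abs)
  obtain C where C: "\<And>i j. i < N \<Longrightarrow> j < N \<Longrightarrow> (\<Sum>k<N. B i k * C k j) = (if i = j then d else 0)"
    unfolding d_def using fdet_adjugate[of N B] by metis
  have split: "(\<Sum>k<N. f k) = f 0 + f 1 + (\<Sum>k<n. f (Suc (Suc k)))" for f :: "nat \<Rightarrow> int"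
    by (simp add: N_def sum.lessThan_Suc_shift del: sum.lessThan_Suc)
  \<comment> \<open>Row 0 of B C = d I involves only the entry \<open>B 0 1\<close>. Hence row 1 of
    \<open>C\<close> vanishes from index 2 on, so the lower right blocks of \<open>B\<close> and
    \<open>C\<close> already multiply to d I, and both have determinant +-1.\<close>
  have row0: "B 0 1 * C 1 j = (if j = 0 then d else 0)" if "j < N" for j
    using C[of 0 j] that unfolding split by (simp add: B00 B0 N_def)
  from row0[of 0] d have b: "B 0 1 \<noteq> 0" by (auto simp: N_def)
  have C1: "C 1 (Suc (Suc j)) = 0" if "j < n" for j
    using row0[of "Suc (Suc j)"] b that by (simp add: N_def)
  let ?M = "\<lambda>i j. B (Suc (Suc i)) (Suc (Suc j))" and ?C = "\<lambda>i j. C (Suc (Suc i)) (Suc (Suc j))"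
  have "(\<Sum>k<n. ?M i k * ?C k j) = d * (if i = j then 1 else 0)" if "i < n" "j < n" for i j
    using C[of "Suc (Suc i)" "Suc (Suc j)"] that unfolding split
    by (simp add: C1[unfolded One_nat_def] B0 Bsym[of "Suc (Suc i)" 0] N_def)
  then have "fdet n ?M * fdet n ?C = fdet n (\<lambda>i j. d * (if i = j then 1 else 0))"
    unfolding fdet_mult[symmetric] by (intro fdet_cong) auto
  also have "\<dots> = d ^ n" by (simp only: fdet_scale fdet_id mult_1_right)
  finally have "\<bar>fdet n ?M\<bar> * \<bar>fdet n ?C\<bar> = 1"
    using d by (metis abs_mult power_abs power_one)
  then have "\<bar>fdet n ?M\<bar> = 1"
    by (auto simp: zmult_eq_1_iff)
  then show thesis
    using that[OF P] B00 B0 unfolding B_def by blast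
qed

text \<open>\<open>w\<close> and the columns of \<open>S\<close> span a sublattice of index 2. Its
  determinant is 4 times that of \<open>A\<close> and, up to sign, also 2 times that of the part
  orthogonal to \<open>w\<close>. The columns of \<open>S\<close> need not generate the full
  orthogonal complement.\<close>

lemma norm_two_complement:
  fixes n :: nat
  defines "N \<equiv> Suc (Suc n)"
  assumes even: "even_form N A" and P1: "unim N P1"
    and e: "gram N A P1 0 0 = 2 * e" "\<bar>e\<bar> = 1"
  obtains w S where "form N A w w = 2 * e" "\<And>y. form N A w (mulv (Suc n) S y) = 0"
    "even_form (Suc n) (gram N A S)" "\<bar>fdet (Suc n) (gram N A S)\<bar> = 2 * \<bar>fdet N A\<bar>"
proof -
  let ?B1 = "gram N A P1"
  obtain Q where Q: "unim (Suc n) Q"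
    and Qr: "\<And>j. 0 < j \<Longrightarrow> j \<le> n \<Longrightarrow> (\<Sum>k\<le>n. ?B1 0 (Suc k) * Q k j) = 0"
    using row_reduction[of n "\<lambda>k. ?B1 0 (Suc k)"] by metis
  define P where "P i j = (\<Sum>k<N. P1 i k * block1 Q k j)" for i j
  define B where "B = gram N A P"
  have B_eq: "B = gram N ?B1 (block1 Q)"
    by (simp add: B_def P_def[abs_def] gram_gram)
  have P: "unim N P"
    unfolding P_def[abs_def] N_def by (rule unim_mult[OF P1[unfolded N_def] unim_block1[OF Q]])
  have B00: "B 0 0 = 2 * e"
    unfolding B_eq N_def gram_block1 using e by (simp add: N_def)
  have B0: "B 0 (Suc (Suc j)) = 0" if "j < n" for j
    unfolding B_eq N_def gram_block1 using Qr[of "Suc j"] that by (simp add: N_def lessThan_Suc_atMost)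
  have Bsym: "form N B x y = form N B y x" for x y
    using even unfolding B_def form_gram even_form_def by blast
  have evenB: "even_form N B" unfolding B_def by (rule even_form_gram[OF even])
  \<comment> \<open>Column 0 corrects the one basis vector that may pair nontrivially with the
    first: 2 e_1 - (B_01 e) e_0 is orthogonal to e_0, because \<open>B 0 0 = 2 * e\<close> and
    \<open>e * e = 1\<close>. The basis vectors in the other columns are orthogonal to e_0
    already.\<close>
  define R where "R i j = (case j of 0 \<Rightarrow> (if i = 0 then - (B 0 1 * e) else if i = 1 then 2 else 0)
     | Suc k \<Rightarrow> unit (Suc (Suc k)) i)" for i j :: nat
  define T where "T i j = (case j of 0 \<Rightarrow> unit 0 i | Suc k \<Rightarrow> R i k)" for i j
  have "fdet (Suc n) (\<lambda>i j. T (Suc i) (Suc j)) = 2"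
  proof (subst fdet_Suc_upper)
    have "fdet n (\<lambda>i j. T (Suc (Suc i)) (Suc (Suc j))) = fdet n (\<lambda>i j. if i = j then 1 else 0)"
      by (rule fdet_cong) (auto simp: T_def R_def unit_def)
    then show "T (Suc 0) (Suc 0) * fdet n (\<lambda>i j. T (Suc (Suc i)) (Suc (Suc j))) = 2"
      by (simp add: T_def R_def)
  qed (auto simp: T_def R_def unit_def)
  then have detT: "fdet N T = 2"
    unfolding N_def by (subst fdet_Suc_upper) (auto simp: T_def unit_def)
  have split: "(\<Sum>k<N. f k) = f 0 + f 1 + (\<Sum>k<n. f (Suc (Suc k)))" for f :: "nat \<Rightarrow> int"
    by (simp add: N_def sum.lessThan_Suc_shift del: sum.lessThan_Suc)
  have orth: "form N B (unit 0) (\<lambda>i. R i j) = 0" if "j < Suc n" for j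
  proof -
    have "form N B (unit 0) (\<lambda>i. R i j) = (\<Sum>k<N. B 0 k * R k j)"
      by (simp add: form_def sum_unit mult.assoc N_def flip: sum_distrib_left del: sum.lessThan_Suc)
    also have "\<dots> = B 0 0 * R 0 j + B 0 1 * R 1 j"
      unfolding split using B0 by simp
    also have "\<dots> = 0"
    proof -
      have "e * e = 1" using e(2) by (metis abs_mult_self_eq mult_1)
      then show ?thesis by (cases j) (simp_all add: R_def unit_def B00 mult.left_commute[of e])
    qed
    finally show ?thesis .
  qed
  have "fdet N (gram N B T) = 2 * e * fdet (Suc n) (gram N B R)"
  proof -
    have "fdet N (gram N B T) = gram N B T 0 0 * fdet (Suc n) (\<lambda>i j. gram N B T (Suc i) (Suc j))"
      unfolding N_def by (rule fdet_Suc_lower) (use orth in \<open>simp add: gram_def T_def N_def\<close>)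
    also have "gram N B T 0 0 = 2 * e"
      by (simp add: gram_def T_def form_unit N_def B00[unfolded N_def])
    also have "(\<lambda>i j. gram N B T (Suc i) (Suc j)) = gram N B R"
      by (simp add: fun_eq_iff gram_def T_def)
    finally show ?thesis .
  qed
  then have "\<bar>4 * fdet N B\<bar> = \<bar>2 * e * fdet (Suc n) (gram N B R)\<bar>"
    unfolding fdet_gram[of N B T] detT by simp
  then have "4 * \<bar>fdet N B\<bar> = 2 * \<bar>fdet (Suc n) (gram N B R)\<bar>"
    using e(2) unfolding abs_mult by simp
  moreover have "\<bar>fdet N B\<bar> = \<bar>fdet N A\<bar>"
    using P unfolding B_def fdet_gram unim_def by (simp add: abs_mult power_abs)
  ultimately have det: "\<bar>fdet (Suc n) (gram N B R)\<bar> = 2 * \<bar>fdet N A\<bar>" by simp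
  define S where "S i j = (\<Sum>k<N. P i k * R k j)" for i j
  have S: "gram N B R = gram N A S"
    by (simp add: B_def gram_gram S_def[abs_def])
  have mulvS: "mulv (Suc n) S y = mulv N P (mulv (Suc n) R y)" for y
    unfolding mulv_def[abs_def] S_def sum_distrib_left sum_distrib_right
    by (subst sum.swap) (simp only: mult.assoc)
  show thesis
  proof (rule that[of "mulv N P (unit 0)" S])
    show "form N A (mulv N P (unit 0)) (mulv N P (unit 0)) = 2 * e"
      using B00 unfolding form_gram[symmetric] B_def[symmetric] by (subst form_unit) (auto simp: N_def)
    show "form N A (mulv N P (unit 0)) (mulv (Suc n) S y) = 0" for y
      unfolding mulvS form_gram[symmetric] B_def[symmetric]
      by (rule form_mulv_right_zero) (rule orth)
    show "even_form (Suc n) (gram N A S)" by (rule even_form_gram[OF even])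
    show "\<bar>fdet (Suc n) (gram N A S)\<bar> = 2 * \<bar>fdet N A\<bar>" using det by (simp add: S)
  qed
qed

section \<open>Even unimodular lattices of signature \<open>(m, m)\<close>\<close>

text \<open>Repeatedly splitting off vectors of norm \<open>\<plusminus>2\<close>: the determinant of the complement
  at most doubles, so the Hermite bound stays below 4 and the values are even.\<close>

lemma isotropic_or_orthogonal_frame:
  assumes "even_form n A" "fdet n A \<noteq> 0" "r \<le> n"
    and "\<And>j. j < r \<Longrightarrow> 2 ^ j * \<bar>fdet n A\<bar> * 4 ^ (\<Sum>{..<n - j}) < 4 ^ (n - j) * 3 ^ (\<Sum>{..<n - j})"
  shows "(\<exists>x. (\<exists>i<n. x i \<noteq> 0) \<and> form n A x x = 0) \<or>
    (\<exists>e t. \<bar>e\<bar> = 1 \<and> (\<forall>i<r. \<forall>j<r. form n A (t i) (t j) = (if i = j then 2 * e else 0)))"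
  using assms
proof (induction r arbitrary: n A)
  case 0
  show ?case by (rule disjI2, rule exI[of _ 1]) auto
next
  case (Suc r)
  then obtain n' where n: "n = Suc n'" by (cases n) auto
  have sym: "A i j = A j i" if "i < n" "j < n" for i j
    using Suc.prems(1) that form_symmetric_iff[of n A] unfolding even_form_def by blast
  obtain P where P: "unim n P" and
    bound: "\<bar>gram n A P 0 0\<bar> ^ n * 3 ^ (\<Sum>{..<n}) \<le> 4 ^ (\<Sum>{..<n}) * \<bar>fdet n A\<bar>"
    using hermite_reduction[of n' A] sym unfolding n lessThan_Suc_atMost by (auto simp: less_Suc_eq_le)
  define a where "a = gram n A P 0 0"
  \<comment> \<open>This is the case j = 0 of the numerical hypothesis. The cases j > 0 are meant
    for the successive complements of rank n - j, whose determinants are 2^j times larger.\<close>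
  have "\<bar>a\<bar> ^ n * 3 ^ (\<Sum>{..<n}) < 4 ^ n * 3 ^ (\<Sum>{..<n})"
  proof -
    have "4 ^ (\<Sum>{..<n}) * \<bar>fdet n A\<bar> < 4 ^ n * 3 ^ (\<Sum>{..<n})"
      using Suc.prems(4)[of 0] by (simp add: mult.commute)
    with bound show ?thesis unfolding a_def by (rule le_less_trans)
  qed
  then have "\<bar>a\<bar> ^ n < 4 ^ n" by simp
  then have "\<bar>a\<bar> < 4" by (rule power_less_imp_less_base) simp
  moreover have "even a" using Suc.prems(1) by (simp add: a_def gram_def even_form_def)
  ultimately have "a \<in> {0, 2, -2}" by (auto simp: abs_if elim!: evenE split: if_splits)
  then consider "a = 0" | e where "a = 2 * e" "\<bar>e\<bar> = 1" by force
  then show ?case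
  proof cases
    case 1
    obtain i where "i \<le> n'" "P i 0 \<noteq> 0"
      using unim_column_nonzero P unfolding n by blast
    with 1 show ?thesis
      by (intro disjI1 exI[of _ "\<lambda>k. P k 0"]) (auto simp: a_def gram_def n less_Suc_eq_le)
  next
    case (2 e)
    show ?thesis
    proof (cases "r = 0")
      case True
      with 2 show ?thesis
        by (intro disjI2 exI[of _ e] exI[of _ "\<lambda>i k. P k 0"]) (auto simp: a_def gram_def)
    next
      case False
      with Suc.prems(3) n obtain m where m: "n = Suc (Suc m)" by (cases n') auto
      obtain w S where w: "form n A w w = 2 * e"
        and orth: "\<And>y. form n A w (mulv (Suc m) S y) = 0"
        and even: "even_form (Suc m) (gram n A S)"
        and det: "\<bar>fdet (Suc m) (gram n A S)\<bar> = 2 * \<bar>fdet n A\<bar>"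
        using norm_two_complement[of m A P e] Suc.prems(1) P 2 unfolding m a_def by metis
      have orth': "form n A (mulv (Suc m) S y) w = 0" for y
        using orth Suc.prems(1) unfolding even_form_def by metis
      let ?B = "gram n A S"
      have nz: "fdet (Suc m) ?B \<noteq> 0" using det Suc.prems(2) by auto
      have r: "r \<le> Suc m" using Suc.prems(3) m by simp
      have bnd: "2 ^ j * \<bar>fdet (Suc m) ?B\<bar> * 4 ^ (\<Sum>{..<Suc m - j}) < 4 ^ (Suc m - j) * 3 ^ (\<Sum>{..<Suc m - j})"
        if "j < r" for j
        using Suc.prems(4)[of "Suc j"] that unfolding det unfolding m by (simp add: mult.commute mult.left_commute)
      have "(\<exists>x. (\<exists>i<Suc m. x i \<noteq> 0) \<and> form (Suc m) ?B x x = 0) \<or>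
        (\<exists>e t. \<bar>e\<bar> = 1 \<and> (\<forall>i<r. \<forall>j<r. form (Suc m) ?B (t i) (t j) = (if i = j then 2 * e else 0)))"
        by (rule Suc.IH[OF even nz r]) (rule bnd)
      then show ?thesis
      proof (elim disjE exE conjE)
        fix x i assume x: "i < Suc m" "x i \<noteq> 0" "form (Suc m) ?B x x = 0"
        \<comment> \<open>\<open>S\<close> is injective because its Gram matrix is
          nondegenerate.\<close>
        have "\<exists>k<n. mulv (Suc m) S x k \<noteq> 0"
        proof (rule ccontr)
          assume "\<not> ?thesis"
          then have "form (Suc m) ?B y x = form n A (mulv (Suc m) S y) (\<lambda>_. 0)" for y
            unfolding form_gram by (intro form_cong) auto
          then show False using form_nondegenerate[OF nz _ x(1), of x] x(2) by simp
        qed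
        then show ?thesis using x(3) by (auto simp: form_gram)
      next
        fix e' t assume e': "\<bar>e'\<bar> = 1"
          and t: "\<forall>i<r. \<forall>j<r. form (Suc m) ?B (t i) (t j) = (if i = j then 2 * e' else 0)"
        show ?thesis
        proof (cases "e' = e")
          case True
          have "form n A (case_nat w (\<lambda>i. mulv (Suc m) S (t i)) i) (case_nat w (\<lambda>i. mulv (Suc m) S (t i)) j)
              = (if i = j then 2 * e else 0)" if "i < Suc r" "j < Suc r" for i j
            using that t True by (auto simp: w orth orth' form_gram split: nat.split)
          then show ?thesis using 2 by blast
        next
          case False
          then have e'e: "e' = - e" using 2 e' by linarith
          \<comment> \<open>Orthogonal vectors of norms \<open>2 * e\<close> and
            \<open>- 2 * e\<close> have an isotropic sum, which is nonzero because its pairing with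
            \<open>w\<close> is \<open>2 * e\<close>.\<close>
          define u where "u = mulv (Suc m) S (t 0)"
          have u: "form n A u u = - 2 * e"
            using t \<open>r \<noteq> 0\<close> by (simp add: u_def form_gram e'e)
          let ?x = "\<lambda>i. w i + u i"
          have xx: "form n A ?x ?x = 0"
            by (simp add: form_add_left form_add_right w u) (simp add: u_def orth orth')
          have "form n A w ?x = 2 * e"
            by (simp add: form_add_right w) (simp add: u_def orth)
          moreover have "form n A w ?x = form n A w (\<lambda>_. 0)" if "\<not> (\<exists>i<n. ?x i \<noteq> 0)"
            using that by (intro form_cong) auto
          ultimately have "\<exists>i<n. ?x i \<noteq> 0" using 2 by force
          then show ?thesis using xx by (intro disjI1 exI[of _ ?x] conjI)
        qed
      qed
    qed
  qed
qed

text \<open>A certificate that the signature has at most \<open>m\<close> entries of sign different from \<open>s\<close>.\<close>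

definition definite_on_kernel :: "int \<Rightarrow> nat \<Rightarrow> nat \<Rightarrow> (nat \<Rightarrow> nat \<Rightarrow> int) \<Rightarrow> bool" where
  "definite_on_kernel s n m A \<longleftrightarrow> (\<exists>C. \<forall>x. (\<exists>i<n. x i \<noteq> 0) \<longrightarrow>
     (\<forall>i<m. (\<Sum>k<n. C i k * x k) = 0) \<longrightarrow> s * form n A x x > 0)"

text \<open>The m + 1 vectors span a space too large to avoid the common kernel of m equations; a
  nonzero combination in that kernel would have a norm of both signs.\<close>

lemma definite_on_kernel_frame_bound:
  assumes "definite_on_kernel (- e) n m A" "\<bar>e\<bar> = 1"
    and t: "\<And>i j. i \<le> m \<Longrightarrow> j \<le> m \<Longrightarrow> form n A (t i) (t j) = (if i = j then 2 * e else 0)"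
  shows False
proof -
  obtain C where C: "\<And>x. (\<exists>i<n. x i \<noteq> 0) \<Longrightarrow> (\<forall>i<m. (\<Sum>k<n. C i k * x k) = 0) \<Longrightarrow> - e * form n A x x > 0"
    using assms(1) unfolding definite_on_kernel_def by blast
  obtain y j where j: "j \<le> m" "y j \<noteq> 0"
    and y: "\<And>i. i < m \<Longrightarrow> (\<Sum>j\<le>m. (\<Sum>k<n. C i k * t j k) * y j) = 0"
    using underdetermined_system[of m "\<lambda>i j. \<Sum>k<n. C i k * t j k"] by metis
  define x where "x k = (\<Sum>j\<le>m. y j * t j k)" for k
  have "(\<Sum>k<n. C i k * x k) = 0" if "i < m" for i
  proof -
    have "(\<Sum>k<n. C i k * x k) = (\<Sum>j\<le>m. (\<Sum>k<n. C i k * t j k) * y j)"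
      unfolding x_def sum_distrib_left sum_distrib_right by (subst sum.swap) (simp only: mult_ac)
    then show ?thesis using y[OF that] by simp
  qed
  moreover have xx: "form n A x x = 2 * e * (\<Sum>j\<le>m. (y j)\<^sup>2)"
  proof -
    have "form n A x x = (\<Sum>i\<le>m. \<Sum>j\<le>m. y i * (y j * form n A (t i) (t j)))"
      unfolding x_def[abs_def] by (simp add: form_sum_left form_sum_right form_scale_left form_scale_right sum_distrib_left)
    also have "\<dots> = (\<Sum>i\<le>m. \<Sum>j\<le>m. if i = j then 2 * e * (y i)\<^sup>2 else 0)"
      by (intro sum.cong) (auto simp: t power2_eq_square)
    finally show ?thesis by (simp add: sum_distrib_left)
  qed
  moreover have pos: "(\<Sum>j\<le>m. (y j)\<^sup>2) > 0"
    by (rule sum_pos2[of _ j]) (use j in auto)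
  moreover have "\<exists>i<n. x i \<noteq> 0"
  proof (rule ccontr)
    assume "\<not> ?thesis"
    then have "form n A x x = form n A x (\<lambda>_. 0)" by (intro form_cong) auto
    then show False using xx pos assms(2) by auto
  qed
  moreover have "e * e = 1" using assms(2) by (metis abs_mult_self_eq mult_1)
  ultimately have "- (2 * (\<Sum>j\<le>m. (y j)\<^sup>2)) > 0"
    using C[of x] by (simp add: mult.left_commute[of e] flip: mult.assoc)
  with pos show False by simp
qed

text \<open>Frames of m + 1 vectors are excluded by the signature, so only the numerical condition
  for j \<le> m remains to be checked. For m = 5 its two extremes are (4/3)^45 < 4^10 and 2^5
  (4/3)^10 < 4^5.\<close>

lemma even_unimodular_isotropic:
  assumes "m \<in> {1..5}" "even_form (2 * m) A" "\<bar>fdet (2 * m) A\<bar> = 1"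
    and sig: "definite_on_kernel 1 (2 * m) m A" "definite_on_kernel (-1) (2 * m) m A"
  obtains x i where "i < 2 * m" "x i \<noteq> 0" "form (2 * m) A x x = 0"
proof -
  have "2 ^ j * 1 * 4 ^ (\<Sum>{..<2 * m - j}) < (4 :: int) ^ (2 * m - j) * 3 ^ (\<Sum>{..<2 * m - j})"
    if "j < Suc m" for j
  proof -
    have "m \<in> {1, 2, 3, 4, 5}" using assms(1) by auto
    moreover from this that have "j \<in> {0, 1, 2, 3, 4, 5}" by auto
    ultimately show ?thesis using that
      by (elim insertE emptyE) (simp_all add: numeral_eq_Suc)
  qed
  then have "(\<exists>x. (\<exists>i<2 * m. x i \<noteq> 0) \<and> form (2 * m) A x x = 0) \<or>
    (\<exists>e t. \<bar>e\<bar> = 1 \<and> (\<forall>i<Suc m. \<forall>j<Suc m. form (2 * m) A (t i) (t j) = (if i = j then 2 * e else 0)))"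
    by (intro isotropic_or_orthogonal_frame) (use assms in auto)
  then show thesis
  proof (elim disjE exE conjE)
    fix e t assume e: "\<bar>e\<bar> = (1 :: int)"
      and t: "\<forall>i<Suc m. \<forall>j<Suc m. form (2 * m) A (t i) (t j) = (if i = j then 2 * e else 0)"
    have "definite_on_kernel (- e) (2 * m) m A"
      using e sig by (cases "e = 1") (auto simp: abs_if split: if_splits)
    then show thesis
      using definite_on_kernel_frame_bound[of e "2 * m" m A t] e t by auto
  qed (rule that)
qed

lemma form_cons:
  "form (Suc n) A (case_nat s v) (case_nat t w) = s * A 0 0 * t + s * (\<Sum>j<n. A 0 (Suc j) * w j)
     + (\<Sum>i<n. v i * A (Suc i) 0) * t + form n (\<lambda>i j. A (Suc i) (Suc j)) v w"
  by (simp add: form_Suc)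

lemma mulv_sum: "mulv n P (\<lambda>k. \<Sum>i\<in>I. y i * X i k) l = (\<Sum>i\<in>I. y i * mulv n P (X i) l)"
  unfolding mulv_def sum_distrib_left by (subst sum.swap) (simp only: mult_ac)

lemma definite_on_kernel_gram:
  assumes "definite_on_kernel s n m A" "fdet n P \<noteq> 0"
  shows "definite_on_kernel s n m (gram n A P)"
proof -
  obtain C where C: "\<And>x. (\<exists>i<n. x i \<noteq> 0) \<Longrightarrow> (\<forall>i<m. (\<Sum>k<n. C i k * x k) = 0) \<Longrightarrow> s * form n A x x > 0"
    using assms(1) unfolding definite_on_kernel_def by blast
  have "s * form n (gram n A P) x x > 0"
    if "\<exists>i<n. x i \<noteq> 0" "\<forall>i<m. (\<Sum>k<n. (\<Sum>l<n. C i l * P l k) * x k) = 0" for x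
    unfolding form_gram
  proof (rule C)
    show "\<exists>i<n. mulv n P x i \<noteq> 0"
      using that(1) mulv_zero_imp[OF assms(2), of x] by blast
    show "\<forall>i<m. (\<Sum>k<n. C i k * mulv n P x k) = 0"
    proof (intro allI impI)
      fix i assume "i < m"
      have "(\<Sum>k<n. C i k * mulv n P x k) = (\<Sum>k<n. (\<Sum>l<n. C i l * P l k) * x k)"
        unfolding mulv_def sum_distrib_left sum_distrib_right by (subst sum.swap) (simp only: mult.assoc)
      then show "(\<Sum>k<n. C i k * mulv n P x k) = 0" using that(2) \<open>i < m\<close> by simp
    qed
  qed
  then show ?thesis unfolding definite_on_kernel_def by (intro exI[of _ "\<lambda>i k. \<Sum>l<n. C i l * P l k"]) blast
qed

text \<open>An isotropic vector cannot satisfy all m + 1 equations, so one of them, number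
  \<open>i\<^sub>0\<close>, involves the first coordinate and determines it up to a denominator.
  Eliminating this coordinate leaves m equations on the orthogonal complement of the vector modulo
  the vector itself.\<close>

lemma definite_on_kernel_isotropic_quotient:
  fixes n :: nat
  defines "N \<equiv> Suc (Suc n)"
  assumes "definite_on_kernel s N (Suc m) B"
    and sym: "\<And>i j. B i j = B j i"
    and B00: "B 0 0 = 0" and B0: "\<And>j. j < n \<Longrightarrow> B 0 (Suc (Suc j)) = 0"
  shows "definite_on_kernel s n m (\<lambda>i j. B (Suc (Suc i)) (Suc (Suc j)))"
proof -
  let ?M = "\<lambda>i j. B (Suc (Suc i)) (Suc (Suc j))"
  obtain C where C: "\<And>x. (\<exists>i<N. x i \<noteq> 0) \<Longrightarrow> (\<forall>i<Suc m. (\<Sum>k<N. C i k * x k) = 0) \<Longrightarrow> s * form N B x x > 0"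
    using assms(2) unfolding definite_on_kernel_def by blast
  have split: "(\<Sum>k<N. f k) = f 0 + f 1 + (\<Sum>k<n. f (Suc (Suc k)))" for f :: "nat \<Rightarrow> int"
    by (simp add: N_def sum.lessThan_Suc_shift del: sum.lessThan_Suc)
  have form_ext: "form N B (case_nat a (case_nat 0 z)) (case_nat a (case_nat 0 z)) = form n ?M z z" for a z
  proof -
    have 1: "(\<Sum>j<Suc n. B 0 (Suc j) * case_nat 0 z j) = 0"
      using B0 by (simp add: sum.lessThan_Suc_shift del: sum.lessThan_Suc)
    then have 2: "(\<Sum>i<Suc n. case_nat 0 z i * B (Suc i) 0) = 0"
      by (simp add: mult.commute sym[of "Suc _" 0] del: sum.lessThan_Suc)
    show ?thesis unfolding N_def
      by (subst form_cons) (simp add: B00 1 2 form_cons[of n] del: sum.lessThan_Suc)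
  qed
  obtain i\<^sub>0 where i0: "i\<^sub>0 < Suc m" "C i\<^sub>0 0 \<noteq> 0"
  proof -
    let ?e = "case_nat 1 (case_nat 0 (\<lambda>_. 0)) :: nat \<Rightarrow> int"
    have "\<not> (\<forall>i<Suc m. (\<Sum>k<N. C i k * ?e k) = 0)"
      using C[of ?e] form_ext[of 1 "\<lambda>_. 0"] by (force simp: N_def)
    then show thesis using that by (auto simp: split)
  qed
  define \<sigma> where "\<sigma> i = (if i < i\<^sub>0 then i else Suc i)" for i
  define D where "D i k = C i\<^sub>0 0 * C (\<sigma> i) (Suc (Suc k)) - C (\<sigma> i) 0 * C i\<^sub>0 (Suc (Suc k))" for i k
  have "s * form n ?M z z > 0" if z: "\<exists>i<n. z i \<noteq> 0" and D: "\<forall>i<m. (\<Sum>k<n. D i k * z k) = 0" for z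
  proof -
    define S where "S i = (\<Sum>k<n. C i (Suc (Suc k)) * z k)" for i
    \<comment> \<open>The lift of \<open>z\<close>, scaled by \<open>C i\<^sub>0 0\<close> to clear
      denominators. The second coordinate is 0 for orthogonality to the first basis vector, and the
      first one solves equation \<open>i\<^sub>0\<close>.\<close>
    define x where "x = case_nat (- S i\<^sub>0) (case_nat 0 (\<lambda>k. C i\<^sub>0 0 * z k))"
    have Cx: "(\<Sum>k<N. C i k * x k) = C i\<^sub>0 0 * S i - C i 0 * S i\<^sub>0" for i
      by (simp add: split x_def S_def sum_distrib_left mult.left_commute)
    have "(\<Sum>k<N. C i k * x k) = 0" if "i < Suc m" for i
    proof (cases "i = i\<^sub>0")
      case False
      then obtain j where j: "i = \<sigma> j" "j < m"
      proof (cases "i < i\<^sub>0")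
        case True
        then show ?thesis using that[of i] i0 by (auto simp: \<sigma>_def)
      next
        case F: False
        with \<open>i \<noteq> i\<^sub>0\<close> \<open>i < Suc m\<close> show ?thesis using that[of "i - 1"] by (auto simp: \<sigma>_def)
      qed
      have "(\<Sum>k<n. D j k * z k) = C i\<^sub>0 0 * S i - C i 0 * S i\<^sub>0"
        by (simp add: D_def j S_def sum_subtractf sum_distrib_left algebra_simps)
      then show ?thesis using D j Cx[of i] by simp
    qed (simp add: Cx)
    moreover have "\<exists>i<N. x i \<noteq> 0"
    proof -
      obtain k where "k < n" "z k \<noteq> 0" using z by blast
      then show ?thesis
        using i0 by (intro exI[of _ "Suc (Suc k)"]) (auto simp: N_def x_def)
    qed
    ultimately have "s * form N B x x > 0" using C by blast
    moreover have "form N B x x = (C i\<^sub>0 0)\<^sup>2 * form n ?M z z"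
      unfolding x_def form_ext by (simp add: form_scale_left form_scale_right power2_eq_square)
    ultimately have "(C i\<^sub>0 0)\<^sup>2 * (s * form n ?M z z) > 0" by (simp add: mult.left_commute)
    then show ?thesis by (simp add: zero_less_mult_iff)
  qed
  then show ?thesis unfolding definite_on_kernel_def by blast
qed

text \<open>Induction through an isotropic vector x: the orthogonal complement of x modulo x is
  again even and unimodular, with m smaller by 1, and an independent isotropic system there lifts
  and is completed by x.\<close>

theorem even_unimodular_hyperbolic:
  assumes "m \<le> 5" "even_form (2 * m) A" "\<bar>fdet (2 * m) A\<bar> = 1"
    and "definite_on_kernel 1 (2 * m) m A" "definite_on_kernel (-1) (2 * m) m A"
  shows "\<exists>X. (\<forall>i<m. \<forall>j<m. form (2 * m) A (X i) (X j) = 0) \<and>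
    (\<forall>y. (\<forall>k<2 * m. (\<Sum>i<m. y i * X i k) = 0) \<longrightarrow> (\<forall>i<m. y i = 0))"
  using assms
proof (induction m arbitrary: A)
  case 0
  show ?case by simp
next
  case (Suc m)
  define n where "n = 2 * m"
  define N where "N = Suc (Suc n)"
  have N: "2 * Suc m = N" by (simp add: N_def n_def)
  note prems = Suc.prems[unfolded N]
  have m: "Suc m \<in> {1..5}" using prems(1) by simp
  obtain x i where x: "i < N" "x i \<noteq> 0" "form N A x x = 0"
    by (rule even_unimodular_isotropic[OF m Suc.prems(2-5), unfolded N]) blast
  obtain P where P: "unim N P" and B00: "gram N A P 0 0 = 0"
    and B0: "\<And>j. j < n \<Longrightarrow> gram N A P 0 (Suc (Suc j)) = 0"
    and detM: "\<bar>fdet n (\<lambda>i j. gram N A P (Suc (Suc i)) (Suc (Suc j)))\<bar> = 1"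
    by (rule isotropic_splitting[of n A i x, folded N_def, OF prems(2,3) x]) blast
  define B where "B = gram N A P"
  define M where "M i j = B (Suc (Suc i)) (Suc (Suc j))" for i j
  have Pnz: "fdet N P \<noteq> 0" using P by (auto simp: unim_def)
  have Bsym: "B i j = B j i" for i j
    using prems(2) unfolding B_def gram_def even_form_def by blast
  have form_ext: "form N B (case_nat a (case_nat 0 z)) (case_nat b (case_nat 0 z')) = form n M z z'" for a b z z'
  proof -
    have 1: "(\<Sum>j<Suc n. B 0 (Suc j) * case_nat 0 z j) = 0" for z
      using B0 by (simp add: B_def sum.lessThan_Suc_shift del: sum.lessThan_Suc)
    then have 2: "(\<Sum>i<Suc n. case_nat 0 z i * B (Suc i) 0) = 0" for z
      by (simp add: mult.commute Bsym[of "Suc _" 0] del: sum.lessThan_Suc)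
    show ?thesis unfolding N_def
      by (subst form_cons) (simp add: B00[folded B_def] 1 2 form_cons[of n] M_def[abs_def] del: sum.lessThan_Suc)
  qed
  have evB: "even_form N B" unfolding B_def by (rule even_form_gram[OF prems(2)])
  have evM: "even_form n M"
    using evB unfolding even_form_def form_ext[of 0 _ 0, symmetric] by blast
  have "definite_on_kernel s n m M" if "definite_on_kernel s N (Suc m) A" for s
    unfolding M_def[abs_def]
    by (rule definite_on_kernel_isotropic_quotient[of s n m B])
      (use definite_on_kernel_gram[OF that Pnz] Bsym B00 B0 in \<open>auto simp: B_def N_def\<close>)
  then have "\<exists>X. (\<forall>i<m. \<forall>j<m. form n M (X i) (X j) = 0) \<and>
      (\<forall>y. (\<forall>k<n. (\<Sum>i<m. y i * X i k) = 0) \<longrightarrow> (\<forall>i<m. y i = 0))"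
    using Suc.IH[of M, folded n_def] prems evM detM[folded B_def, folded M_def] by simp
  then obtain X where X: "(\<forall>i<m. \<forall>j<m. form n M (X i) (X j) = 0) \<and>
      (\<forall>y. (\<forall>k<n. (\<Sum>i<m. y i * X i k) = 0) \<longrightarrow> (\<forall>i<m. y i = 0))"
    by (elim exE)
  have X0: "form n M (X i) (X j) = 0" if "i < m" "j < m" for i j
    using conjunct1[OF X] that by simp
  have Xi: "y i = 0" if "\<And>k. k < n \<Longrightarrow> (\<Sum>i<m. y i * X i k) = 0" "i < m" for y i
    using conjunct2[OF X, rule_format, of y i] that by simp
  \<comment> \<open>Coordinate 1 is 0, so the lifts stay orthogonal to the isotropic vector e_0,
    which joins them as the first member.\<close>
  define Y where "Y i = (case i of 0 \<Rightarrow> case_nat 1 (case_nat 0 (\<lambda>_. 0)) | Suc i \<Rightarrow> case_nat 0 (case_nat 0 (X i)))" for i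
  have Y0: "form N B (Y i) (Y j) = 0" if "i < Suc m" "j < Suc m" for i j
    using that X0 by (cases i; cases j) (auto simp: Y_def form_ext)
  have Yi: "y i = 0" if y: "\<And>k. k < N \<Longrightarrow> (\<Sum>i<Suc m. y i * Y i k) = 0" and i: "i < Suc m" for y i
  proof -
    have "y 0 = 0" using y[of 0]
      by (simp add: N_def Y_def sum.lessThan_Suc_shift del: sum.lessThan_Suc)
    moreover have "y (Suc j) = 0" if "j < m" for j
      using Xi[of "\<lambda>i. y (Suc i)", OF _ that] y[of "Suc (Suc _)"]
      by (simp add: N_def Y_def sum.lessThan_Suc_shift del: sum.lessThan_Suc)
    ultimately show ?thesis using i by (cases i) auto
  qed
  show ?case unfolding N
  proof (intro exI[of _ "\<lambda>i. mulv N P (Y i)"] conjI allI impI)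
    fix i j assume "i < Suc m" "j < Suc m"
    then show "form N A (mulv N P (Y i)) (mulv N P (Y j)) = 0"
      using Y0 by (simp add: form_gram[symmetric] B_def)
  next
    fix y i assume y: "\<forall>k<N. (\<Sum>i<Suc m. y i * mulv N P (Y i) k) = 0" and i: "i < Suc m"
    have "(\<Sum>i<Suc m. y i * Y i k) = 0" if "k < N" for k
      using mulv_zero_imp[OF Pnz _ that, of "\<lambda>k. \<Sum>i<Suc m. y i * Y i k"] y
      unfolding mulv_sum by blast
    then show "y i = 0" using Yi i by blast
  qed
qed

section \<open>Congruences from equivalence over the \<open>\<nu>\<close>-adic integers\<close>

lemma padic_int_simps:
  "carrier (padic_int \<nu>) = {a. \<forall>n. a n \<in> {0..<int \<nu> ^ n} \<and> a (Suc n) mod int \<nu> ^ n = a n}"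
  "a \<oplus>\<^bsub>padic_int \<nu>\<^esub> b = (\<lambda>n. (a n + b n) mod int \<nu> ^ n)"
  "a \<otimes>\<^bsub>padic_int \<nu>\<^esub> b = (\<lambda>n. (a n * b n) mod int \<nu> ^ n)"
  "\<one>\<^bsub>padic_int \<nu>\<^esub> = (\<lambda>n. 1 mod int \<nu> ^ n)"
  "\<zero>\<^bsub>padic_int \<nu>\<^esub> = (\<lambda>n. 0)"
  by (simp_all add: padic_int_def)

lemma padic_int_mod: "a \<in> carrier (padic_int \<nu>) \<Longrightarrow> a n mod int \<nu> ^ n = a n"
  by (auto simp: padic_int_simps)

lemma padic_int_of_int:
  assumes "\<nu> > 0"
  shows "(\<lambda>n. x mod int \<nu> ^ n) \<in> carrier (padic_int \<nu>)"
proof -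
  have "x mod int \<nu> ^ Suc n mod int \<nu> ^ n = x mod int \<nu> ^ n" for n
    by (rule mod_mod_cancel) simp
  then show ?thesis using assms by (simp add: padic_int_simps)
qed

lemma padic_int_finsum:
  assumes "\<nu> > 0" "finite I" "\<And>i. i \<in> I \<Longrightarrow> f i \<in> carrier (padic_int \<nu>)"
  shows "(\<Oplus>\<^bsub>padic_int \<nu>\<^esub>i\<in>I. f i) n = (\<Sum>i\<in>I. f i n) mod int \<nu> ^ n"
proof -
  interpret cring "padic_int \<nu>" by (rule cring_padic_int[OF assms(1)])
  show ?thesis using assms(2,3)
  proof (induction I)
    case empty
    show ?case by (simp add: padic_int_simps(5))
  next
    case (insert i I)
    then have "(\<Oplus>\<^bsub>padic_int \<nu>\<^esub>i\<in>insert i I. f i) = f i \<oplus>\<^bsub>padic_int \<nu>\<^esub> (\<Oplus>\<^bsub>padic_int \<nu>\<^esub>i\<in>I. f i)"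
      by (intro finsum_insert) auto
    then show ?case using insert by (simp add: padic_int_simps(2) mod_simps)
  qed
qed

lemma padic_int_add_pow_nat:
  fixes k :: nat
  assumes "\<nu> > 0" "a \<in> carrier (padic_int \<nu>)"
  shows "([k] \<cdot>\<^bsub>padic_int \<nu>\<^esub> a) n = (int k * a n) mod int \<nu> ^ n"
proof -
  interpret cring "padic_int \<nu>" by (rule cring_padic_int[OF assms(1)])
  show ?thesis
  proof (induction k)
    case 0
    show ?case by (simp add: padic_int_simps(5))
  next
    case (Suc k)
    then show ?case
      by (simp add: add.nat_pow_Suc padic_int_simps(2) mod_simps algebra_simps)
  qed
qed

lemma padic_int_add_pow:
  fixes k :: int
  assumes "\<nu> > 0" "a \<in> carrier (padic_int \<nu>)"
  shows "([k] \<cdot>\<^bsub>padic_int \<nu>\<^esub> a) n = (k * a n) mod int \<nu> ^ n"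
proof -
  interpret cring "padic_int \<nu>" by (rule cring_padic_int[OF assms(1)])
  show ?thesis
  proof (cases "k \<ge> 0")
    case True
    then have "[k] \<cdot>\<^bsub>padic_int \<nu>\<^esub> a = [nat k] \<cdot>\<^bsub>padic_int \<nu>\<^esub> a"
      unfolding add_pow_def int_pow_def2 by simp
    then show ?thesis using True by (simp add: padic_int_add_pow_nat[OF assms])
  next
    case False
    define b where "b = [nat (- k)] \<cdot>\<^bsub>padic_int \<nu>\<^esub> a"
    have b: "b \<in> carrier (padic_int \<nu>)" unfolding b_def using assms(2) by simp
    have "[k] \<cdot>\<^bsub>padic_int \<nu>\<^esub> a = \<ominus>\<^bsub>padic_int \<nu>\<^esub> b"
      using False unfolding add_pow_def int_pow_def2 b_def a_inv_def by simp
    moreover have "(\<ominus>\<^bsub>padic_int \<nu>\<^esub> b) n = (k * a n) mod int \<nu> ^ n"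
    proof -
      let ?c = "\<ominus>\<^bsub>padic_int \<nu>\<^esub> b"
      have "(?c \<oplus>\<^bsub>padic_int \<nu>\<^esub> b) n = 0"
        unfolding l_neg[OF b] by (simp add: padic_int_simps(5))
      then have "(?c n + b n) mod int \<nu> ^ n = 0" by (simp add: padic_int_simps(2))
      moreover have "b n = (- k * a n) mod int \<nu> ^ n"
        using False by (simp add: b_def padic_int_add_pow_nat[OF assms])
      ultimately have "(?c n + - k * a n) mod int \<nu> ^ n = 0"
        by (simp add: mod_simps)
      then have "int \<nu> ^ n dvd ?c n - k * a n" by (simp add: dvd_eq_mod_eq_0)
      then have "?c n mod int \<nu> ^ n = (k * a n) mod int \<nu> ^ n"
        by (simp add: mod_eq_dvd_iff)
      then show ?thesis using padic_int_mod[of ?c \<nu> n] b by simp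
    qed
    ultimately show ?thesis by simp
  qed
qed

text \<open>\<open>qf_eval\<close> for integer vectors as plain functions, the shape in which
  \<open>qf_eval_ring\<close> takes its argument.\<close>

definition qval :: "'n::finite qform \<Rightarrow> ('n \<Rightarrow> int) \<Rightarrow> int" where
  "qval c x = (\<Sum>i\<in>UNIV. \<Sum>j\<in>UNIV. c i j * (x i * x j))"

lemma qf_eval_ring_padic_int:
  assumes "\<nu> > 0" "\<And>i. x i \<in> carrier (padic_int \<nu>)"
  shows "qf_eval_ring (padic_int \<nu>) c x n = qval c (\<lambda>i. x i n) mod int \<nu> ^ n"
proof -
  interpret cring "padic_int \<nu>" by (rule cring_padic_int[OF assms(1)])
  have 1: "[c i j] \<cdot>\<^bsub>padic_int \<nu>\<^esub> (x i \<otimes>\<^bsub>padic_int \<nu>\<^esub> x j) \<in> carrier (padic_int \<nu>)" for i j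
    using assms(2) add.int_pow_closed by simp
  have 2: "([c i j] \<cdot>\<^bsub>padic_int \<nu>\<^esub> (x i \<otimes>\<^bsub>padic_int \<nu>\<^esub> x j)) n = c i j * (x i n * x j n) mod int \<nu> ^ n" for i j
    using assms by (simp add: padic_int_add_pow) (simp add: padic_int_simps(3) mod_simps)
  show ?thesis
    unfolding qf_eval_ring_def qval_def
    by (simp add: padic_int_finsum[OF assms(1)] 1 2 mod_sum_eq mod_simps)
qed

lemma mat_vec_ring_padic_int:
  assumes "\<nu> > 0" "\<And>i j. U i j \<in> carrier (padic_int \<nu>)" "\<And>i. x i \<in> carrier (padic_int \<nu>)"
  shows "mat_vec_ring (padic_int \<nu>) U x i n = (\<Sum>j\<in>UNIV. U i j n * x j n) mod int \<nu> ^ n"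
    "mat_vec_ring (padic_int \<nu>) U x i \<in> carrier (padic_int \<nu>)"
proof -
  interpret cring "padic_int \<nu>" by (rule cring_padic_int[OF assms(1)])
  have "U i j \<otimes>\<^bsub>padic_int \<nu>\<^esub> x j \<in> carrier (padic_int \<nu>)" for j
    by (intro m_closed assms(2,3))
  then show "mat_vec_ring (padic_int \<nu>) U x i n = (\<Sum>j\<in>UNIV. U i j n * x j n) mod int \<nu> ^ n"
    unfolding mat_vec_ring_def
    by (simp add: padic_int_finsum[OF assms(1)]) (simp add: padic_int_simps(3) mod_sum_eq)
  show "mat_vec_ring (padic_int \<nu>) U x i \<in> carrier (padic_int \<nu>)"
    unfolding mat_vec_ring_def using assms by (intro finsum_closed) auto
qed

lemma sum_mod_cong:
  fixes f g :: "'a \<Rightarrow> int"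
  assumes "\<And>i. i \<in> A \<Longrightarrow> f i mod M = g i mod M"
  shows "sum f A mod M = sum g A mod M"
proof -
  have "(\<Sum>i\<in>A. f i mod M) mod M = (\<Sum>i\<in>A. g i mod M) mod M"
    using assms by (metis (mono_tags, lifting) sum.cong)
  then show ?thesis by (simp only: mod_sum_eq)
qed

lemma qval_mod_cong:
  assumes "\<And>i. x i mod M = y i mod M"
  shows "qval c x mod M = qval c y mod M"
proof -
  have "(c i j * (x i * x j)) mod M = (c i j * (y i * y j)) mod M" for i j
    by (rule mod_mult_cong[OF refl mod_mult_cong[OF assms assms]])
  then show ?thesis unfolding qval_def by (intro sum_mod_cong) simp
qed

text \<open>Component n is a ring homomorphism to the integers modulo \<nu>^n, and integers embed as
  the sequences of their residues. So the equivalence and the inverse of \<open>U\<close> can be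
  read off at level n.\<close>

lemma padic_equivalence_congruence:
  fixes c d :: "'n::finite qform"
  assumes "\<nu> > 0" "equivalent_over (padic_int \<nu>) c d"
  obtains U V :: "'n \<Rightarrow> 'n \<Rightarrow> int" where
    "\<And>x. int \<nu> ^ n dvd qval c (\<lambda>i. \<Sum>j\<in>UNIV. U i j * x j) - qval d x"
    "\<And>i j. int \<nu> ^ n dvd (\<Sum>k\<in>UNIV. U i k * V k j) - (if i = j then 1 else 0)"
proof -
  let ?R = "padic_int \<nu>"
  interpret cring ?R by (rule cring_padic_int[OF assms(1)])
  obtain U where U: "U \<in> GL_ring ?R" and eq: "\<And>x. (\<forall>i. x i \<in> carrier ?R) \<Longrightarrow>
      qf_eval_ring ?R c (mat_vec_ring ?R U x) = qf_eval_ring ?R d x"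
    using assms(2) unfolding equivalent_over_def by blast
  from U obtain V where Uc: "\<And>i j. U i j \<in> carrier ?R" and Vc: "\<And>i j. V i j \<in> carrier ?R"
    and UV: "mat_mult_ring ?R U V = mat_one_ring ?R"
    unfolding GL_ring_def by blast
  let ?M = "int \<nu> ^ n"
  show thesis
  proof (rule that[of "\<lambda>i j. U i j n" "\<lambda>i j. V i j n"])
    fix x :: "'n \<Rightarrow> int"
    define X where "X i n = x i mod int \<nu> ^ n" for i n
    have X: "X i \<in> carrier ?R" for i
      unfolding X_def using padic_int_of_int[OF assms(1)] by simp
    have "qf_eval_ring ?R c (mat_vec_ring ?R U X) n = qf_eval_ring ?R d X n"
      using eq[of X] X by simp
    then have "qval c (\<lambda>i. (\<Sum>j\<in>UNIV. U i j n * X j n) mod ?M) mod ?M = qval d (\<lambda>i. X i n) mod ?M"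
      by (simp add: qf_eval_ring_padic_int[OF assms(1)] mat_vec_ring_padic_int[OF assms(1) Uc X] X)
    moreover have "qval c (\<lambda>i. (\<Sum>j\<in>UNIV. U i j n * X j n) mod ?M) mod ?M
        = qval c (\<lambda>i. \<Sum>j\<in>UNIV. U i j n * x j) mod ?M"
    proof (rule qval_mod_cong)
      fix i
      have "(U i j n * X j n) mod ?M = (U i j n * x j) mod ?M" for j
        by (simp add: X_def mod_simps)
      then have "(\<Sum>j\<in>UNIV. U i j n * X j n) mod ?M = (\<Sum>j\<in>UNIV. U i j n * x j) mod ?M"
        by (intro sum_mod_cong) simp
      then show "(\<Sum>j\<in>UNIV. U i j n * X j n) mod ?M mod ?M = (\<Sum>j\<in>UNIV. U i j n * x j) mod ?M" by simp
    qed
    moreover have "qval d (\<lambda>i. X i n) mod ?M = qval d x mod ?M"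
      by (rule qval_mod_cong) (simp add: X_def)
    ultimately show "?M dvd qval c (\<lambda>i. \<Sum>j\<in>UNIV. U i j n * x j) - qval d x"
      by (simp add: mod_eq_dvd_iff)
  next
    fix i j
    have "mat_mult_ring ?R U V i j = mat_vec_ring ?R U (\<lambda>k. V k j) i"
      by (simp add: mat_mult_ring_def mat_vec_ring_def)
    then have "(\<Sum>k\<in>UNIV. U i k n * V k j n) mod ?M = mat_one_ring ?R i j n"
      using mat_vec_ring_padic_int(1)[where U = U and x = "\<lambda>k. V k j", OF assms(1) Uc Vc] UV by simp
    also have "\<dots> = (if i = j then 1 else 0) mod ?M"
      by (simp add: mat_one_ring_def padic_int_simps(4,5))
    finally show "?M dvd (\<Sum>k\<in>UNIV. U i k n * V k j n) - (if i = j then 1 else 0)"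
      by (simp add: mod_eq_dvd_iff)
  qed
qed

section \<open>Gluing\<close>

lemma mulv_mulv: "mulv n U (mulv n C b) = mulv n (\<lambda>i j. \<Sum>k<n. U i k * C k j) b"
  unfolding mulv_def[abs_def] sum_distrib_left sum_distrib_right
  by (intro ext, subst sum.swap) (simp only: mult.assoc)

lemma mulv_cong: "(\<And>k. k < n \<Longrightarrow> x k = y k) \<Longrightarrow> mulv n P x = mulv n P y"
  unfolding mulv_def by auto

lemma form_eq_mulv: "form n A x y = (\<Sum>i<n. x i * mulv n A y i)"
  by (simp add: form_def mulv_def sum_distrib_left mult.assoc)

text \<open>By f(x + y, x + y) = f(x, x) + 2 f(x, y) + f(y, y); the extra factor 2 in the hypothesis
  pays for the division by 2.\<close>

lemma polarization_dvd:
  fixes f :: "(nat \<Rightarrow> int) \<Rightarrow> (nat \<Rightarrow> int) \<Rightarrow> int"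
  assumes sym: "\<And>x y. f x y = f y x" and add: "\<And>x y z. f (\<lambda>i. x i + y i) z = f x z + f y z"
    and dvd: "\<And>x. 2 * M dvd f x x"
  shows "(M :: int) dvd f x y"
proof -
  let ?s = "\<lambda>i. x i + y i :: int"
  have "f ?s ?s = f x x + 2 * f x y + f y y"
    using add[of x y ?s] add[of x y x] add[of x y y] sym[of x ?s] sym[of y ?s] sym[of x y] by simp
  then have "2 * f x y = f ?s ?s - f x x - f y y" by simp
  then have "2 * M dvd 2 * f x y" using dvd by (metis dvd_diff)
  then show ?thesis by simp
qed

lemma even_form_difference_dvd:
  assumes ea: "even_form n a" and ed: "even_form n d"
    and U: "\<And>x. 2 * M dvd form n a (mulv n U x) (mulv n U x) - form n d x x"
  shows "M dvd form n a (mulv n U x) (mulv n U y) - form n d x y"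
proof (rule polarization_dvd[of "\<lambda>x y. form n a (mulv n U x) (mulv n U y) - form n d x y"])
  fix x y z :: "nat \<Rightarrow> int"
  show "form n a (mulv n U x) (mulv n U y) - form n d x y = form n a (mulv n U y) (mulv n U x) - form n d y x"
    using ea ed unfolding even_form_def by metis
  have "mulv n U (\<lambda>i. x i + y i) = (\<lambda>i. mulv n U x i + mulv n U y i)"
    by (simp add: fun_eq_iff mulv_def distrib_left sum.distrib)
  then show "form n a (mulv n U (\<lambda>i. x i + y i)) (mulv n U z) - form n d (\<lambda>i. x i + y i) z
    = form n a (mulv n U x) (mulv n U z) - form n d x z + (form n a (mulv n U y) (mulv n U z) - form n d y z)"
    by (simp add: form_add_left)
qed (rule U)

lemma even_form_scaled:
  assumes sym: "\<And>x y. form n B x y = form n B y x" and dvd: "\<And>x. 2 * M dvd form n B x x" and M: "M \<noteq> 0"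
  obtains A where "even_form n A" "\<And>x y. form n B x y = M * form n A x y" "fdet n B = M ^ n * fdet n A"
proof -
  define A where "A i j = B i j div M" for i j
  have "M dvd B i j" if "i < n" "j < n" for i j
    using polarization_dvd[of "form n B" M "unit i" "unit j", OF sym form_add_left dvd] that
    by (simp add: form_unit)
  then have BA: "B i j = M * A i j" if "i < n" "j < n" for i j
    using that by (simp add: A_def)
  have f: "form n B x y = M * form n A x y" for x y
    unfolding form_def sum_distrib_left by (intro sum.cong) (auto simp: BA)
  have "fdet n B = fdet n (\<lambda>i j. M * A i j)"
    by (intro fdet_cong BA)
  then have d: "fdet n B = M ^ n * fdet n A" by (simp only: fdet_scale)
  have "form n A x y = form n A y x" for x y
    using sym[of x y] M by (simp add: f)
  moreover have "even (form n A x x)" for x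
    using dvd[of x] M by (simp add: f)
  ultimately have "even_form n A" by (simp add: even_form_def)
  then show thesis by (rule that[OF _ f d])
qed

lemma sum_lessThan_double:
  fixes f :: "nat \<Rightarrow> 'a::comm_monoid_add"
  shows "(\<Sum>i<2 * n. f i) = (\<Sum>i<n. f i) + (\<Sum>i<n. f (n + i))"
proof -
  have "(\<Sum>i<n + m. f i) = (\<Sum>i<n. f i) + (\<Sum>i<m. f (n + i))" for m
    by (induction m) (simp_all add: add.assoc)
  from this[of n] show ?thesis by (simp add: mult_2)
qed

text \<open>Gluing: the rank \<open>2n\<close> form \<open>a(z + D\<inverse>UCb) - d(D\<inverse>Cb)\<close>, where \<open>C\<close> is the adjugate of \<open>d\<close>,
  is integral, even and unimodular, because \<open>U\<close> identifies the discriminant groups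
  of \<open>a\<close> and \<open>d\<close>. Its totally isotropic subspaces of rank \<open>n\<close> are graphs of
  rational isometries.\<close>

theorem glue_isometry:
  assumes n: "n \<le> 5" and ea: "even_form n a" and ed: "even_form n d"
    and pa: "\<And>x i. i < n \<Longrightarrow> x i \<noteq> 0 \<Longrightarrow> form n a x x > 0"
    and pd: "\<And>x i. i < n \<Longrightarrow> x i \<noteq> 0 \<Longrightarrow> form n d x x > 0"
    and D: "fdet n a = D" "fdet n d = D" "D \<noteq> 0"
    and U: "\<And>x. 2 * D\<^sup>2 dvd form n a (mulv n U x) (mulv n U x) - form n d x x"
    and cop: "coprime (fdet n U) D"
  obtains w c where "c \<noteq> 0" "form n a w w = c\<^sup>2 * form n d v v"
proof -
  obtain C where dC: "\<And>i j. i < n \<Longrightarrow> j < n \<Longrightarrow> (\<Sum>k<n. d i k * C k j) = (if i = j then D else 0)"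
    and Cd: "\<And>i j. i < n \<Longrightarrow> j < n \<Longrightarrow> (\<Sum>k<n. C i k * d k j) = (if i = j then D else 0)"
    by (rule fdet_adjugate[of n d, unfolded D]) blast
  have syma: "form n a x y = form n a y x" for x y using ea unfolding even_form_def by blast
  have symd: "form n d x y = form n d y x" for x y using ed unfolding even_form_def by blast
  have mulv_scalar: "mulv n (\<lambda>i j. if i = j then D else 0) x i = D * x i" if "i < n" for x i
  proof -
    have "mulv n (\<lambda>i j. if i = j then D else 0) x i = (\<Sum>k<n. unit i k * (D * x k))"
      unfolding mulv_def unit_def by (intro sum.cong) auto
    then show ?thesis using that by (simp only: sum_unit)
  qed
  have mulv_dC: "mulv n d (mulv n C x) i = D * x i" if "i < n" for x i
  proof -
    have "mulv n d (mulv n C x) i = mulv n (\<lambda>i j. if i = j then D else 0) x i"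
      unfolding mulv_mulv unfolding mulv_def by (intro sum.cong refl) (simp add: dC that)
    then show ?thesis using mulv_scalar[OF that] by simp
  qed
  have mulv_Cd: "mulv n C (mulv n d x) i = D * x i" if "i < n" for x i
  proof -
    have "mulv n C (mulv n d x) i = mulv n (\<lambda>i j. if i = j then D else 0) x i"
      unfolding mulv_mulv unfolding mulv_def by (intro sum.cong refl) (simp add: Cd that)
    then show ?thesis using mulv_scalar[OF that] by simp
  qed
  have detC: "fdet n C * D = D ^ n"
  proof -
    have "fdet n (\<lambda>i j. \<Sum>k<n. C i k * d k j) = fdet n (\<lambda>i j. D * (if i = j then 1 else 0))"
      by (rule fdet_cong) (simp add: Cd)
    then show ?thesis by (simp only: fdet_mult fdet_scale fdet_id D mult_1_right)
  qed
  then have detC0: "fdet n C \<noteq> 0" using D(3) by (metis mult_zero_left power_not_zero)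
  have polU: "D\<^sup>2 dvd form n a (mulv n U x) (mulv n U y) - form n d x y" for x y
    by (rule even_form_difference_dvd[OF ea ed U])
  \<comment> \<open>Since \<open>C\<close> is the adjugate of \<open>d\<close>, d(y, C b) is D times
    the dot product of y and b; the congruence carries the divisibility by D over to
    \<open>a\<close>.\<close>
  have DdvdU: "D dvd form n a (mulv n U y) (mulv n U (mulv n C b))" for y b
  proof -
    have "form n d y (mulv n C b) = (\<Sum>i<n. y i * (D * b i))"
      unfolding form_eq_mulv by (intro sum.cong) (auto simp: mulv_dC)
    then have "D dvd form n d y (mulv n C b)"
      by (auto intro!: dvd_sum)
    moreover have "D dvd form n a (mulv n U y) (mulv n U (mulv n C b)) - form n d y (mulv n C b)"
      using polU[of y "mulv n C b"] by (metis dvd_mult_left power2_eq_square)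
    ultimately show ?thesis by (metis dvd_add diff_add_cancel)
  qed
  \<comment> \<open>From the image of \<open>U\<close> to arbitrary z: det U times z lies in that
    image, and det U is prime to D.\<close>
  have Ddvd: "D dvd form n a z (mulv n U (mulv n C b))" for z b
  proof -
    obtain K where K: "\<And>i j. i < n \<Longrightarrow> j < n \<Longrightarrow> (\<Sum>k<n. U i k * K k j) = (if i = j then fdet n U else 0)"
      by (rule fdet_adjugate[of n U]) blast
    have "mulv n U (mulv n K z) i = fdet n U * z i" if "i < n" for i
    proof -
      have "mulv n U (mulv n K z) i = (\<Sum>k<n. unit i k * (fdet n U * z k))"
        unfolding mulv_mulv unfolding mulv_def unit_def by (intro sum.cong refl) (simp add: K that)
      then show ?thesis using that by (simp only: sum_unit)
    qed
    then have "form n a (mulv n U (mulv n K z)) (mulv n U (mulv n C b))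
        = form n a (\<lambda>i. fdet n U * z i) (mulv n U (mulv n C b))"
      by (intro form_cong) auto
    then have "D dvd fdet n U * form n a z (mulv n U (mulv n C b))"
      using DdvdU[of "mulv n K z" b] by (simp add: form_scale_left)
    then show ?thesis using cop by (metis coprime_commute coprime_dvd_mult_right_iff)
  qed
  \<comment> \<open>\<open>\<Delta>\<close> is the orthogonal sum of a and -d, and the columns of
    \<open>T\<close> = [[D, U C], [0, C]] generate D times the glued lattice. Their Gram matrix is
    thus D^2 times the form sought.\<close>
  define \<Delta> where "\<Delta> i j = (if i < n \<and> j < n then a i j else if n \<le> i \<and> n \<le> j then - d (i - n) (j - n) else 0)" for i j
  define W where "W i j = (\<Sum>k<n. U i k * C k j)" for i j
  define T where "T i j = (if i < n then (if j < n then D * unit j i else W i (j - n))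
      else (if j < n then 0 else C (i - n) (j - n)))" for i j
  have form_\<Delta>: "form (2 * n) \<Delta> x y = form n a x y - form n d (\<lambda>i. x (n + i)) (\<lambda>i. y (n + i))" for x y
  proof -
    have "\<Delta> i j = a i j" "\<Delta> i (n + j) = 0" "\<Delta> (n + i) j = 0" "\<Delta> (n + i) (n + j) = - d i j"
      if "i < n" "j < n" for i j
      using that by (auto simp: \<Delta>_def)
    then show ?thesis
      unfolding form_def sum_lessThan_double by (simp add: sum_negf cong: sum.cong_simp)
  qed
  have T_upper: "mulv (2 * n) T x i = D * x i + mulv n U (mulv n C (\<lambda>k. x (n + k))) i" if "i < n" for x i
  proof -
    have "(\<Sum>k<n. T i k * x k) = (\<Sum>k<n. unit i k * (D * x k))"
      using that by (intro sum.cong) (auto simp: T_def unit_def)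
    moreover have "(\<Sum>k<n. T i (n + k) * x (n + k)) = mulv n U (mulv n C (\<lambda>k. x (n + k))) i"
      using that unfolding mulv_mulv unfolding mulv_def by (intro sum.cong) (auto simp: T_def W_def)
    ultimately show ?thesis using that
      unfolding mulv_def[of "2 * n"] sum_lessThan_double by (simp only: sum_unit)
  qed
  have T_lower: "mulv (2 * n) T x (n + i) = mulv n C (\<lambda>k. x (n + k)) i" for x i
    unfolding mulv_def sum_lessThan_double by (simp add: T_def)
  define up where "up x i = D * x i + mulv n U (mulv n C (\<lambda>k. x (n + k))) i" for x i
  define lo where "lo x = mulv n C (\<lambda>k. x (n + k))" for x
  have form_T: "form (2 * n) (gram (2 * n) \<Delta> T) x y = form n a (up x) (up y) - form n d (lo x) (lo y)" for x y
    unfolding form_gram form_\<Delta> T_lower lo_def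
    by (intro arg_cong2[of _ _ _ _ "(-)"] form_cong) (auto simp: T_upper up_def)
  \<comment> \<open>Integrality and evenness: the three summands are divisible by 2 D^2 because
    \<open>a\<close> is even, because D divides a(x, U C b), and by the assumed congruence. The last
    one explains the modulus.\<close>
  have dvd\<Phi>: "2 * D\<^sup>2 dvd form (2 * n) (gram (2 * n) \<Delta> T) x x" for x
  proof -
    define g where "g = mulv n U (lo x)"
    have "form n a (up x) (up x) = D\<^sup>2 * form n a x x + 2 * D * form n a x g + form n a g g"
      unfolding up_def lo_def[symmetric] g_def[symmetric] form_add_left form_add_right form_scale_left form_scale_right
      by (simp add: syma[of g x] power2_eq_square algebra_simps)
    then have eq: "form (2 * n) (gram (2 * n) \<Delta> T) x x
        = D\<^sup>2 * form n a x x + 2 * D * form n a x g + (form n a g g - form n d (lo x) (lo x))"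
      by (simp add: form_T)
    have "2 * D\<^sup>2 dvd D\<^sup>2 * form n a x x"
      using ea unfolding even_form_def by (metis dvd_refl mult.commute mult_dvd_mono)
    moreover have "2 * D\<^sup>2 dvd 2 * D * form n a x g"
      using Ddvd[of x "\<lambda>k. x (n + k)"] unfolding g_def lo_def power2_eq_square mult.assoc[symmetric]
      by (rule mult_dvd_mono[OF dvd_refl])
    moreover have "2 * D\<^sup>2 dvd form n a g g - form n d (lo x) (lo x)"
      unfolding g_def by (rule U)
    ultimately show ?thesis unfolding eq by (intro dvd_add)
  qed
  have sym\<Phi>: "form (2 * n) (gram (2 * n) \<Delta> T) x y = form (2 * n) (gram (2 * n) \<Delta> T) y x" for x y
    unfolding form_T by (simp add: syma[of "up x"] symd[of "lo x"])
  have D2: "D\<^sup>2 \<noteq> 0" using D(3) by simp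
  obtain \<Phi> where ev: "even_form (2 * n) \<Phi>"
    and f\<Phi>: "\<And>x y. form (2 * n) (gram (2 * n) \<Delta> T) x y = D\<^sup>2 * form (2 * n) \<Phi> x y"
    and det: "fdet (2 * n) (gram (2 * n) \<Delta> T) = (D\<^sup>2) ^ (2 * n) * fdet (2 * n) \<Phi>"
    by (rule even_form_scaled[OF sym\<Phi> dvd\<Phi> D2]) blast
  have key: "D\<^sup>2 * form (2 * n) \<Phi> x x = form n a (up x) (up x) - form n d (lo x) (lo x)" for x
    using f\<Phi> form_T by simp
  \<comment> \<open>Here det T = D^n det C and det \<open>\<Delta>\<close> = +-D^2. As D det C =
    D^n, the Gram matrix has determinant +-D^(4n), and division by D^2 in rank 2n leaves
    +-1.\<close>
  have "\<bar>fdet (2 * n) \<Phi>\<bar> = 1"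
  proof -
    have T: "fdet (n + n) T = D ^ n * fdet n C"
    proof -
      have "fdet (n + n) T = fdet n T * fdet n (\<lambda>i j. T (n + i) (n + j))"
        by (rule fdet_block_upper) (simp add: T_def)
      also have "fdet n T = fdet n (\<lambda>i j. D * (if i = j then 1 else 0))"
        by (rule fdet_cong) (auto simp: T_def unit_def)
      also have "\<dots> = D ^ n" by (simp only: fdet_scale fdet_id mult_1_right)
      also have "(\<lambda>i j. T (n + i) (n + j)) = C" by (simp add: T_def)
      finally show ?thesis .
    qed
    have "fdet (n + n) \<Delta> = fdet n \<Delta> * fdet n (\<lambda>i j. \<Delta> (n + i) (n + j))"
      by (rule fdet_block_upper) (simp add: \<Delta>_def)
    also have "fdet n \<Delta> = D" unfolding D(1)[symmetric] by (rule fdet_cong) (simp add: \<Delta>_def)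
    also have "(\<lambda>i j. \<Delta> (n + i) (n + j)) = (\<lambda>i j. -1 * d i j)" by (simp add: \<Delta>_def)
    finally have "fdet (n + n) \<Delta> = D * ((-1) ^ n * D)" by (simp only: fdet_scale D)
    then have "(D\<^sup>2) ^ (2 * n) * fdet (2 * n) \<Phi> = (D ^ n * fdet n C)\<^sup>2 * (D * ((-1) ^ n * D))"
      using det T by (simp add: fdet_gram mult_2)
    also have "\<dots> = (D ^ n)\<^sup>2 * (fdet n C * D)\<^sup>2 * (-1) ^ n" by (simp add: power2_eq_square)
    also have "\<dots> = (D\<^sup>2) ^ (2 * n) * (-1) ^ n" unfolding detC
      by (simp add: power2_eq_square power_mult_distrib mult_2 power_add)
    finally have "fdet (2 * n) \<Phi> = (-1) ^ n" using D(3) by simp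
    then show ?thesis by simp
  qed
  moreover have "definite_on_kernel 1 (2 * n) n \<Phi>"
    unfolding definite_on_kernel_def
  proof (intro exI[of _ "\<lambda>i k. unit (n + i) k"] allI impI)
    fix x assume x: "\<exists>i<2 * n. x i \<noteq> 0" and "\<forall>i<n. (\<Sum>k<2 * n. unit (n + i) k * x k) = 0"
    then have b: "x (n + i) = 0" if "i < n" for i
      using that by (simp add: sum_unit mult_2)
    have lo: "lo x = (\<lambda>_. 0)" unfolding lo_def mulv_def by (simp add: b)
    have up: "up x = (\<lambda>i. D * x i)"
      using lo unfolding up_def lo_def by (simp add: mulv_def)
    obtain i where i: "i < n" "x i \<noteq> 0"
    proof -
      obtain i where i: "i < 2 * n" "x i \<noteq> 0" using x by blast
      have "i < n"
      proof (rule ccontr)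
        assume "\<not> i < n"
        with i(1) have "i - n < n" "n + (i - n) = i" by auto
        with b[of "i - n"] i(2) show False by simp
      qed
      with i that show thesis by blast
    qed
    have "D\<^sup>2 * form (2 * n) \<Phi> x x = D\<^sup>2 * form n a x x"
      unfolding key up lo by (simp add: form_scale_left form_scale_right power2_eq_square)
    then show "0 < 1 * form (2 * n) \<Phi> x x" using pa[where x = x, OF i] D(3) by simp
  qed
  \<comment> \<open>The first n rows of \<open>T\<close> express that the component in the space of
    \<open>a\<close> vanishes; what remains of the form is -d, up to the factor D^2.\<close>
  moreover have "definite_on_kernel (-1) (2 * n) n \<Phi>"
    unfolding definite_on_kernel_def
  proof (intro exI[of _ T] allI impI)
    fix x assume x: "\<exists>i<2 * n. x i \<noteq> 0" and Tx: "\<forall>i<n. (\<Sum>k<2 * n. T i k * x k) = 0"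
    have up: "up x i = 0" if "i < n" for i
      using Tx that T_upper[OF that, of x] by (simp add: up_def mulv_def[of "2 * n"])
    have "form n a (up x) (up x) = form n a (\<lambda>_. 0) (\<lambda>_. 0)"
      by (intro form_cong) (auto simp: up)
    then have neg: "D\<^sup>2 * form (2 * n) \<Phi> x x = - form n d (lo x) (lo x)"
      unfolding key by simp
    have "\<exists>i<n. lo x i \<noteq> 0"
    proof (rule ccontr)
      assume "\<not> ?thesis"
      then have lo0: "lo x i = 0" if "i < n" for i using that by blast
      then have b: "x (n + i) = 0" if "i < n" for i
        using mulv_zero_imp[OF detC0, of "\<lambda>k. x (n + k)" i] that unfolding lo_def by blast
      have "mulv n U (lo x) i = 0" for i
        unfolding mulv_def by (simp add: lo0)
      then have "x i = 0" if "i < n" for i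
        using up[OF that] D(3) unfolding up_def lo_def[symmetric] by simp
      with b x show False by (metis add_diff_inverse_nat mult_2 nat_add_left_cancel_less)
    qed
    then have "form n d (lo x) (lo x) > 0" using pd by blast
    then have "D\<^sup>2 * form (2 * n) \<Phi> x x < 0" unfolding neg by simp
    then show "0 < - 1 * form (2 * n) \<Phi> x x" by (simp add: mult_less_0_iff)
  qed
  ultimately have "\<exists>X. (\<forall>i<n. \<forall>j<n. form (2 * n) \<Phi> (X i) (X j) = 0) \<and>
    (\<forall>y. (\<forall>k<2 * n. (\<Sum>i<n. y i * X i k) = 0) \<longrightarrow> (\<forall>i<n. y i = 0))"
    using even_unimodular_hyperbolic[OF n ev] by blast
  then obtain X where X: "(\<forall>i<n. \<forall>j<n. form (2 * n) \<Phi> (X i) (X j) = 0) \<and>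
    (\<forall>y. (\<forall>k<2 * n. (\<Sum>i<n. y i * X i k) = 0) \<longrightarrow> (\<forall>i<n. y i = 0))"
    by (elim exE)
  \<comment> \<open>A combination of the n isotropic vectors is sought whose component in the space
    of \<open>d\<close> is proportional to \<open>v\<close>: n equations in n + 1 unknowns, the last
    one being the multiple. The target is d v because C (d v) = D v.\<close>
  obtain y j where j: "j \<le> n" "y j \<noteq> 0" and y: "\<And>k. k < n \<Longrightarrow>
      (\<Sum>j\<le>n. (if j < n then X j (n + k) else - mulv n d v k) * y j) = 0"
    using underdetermined_system[of n "\<lambda>k j. if j < n then X j (n + k) else - mulv n d v k"] by metis
  define x where "x k = (\<Sum>i<n. y i * X i k)" for k
  have b: "x (n + k) = y n * mulv n d v k" if "k < n" for k
  proof -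
    have "(\<Sum>j<n. (if j < n then X j (n + k) else - mulv n d v k) * y j) = x (n + k)"
      unfolding x_def by (intro sum.cong) auto
    then show ?thesis using y[OF that] by (simp flip: lessThan_Suc_atMost)
  qed
  have "form (2 * n) \<Phi> x x = (\<Sum>i<n. \<Sum>j<n. y i * (y j * form (2 * n) \<Phi> (X i) (X j)))"
    unfolding x_def[abs_def]
    by (simp add: form_sum_left form_sum_right form_scale_left form_scale_right sum_distrib_left)
  also have "\<dots> = 0" using X by simp
  finally have iso: "form n a (up x) (up x) = form n d (lo x) (lo x)"
    using key[of x] by simp
  have lo: "lo x i = (y n * D) * v i" if "i < n" for i
  proof -
    have "lo x i = mulv n C (\<lambda>k. y n * mulv n d v k) i"
      unfolding lo_def by (subst mulv_cong) (auto simp: b)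
    also have "\<dots> = y n * mulv n C (mulv n d v) i"
      unfolding mulv_def[of n C] sum_distrib_left by (simp add: mult.left_commute)
    finally show ?thesis using mulv_Cd[OF that] by simp
  qed
  \<comment> \<open>The graph property: if the \<open>d\<close>-component of an isotropic vector is
    0, then definiteness of \<open>a\<close> makes the other one 0 as well, contrary to the
    independence of the \<open>X i\<close>.\<close>
  have "y n \<noteq> 0"
  proof
    assume y0: "y n = 0"
    then have b0: "x (n + k) = 0" if "k < n" for k using b[OF that] by simp
    have lo0: "lo x = (\<lambda>_. 0)" unfolding lo_def mulv_def by (simp add: b0)
    have "up x = (\<lambda>i. D * x i)"
      using lo0 unfolding up_def lo_def by (simp add: mulv_def)
    then have "D\<^sup>2 * form n a x x = 0"
      using iso unfolding lo0 by (simp add: form_scale_left form_scale_right)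
    then have "form n a x x = 0" using D(3) by simp
    then have "x k = 0" if "k < n" for k using pa[OF that, of x] by fastforce
    with b0 have "\<forall>k<2 * n. x k = 0"
      by (metis add_diff_inverse_nat mult_2 nat_add_left_cancel_less)
    then have "\<forall>i<n. y i = 0" using X unfolding x_def by blast
    with y0 j show False by (metis le_neq_implies_less)
  qed
  show thesis
  proof (rule that)
    show "y n * D \<noteq> 0" using \<open>y n \<noteq> 0\<close> D(3) by simp
    have "form n d (lo x) (lo x) = form n d (\<lambda>i. (y n * D) * v i) (\<lambda>i. (y n * D) * v i)"
      by (intro form_cong) (auto simp: lo)
    then show "form n a (up x) (up x) = (y n * D)\<^sup>2 * form n d v v"
      unfolding iso by (simp add: form_scale_left form_scale_right power2_eq_square)
  qed
qed

section \<open>Chinese remainder theorem: one integer matrix for all primes dividing the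
  modulus\<close>

lemma fdet_mod_cong:
  fixes A B :: "nat \<Rightarrow> nat \<Rightarrow> int"
  assumes "\<And>i j. i < n \<Longrightarrow> j < n \<Longrightarrow> M dvd A i j - B i j"
  shows "M dvd fdet n A - fdet n B"
proof -
  have "(\<Prod>i = 0..<n. A i (p i)) mod M = (\<Prod>i = 0..<n. B i (p i)) mod M" if "p permutes {0..<n}" for p
  proof -
    have "A i (p i) mod M = B i (p i) mod M" if "i \<in> {0..<n}" for i
      using that assms[of i "p i"] permutes_in_image[OF \<open>p permutes {0..<n}\<close>, of i] by (simp add: mod_eq_dvd_iff)
    then have "(\<Prod>i = 0..<n. A i (p i) mod M) mod M = (\<Prod>i = 0..<n. B i (p i) mod M) mod M"
      by (metis (mono_tags, lifting) prod.cong)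
    then show ?thesis by (simp only: mod_prod_eq)
  qed
  then have "fdet n A mod M = fdet n B mod M"
    unfolding fdet_leibniz by (intro sum_mod_cong mod_mult_cong refl) simp
  then show ?thesis by (simp add: mod_eq_dvd_iff)
qed

text \<open>With y' = y + M t the difference is 2 M a(y, t) + M^2 a(t, t), and a(t, t) is
  even.\<close>

lemma even_form_cong_dvd:
  assumes "even_form n a" "\<And>i. i < n \<Longrightarrow> M dvd y' i - y i"
  shows "2 * M dvd form n a y' y' - form n a y y"
proof -
  define t where "t i = (y' i - y i) div M" for i
  have "form n a y' y' = form n a (\<lambda>i. y i + M * t i) (\<lambda>i. y i + M * t i)"
    by (rule form_cong) (use assms(2) in \<open>auto simp: t_def\<close>)
  also have "\<dots> = form n a y y + 2 * M * form n a y t + M * M * form n a t t"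
    using assms(1) unfolding even_form_def
    by (simp add: form_add_left form_add_right form_scale_left form_scale_right algebra_simps)
  finally have eq: "form n a y' y' - form n a y y = 2 * M * form n a y t + M * (M * form n a t t)" by simp
  have "2 * M dvd M * (M * form n a t t)"
    using assms(1) unfolding even_form_def by (simp add: mult.commute[of 2])
  then show ?thesis unfolding eq by (intro dvd_add) auto
qed

text \<open>The matrix 2 G_q with its indices renumbered by \<open>f\<close>. Doubling keeps odd
  mixed coefficients integral and makes the form even.\<close>

definition polar :: "'n qform \<Rightarrow> (nat \<Rightarrow> 'n) \<Rightarrow> nat \<Rightarrow> nat \<Rightarrow> int" where
  "polar c f i j = c (f i) (f j) + c (f j) (f i)"

lemma form_polar:
  fixes c :: "'n::finite qform"
  assumes "bij_betw f {..<n} UNIV"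
  shows "form n (polar c f) (\<lambda>i. x (f i)) (\<lambda>i. x (f i)) = 2 * qval c x"
proof -
  have reindex: "(\<Sum>i<n. h (f i)) = (\<Sum>i\<in>UNIV. h i)" for h :: "'n \<Rightarrow> int"
    by (rule sum.reindex_bij_betw[OF assms])
  have "form n (polar c f) (\<lambda>i. x (f i)) (\<lambda>i. x (f i))
      = (\<Sum>i<n. \<Sum>j<n. c (f i) (f j) * (x (f i) * x (f j))) + (\<Sum>i<n. \<Sum>j<n. c (f j) (f i) * (x (f j) * x (f i)))"
    unfolding form_def polar_def sum.distrib[symmetric] by (intro sum.cong) (auto simp: algebra_simps)
  also have "(\<Sum>i<n. \<Sum>j<n. c (f j) (f i) * (x (f j) * x (f i))) = (\<Sum>i<n. \<Sum>j<n. c (f i) (f j) * (x (f i) * x (f j)))"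
    by (rule sum.swap)
  also have "(\<Sum>i<n. \<Sum>j<n. c (f i) (f j) * (x (f i) * x (f j))) = qval c x"
    unfolding qval_def by (simp add: reindex[of "\<lambda>j. c _ j * (x _ * x j)"] reindex[of "\<lambda>i. \<Sum>j\<in>UNIV. c i j * (x i * x j)"])
  finally show ?thesis by simp
qed

lemma bij_betw_coordinates:
  assumes "bij_betw f {..<n} UNIV"
  obtains x where "\<And>i. i < n \<Longrightarrow> x (f i) = z i"
  using assms that[of "\<lambda>k. z (inv_into {..<n} f k)"] by (auto simp: bij_betw_def)

lemma even_form_polar:
  fixes c :: "'n::finite qform"
  assumes "bij_betw f {..<n} UNIV"
  shows "even_form n (polar c f)"
  unfolding even_form_def
proof
  show "\<forall>x y. form n (polar c f) x y = form n (polar c f) y x"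
    unfolding form_symmetric_iff by (simp add: polar_def add.commute)
  show "\<forall>x. even (form n (polar c f) x x)"
  proof
    fix z :: "nat \<Rightarrow> int"
    obtain x where "\<And>i. i < n \<Longrightarrow> x (f i) = z i" using bij_betw_coordinates[OF assms] by metis
    then have "form n (polar c f) z z = form n (polar c f) (\<lambda>i. x (f i)) (\<lambda>i. x (f i))"
      by (intro form_cong) auto
    then show "even (form n (polar c f) z z)" by (simp add: form_polar[OF assms])
  qed
qed

text \<open>Strong induction on M, one prime power at a time. The property depends only on U modulo
  M (\<open>transfer\<close>), so solutions for \<nu>^k and for the cofactor M' combine through a
  Bezout identity. Invertibility over the \<nu>-adic integers makes det U prime to \<nu>.\<close>

lemma locally_equivalent_congruence:
  fixes c d :: "'n::finite qform"
  assumes f: "bij_betw f {..<n} UNIV"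
    and loc: "\<And>\<nu>::nat. Factorial_Ring.prime \<nu> \<Longrightarrow> equivalent_over (padic_int \<nu>) c d"
    and "M > 0"
  shows "\<exists>U. (\<forall>x. 2 * int M dvd form n (polar c f) (mulv n U x) (mulv n U x) - form n (polar d f) x x)
    \<and> coprime (fdet n U) (int M)"
  using \<open>M > 0\<close>
proof (induction M rule: less_induct)
  case (less M)
  let ?a = "polar c f" and ?b = "polar d f"
  let ?P = "\<lambda>M U. (\<forall>x. 2 * M dvd form n ?a (mulv n U x) (mulv n U x) - form n ?b x x) \<and> coprime (fdet n U) M"
  have ea: "even_form n ?a" and eb: "even_form n ?b" by (rule even_form_polar[OF f])+
  have transfer: "?P M U'" if P: "?P M U" and UU: "\<And>i j. M dvd U' i j - U i j" for M U U'
  proof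
    show "\<forall>x. 2 * M dvd form n ?a (mulv n U' x) (mulv n U' x) - form n ?b x x"
    proof
      fix x
      have "M dvd mulv n U' x i - mulv n U x i" for i
        unfolding mulv_def sum_subtractf[symmetric] left_diff_distrib[symmetric]
        by (intro dvd_sum dvd_mult2 UU)
      then have "2 * M dvd form n ?a (mulv n U' x) (mulv n U' x) - form n ?a (mulv n U x) (mulv n U x)"
        by (intro even_form_cong_dvd ea)
      moreover have "2 * M dvd form n ?a (mulv n U x) (mulv n U x) - form n ?b x x" using P by blast
      ultimately have "2 * M dvd (form n ?a (mulv n U' x) (mulv n U' x) - form n ?a (mulv n U x) (mulv n U x))
          + (form n ?a (mulv n U x) (mulv n U x) - form n ?b x x)"
        by (rule dvd_add)
      then show "2 * M dvd form n ?a (mulv n U' x) (mulv n U' x) - form n ?b x x" by simp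
    qed
    have "M dvd fdet n U' - fdet n U" by (intro fdet_mod_cong UU)
    then obtain k where "fdet n U' = fdet n U + M * k" by (metis add.commute diff_add_cancel dvdE)
    then show "coprime (fdet n U') M"
      using P by (metis coprime_iff_gcd_eq_1 gcd.commute gcd_add_mult mult.commute add.commute)
  qed
  show ?case
  proof (cases "M = 1")
    case True
    have "even (form n ?a x x - form n ?b y y)" for x y
      using ea eb unfolding even_form_def by simp
    then show ?thesis using True by simp
  next
    case False
    then obtain \<nu> where \<nu>: "Factorial_Ring.prime \<nu>" "\<nu> dvd M" using prime_factor_nat by blast
    define k where "k = multiplicity \<nu> M"
    have "\<not> is_unit \<nu>" "M \<noteq> 0" using \<nu>(1) less.prems not_prime_unit by auto
    then obtain M' where M': "M = \<nu> ^ k * M'" "\<not> \<nu> dvd M'"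
      unfolding k_def using multiplicity_decompose'[of M \<nu>] by metis
    have "k > 0" using M' \<nu>(2) by (cases k) auto
    have "M' < M" "M' > 0"
      using M'(1) less.prems one_less_power[OF prime_gt_1_nat[OF \<nu>(1)] \<open>k > 0\<close>] by auto
    then obtain U2 where U2: "?P (int M') U2" using less.IH by blast
    obtain U1 where U1: "?P (int \<nu> ^ k) U1"
    proof -
      obtain U0 V0 :: "'n \<Rightarrow> 'n \<Rightarrow> int" where
        U0: "\<And>x. int \<nu> ^ k dvd qval c (\<lambda>i. \<Sum>j\<in>UNIV. U0 i j * x j) - qval d x" and
        V0: "\<And>i j. int \<nu> ^ k dvd (\<Sum>l\<in>UNIV. U0 i l * V0 l j) - (if i = j then 1 else 0)"
        by (rule padic_equivalence_congruence[OF prime_gt_0_nat[OF \<nu>(1)] loc[OF \<nu>(1)], of k]) blast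
      define U where "U i j = U0 (f i) (f j)" for i j
      define V where "V i j = V0 (f i) (f j)" for i j
      have "2 * int \<nu> ^ k dvd form n ?a (mulv n U z) (mulv n U z) - form n ?b z z" for z
      proof -
        obtain x where x: "\<And>i. i < n \<Longrightarrow> x (f i) = z i" using bij_betw_coordinates[OF f] by metis
        define X where "X i = (\<Sum>j\<in>UNIV. U0 i j * x j)" for i
        have "mulv n U z = (\<lambda>i. X (f i))"
        proof
          fix i
          have "mulv n U z i = (\<Sum>j<n. U0 (f i) (f j) * x (f j))"
            unfolding mulv_def U_def by (intro sum.cong) (auto simp: x)
          also have "\<dots> = X (f i)" unfolding X_def by (rule sum.reindex_bij_betw[OF f])
          finally show "mulv n U z i = X (f i)" .
        qed
        then have "form n ?a (mulv n U z) (mulv n U z) = 2 * qval c X"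
          by (simp add: form_polar[OF f])
        moreover have "form n ?b z z = form n ?b (\<lambda>i. x (f i)) (\<lambda>i. x (f i))"
          by (intro form_cong) (auto simp: x)
        ultimately have eq: "form n ?a (mulv n U z) (mulv n U z) - form n ?b z z = 2 * (qval c X - qval d x)"
          by (simp add: form_polar[OF f])
        show ?thesis unfolding eq X_def[abs_def] by (rule mult_dvd_mono[OF dvd_refl U0])
      qed
      moreover have "coprime (fdet n U) (int \<nu> ^ k)"
      proof -
        have inj: "f i = f j \<longleftrightarrow> i = j" if "i < n" "j < n" for i j
          using inj_on_eq_iff[OF bij_betw_imp_inj_on[OF f]] that by simp
        have "int \<nu> ^ k dvd fdet n (\<lambda>i j. \<Sum>l<n. U i l * V l j) - fdet n (\<lambda>i j. if i = j then 1 else 0)"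
        proof (rule fdet_mod_cong)
          fix i j assume "i < n" "j < n"
          have "(\<Sum>l<n. U i l * V l j) = (\<Sum>l\<in>UNIV. U0 (f i) l * V0 l (f j))"
            unfolding U_def V_def by (rule sum.reindex_bij_betw[OF f])
          then show "int \<nu> ^ k dvd (\<Sum>l<n. U i l * V l j) - (if i = j then 1 else 0)"
            using V0[of "f i" "f j"] inj[OF \<open>i < n\<close> \<open>j < n\<close>] by simp
        qed
        then have "int \<nu> ^ k dvd fdet n U * fdet n V - 1" by (simp add: fdet_mult)
        then obtain m where m: "fdet n U * fdet n V - 1 = int \<nu> ^ k * m" by blast
        show ?thesis
        proof (rule coprimeI)
          fix g assume "g dvd fdet n U" "g dvd int \<nu> ^ k"
          then have "g dvd fdet n U * fdet n V - int \<nu> ^ k * m" by (intro dvd_diff dvd_mult2)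
          moreover have "fdet n U * fdet n V - int \<nu> ^ k * m = 1" using m by simp
          ultimately show "g dvd 1" by simp
        qed
      qed
      ultimately show thesis using that by blast
    qed
    have cop: "coprime (int \<nu> ^ k) (int M')"
    proof -
      have "coprime (\<nu> ^ k) M'" using \<nu>(1) M'(2) by (simp add: prime_imp_coprime)
      then show ?thesis by (metis coprime_int_iff of_nat_power)
    qed
    then obtain r s where rs: "r * int \<nu> ^ k + s * int M' = 1"
      using bezout_int[of "int \<nu> ^ k" "int M'"] by (metis coprime_iff_gcd_eq_1)
    define U where "U i j = U1 i j * (s * int M') + U2 i j * (r * int \<nu> ^ k)" for i j
    have "U i j - U1 i j = int \<nu> ^ k * (r * (U2 i j - U1 i j))" for i j
    proof -
      have eq: "s * int M' = 1 - r * int \<nu> ^ k" using rs by simp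
      show ?thesis unfolding U_def eq by (simp add: algebra_simps)
    qed
    then have P1: "?P (int \<nu> ^ k) U" by (intro transfer[OF U1]) simp
    have "U i j - U2 i j = int M' * (s * (U1 i j - U2 i j))" for i j
    proof -
      have eq: "r * int \<nu> ^ k = 1 - s * int M'" using rs by simp
      show ?thesis unfolding U_def eq by (simp add: algebra_simps)
    qed
    then have P2: "?P (int M') U" by (intro transfer[OF U2]) simp
    have M: "int M = int \<nu> ^ k * int M'" using M'(1) by simp
    \<comment> \<open>The moduli 2 \<nu>^k and 2 M' share the factor 2, so coprimality is applied to
      half the difference.\<close>
    have "2 * int M dvd form n ?a (mulv n U x) (mulv n U x) - form n ?b x x" for x
    proof -
      have d1: "2 * int \<nu> ^ k dvd form n ?a (mulv n U x) (mulv n U x) - form n ?b x x" using P1 by blast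
      have d2: "2 * int M' dvd form n ?a (mulv n U x) (mulv n U x) - form n ?b x x" using P2 by blast
      obtain h where h: "form n ?a (mulv n U x) (mulv n U x) - form n ?b x x = 2 * h"
        using dvd_mult_left[OF d1] by (rule dvdE)
      have "int \<nu> ^ k dvd h" "int M' dvd h"
        using d1 d2 unfolding h by simp_all
      then have "int M dvd h" unfolding M by (intro divides_mult cop)
      then show ?thesis unfolding h by simp
    qed
    moreover have "coprime (fdet n U) (int M)"
      using P1 P2 unfolding M by simp
    ultimately show ?thesis by blast
  qed
qed

text \<open>For every modulus M > 0 the determinants satisfy u^2 A \<equiv> B for some u prime to M.
  A common multiple as modulus shows that they divide each other, and A = -B would make -1 a square
  modulo 4.\<close>

lemma fdet_polar_eq:
  fixes c d :: "'n::finite qform"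
  assumes f: "bij_betw f {..<n} UNIV"
    and loc: "\<And>\<nu>::nat. Factorial_Ring.prime \<nu> \<Longrightarrow> equivalent_over (padic_int \<nu>) c d"
    and nz: "fdet n (polar d f) \<noteq> 0"
  shows "fdet n (polar c f) = fdet n (polar d f)"
proof -
  define A where "A = fdet n (polar c f)"
  define B where "B = fdet n (polar d f)"
  have cong: "\<exists>u. M dvd u\<^sup>2 * A - B \<and> coprime u M" if pos: "M > 0" for M :: int
  proof -
    obtain m where m: "M = int m" "m > 0" using pos_int_cases[OF pos] by blast
    have "\<exists>U. (\<forall>x. 2 * M dvd form n (polar c f) (mulv n U x) (mulv n U x) - form n (polar d f) x x)
        \<and> coprime (fdet n U) M"
      unfolding m(1) by (rule locally_equivalent_congruence[OF f _ m(2)]) (rule loc)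
    then obtain U where "\<forall>x. 2 * M dvd form n (polar c f) (mulv n U x) (mulv n U x) - form n (polar d f) x x"
      and cop: "coprime (fdet n U) M" by (elim exE conjE)
    then have U: "2 * M dvd form n (polar c f) (mulv n U x) (mulv n U x) - form n (polar d f) x x" for x by simp
    have "M dvd gram n (polar c f) U i j - polar d f i j" if ij: "i < n" "j < n" for i j
    proof -
      have "form n (polar c f) (mulv n U (unit i)) (mulv n U (unit j)) = gram n (polar c f) U i j"
        using ij by (simp add: form_gram[symmetric] form_unit)
      then show ?thesis
        using even_form_difference_dvd[OF even_form_polar[OF f] even_form_polar[OF f] U, of "unit i" "unit j"] ij
        by (simp add: form_unit)
    qed
    then have "M dvd fdet n (gram n (polar c f) U) - B"
      unfolding B_def by (rule fdet_mod_cong)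
    then show ?thesis using cop by (auto simp: fdet_gram A_def)
  qed
  have B0: "B \<noteq> 0" using nz by (simp add: B_def)
  have A0: "A \<noteq> 0"
  proof
    assume "A = 0"
    then have "2 * \<bar>B\<bar> dvd B" using cong[of "2 * \<bar>B\<bar>"] B0 by auto
    then have "\<bar>2 * \<bar>B\<bar>\<bar> \<le> \<bar>B\<bar>" using B0 by (intro dvd_imp_le_int) auto
    then show False using B0 by simp
  qed
  \<comment> \<open>A multiple of A and B for the mutual divisibility, and of 4 B so that the
    modulus 4 remains after cancelling B.\<close>
  define M where "M = 4 * (\<bar>A\<bar> * \<bar>B\<bar>)"
  obtain u where u: "M dvd u\<^sup>2 * A - B" "coprime u M"
    using cong[of M] A0 B0 by (auto simp: M_def)
  have "A dvd M" "B dvd M" "4 * B dvd M" by (auto simp: M_def)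
  have "A dvd u\<^sup>2 * A - B" using \<open>A dvd M\<close> u(1) by (rule dvd_trans)
  from dvd_diff[OF dvd_triv_right[of A "u\<^sup>2"] this] have AB: "A dvd B" by simp
  have "B dvd u\<^sup>2 * A - B" using \<open>B dvd M\<close> u(1) by (rule dvd_trans)
  from dvd_add[OF this dvd_refl] have "B dvd u\<^sup>2 * A" by simp
  moreover have "coprime B (u\<^sup>2)" using u(2) \<open>B dvd M\<close> by (meson coprime_commute coprime_divisors coprime_power_right_iff dvd_refl)
  ultimately have "B dvd A" by (metis coprime_dvd_mult_right_iff)
  with AB have "\<bar>A\<bar> = \<bar>B\<bar>" by (metis zdvd_antisym_abs)
  then consider "A = B" | "A = - B" by linarith
  then show ?thesis
  proof cases
    case 2
    have eq: "u\<^sup>2 * A - B = B * - (u\<^sup>2 + 1)" using 2 by (simp add: algebra_simps)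
    have "B * 4 dvd B * - (u\<^sup>2 + 1)"
      using dvd_trans[OF \<open>4 * B dvd M\<close> u(1)] unfolding eq by (simp only: mult.commute)
    then have "4 dvd - (u\<^sup>2 + 1)" using B0 by (simp only: dvd_mult_cancel_left simp_thms)
    then have "4 dvd u\<^sup>2 + 1" by (simp only: dvd_minus_iff)
    then have False
    proof (cases "even u")
      case True
      then obtain t where "u = 2 * t" by blast
      then show ?thesis using \<open>4 dvd u\<^sup>2 + 1\<close> by (simp add: power2_eq_square) presburger
    next
      case False
      then obtain t where "u = 2 * t + 1" by (rule oddE)
      then have "u\<^sup>2 + 1 = 4 * (t * t + t) + 2" by (simp add: power2_eq_square algebra_simps)
      then show ?thesis using \<open>4 dvd u\<^sup>2 + 1\<close> by presburger
    qed
    then show ?thesis ..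
  qed (simp add: A_def B_def)
qed

section \<open>The genus of \<open>q5\<close>\<close>

lemma fdet_of_int: "fdet n (\<lambda>i j. of_int (A i j)) = of_int (fdet n A)"
  by (simp add: fdet_leibniz)

text \<open>Bridge to determinants indexed by a finite type: permutations are conjugated by the
  enumeration \<open>f\<close>, which preserves their signs.\<close>

lemma det_eq_fdet:
  fixes M :: "'a::comm_ring_1 ^ 'n ^ 'n"
  assumes f: "bij_betw f {0..<n} UNIV"
  shows "det M = fdet n (\<lambda>i j. M $ f i $ f j)"
proof -
  let ?m = "\<lambda>p x. if x \<in> UNIV then f (p (inv_into {0..<n} f x)) else x"
  have inj: "inj_on f {0..<n}" using f by (rule bij_betw_imp_inj_on)
  have m: "?m p (f i) = f (p i)" if "i < n" for p i
    using that inv_into_f_f[OF inj] by simp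
  have sign: "sign (?m p) = sign p" if "p permutes {0..<n}" for p
  proof -
    have "map_permutation {0..<n} f p = ?m p"
      using bij_betw_imp_surj_on[OF f] by (simp add: map_permutation_def fun_eq_iff)
    then show ?thesis using sign_map_permutation[OF inj that] by simp
  qed
  have "det M = (\<Sum>p | p permutes {0..<n}. of_int (sign (?m p)) * (\<Prod>i\<in>UNIV. M $ i $ ?m p i))"
    unfolding Determinants.det_def by (rule sum.reindex_bij_betw[OF bij_betw_permutations[OF f], symmetric])
  also have "\<dots> = (\<Sum>p | p permutes {0..<n}. of_int (sign p) * (\<Prod>i = 0..<n. M $ f i $ f (p i)))"
  proof (intro sum.cong refl)
    fix p assume "p \<in> {p. p permutes {0..<n}}"
    moreover have "(\<Prod>i\<in>UNIV. M $ i $ ?m p i) = (\<Prod>i = 0..<n. M $ f i $ ?m p (f i))"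
      by (rule prod.reindex_bij_betw[OF f, symmetric])
    moreover have "(\<Prod>i = 0..<n. M $ f i $ ?m p (f i)) = (\<Prod>i = 0..<n. M $ f i $ f (p i))"
      using m by (intro prod.cong) auto
    ultimately show "of_int (sign (?m p)) * (\<Prod>i\<in>UNIV. M $ i $ ?m p i)
      = of_int (sign p) * (\<Prod>i = 0..<n. M $ f i $ f (p i))"
      using sign[of p] by simp
  qed
  finally show ?thesis by (simp add: fdet_leibniz)
qed

lemma qf_eval_of_int:
  fixes c :: "'n::finite qform"
  shows "qf_eval c (\<chi> i. of_int (x i) :: 'a::comm_ring_1 ^ 'n) = of_int (qval c x)"
  by (simp add: qf_eval_def qval_def)

lemma qf_eval_int: "qf_eval c (x :: int ^ 'n) = qval c (\<lambda>i. x $ i)"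
  by (simp add: qf_eval_def qval_def)

lemma pos_def_qval:
  fixes c :: "'n::finite qform"
  assumes "pos_def c" "x i \<noteq> 0"
  shows "qval c x > 0"
proof -
  have "(\<chi> i. of_int (x i) :: real ^ 'n) \<noteq> 0"
    using assms(2) by (auto simp: Finite_Cartesian_Product.vec_eq_iff)
  then have "qf_eval c (\<chi> i. of_int (x i) :: real ^ 'n) > 0"
    using assms(1) unfolding pos_def_def by blast
  then show ?thesis unfolding qf_eval_of_int by simp
qed

lemma pos_def_polar:
  fixes c :: "'n::finite qform"
  assumes "pos_def c" "bij_betw f {..<n} UNIV" "i < n" "z i \<noteq> 0"
  shows "form n (polar c f) z z > 0"
proof -
  obtain x where x: "\<And>i. i < n \<Longrightarrow> x (f i) = z i"
    by (rule bij_betw_coordinates[where z = z, OF assms(2)]) blast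
  then have "form n (polar c f) z z = form n (polar c f) (\<lambda>i. x (f i)) (\<lambda>i. x (f i))"
    by (intro form_cong) auto
  then show ?thesis
    using pos_def_qval[OF assms(1), of x "f i"] x[OF assms(3)] assms(4) by (simp add: form_polar[OF assms(2)])
qed

text \<open>The order 0, 1, 3, 2, 4 of the variables makes the Gram matrix of \<open>q5\<close> block diagonal.\<close>

definition q5_index :: "nat \<Rightarrow> 5" where
  "q5_index i = (if i = 0 then 0 else if i = 1 then 1 else if i = 2 then 3 else if i = 3 then 2 else 4)"

lemma bij_betw_q5_index: "bij_betw q5_index {..<5} UNIV"
proof -
  have "{..<5} = {0, 1, 2, 3, 4 :: nat}" by auto
  then have "q5_index ` {..<5} = UNIV"
    unfolding UNIV_5 by (simp add: q5_index_def insert_commute)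
  then show ?thesis
    unfolding bij_betw_def by (auto intro!: eq_card_imp_inj_on)
qed

lemma fdet_2_symmetric:
  fixes A :: "nat \<Rightarrow> nat \<Rightarrow> int"
  assumes "A 0 1 = A 1 0" "A 0 0 \<noteq> 0"
  shows "fdet 2 A = A 0 0 * A 1 1 - (A 0 1)\<^sup>2"
proof -
  have "A i j = A j i" if "i \<le> 1" "j \<le> 1" for i j
    using that assms(1) by (cases i; cases j) auto
  then have "A 0 0 * fdet 1 (\<lambda>i j. A 0 0 * A (Suc i) (Suc j) - A 0 (Suc i) * A 0 (Suc j)) = A 0 0 ^ 1 * fdet (Suc 1) A"
    using assms(2) by (intro fdet_schur)
  then show ?thesis
    using assms(2) by (simp add: power2_eq_square numeral_2_eq_2)
qed

lemma polar_q5_entry: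
  assumes "i < 5" "j < 5"
  shows "polar (q5 p) q5_index i j = (if i = j then if i = 0 then 2 else if i \<in> {1, 3} then 8 else 2 * int p + 2
    else if (i, j) \<in> {(1, 2), (2, 1), (3, 4), (4, 3)} then 4 else 0)"
proof -
  have d: "(0::5) \<noteq> 1" "(0::5) \<noteq> 2" "(0::5) \<noteq> 3" "(0::5) \<noteq> 4" "(1::5) \<noteq> 2" "(1::5) \<noteq> 3"
    "(1::5) \<noteq> 4" "(2::5) \<noteq> 3" "(2::5) \<noteq> 4" "(3::5) \<noteq> 4"
    by simp_all
  have "i \<in> {0, 1, 2, 3, 4}" "j \<in> {0, 1, 2, 3, 4}" using assms by auto
  then show ?thesis
    by (elim insertE emptyE) (simp_all add: polar_def q5_index_def q5_def d d[symmetric] del: eq_numeral_iff_iszero)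
qed

text \<open>The diagonal blocks are 2 and two copies of [[8, 4], [4, 2p + 2]], each of determinant
  16 p.\<close>

lemma fdet_polar_q5: "fdet 5 (polar (q5 p) q5_index) = 2 ^ 9 * (int p)\<^sup>2"
proof -
  let ?A = "polar (q5 p) q5_index"
  define B where "B i j = ?A (Suc i) (Suc j)" for i j
  have B: "B i j = (if i = j then if i \<in> {0, 2} then 8 else 2 * int p + 2
      else if (i, j) \<in> {(0, 1), (1, 0), (2, 3), (3, 2)} then 4 else 0)" if "i < 4" "j < 4" for i j
    using that unfolding B_def by (subst polar_q5_entry) auto
  have "fdet (Suc 4) ?A = ?A 0 0 * fdet 4 (\<lambda>i j. ?A (Suc i) (Suc j))"
    by (rule fdet_Suc_upper) (simp add: polar_q5_entry)
  then have e1: "fdet 5 ?A = 2 * fdet 4 B"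
    unfolding B_def[abs_def] by (simp add: polar_q5_entry)
  have "fdet (2 + 2) B = fdet 2 B * fdet 2 (\<lambda>i j. B (2 + i) (2 + j))"
    by (rule fdet_block_upper) (simp add: B)
  then have e2: "fdet 4 B = fdet 2 B * fdet 2 (\<lambda>i j. B (2 + i) (2 + j))" by simp
  have e3: "fdet 2 B = 16 * int p"
    using fdet_2_symmetric[of B] by (simp add: B algebra_simps)
  have e4: "fdet 2 (\<lambda>i j. B (2 + i) (2 + j)) = 16 * int p"
    using fdet_2_symmetric[of "\<lambda>i j. B (2 + i) (2 + j)"] by (simp add: B algebra_simps)
  show ?thesis unfolding e1 e2 e3 e4 by (simp add: power2_eq_square)
qed

lemma pos_def_q5:
  assumes "p > 0"
  shows "pos_def (q5 p)"
  unfolding pos_def_def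
proof (intro allI impI)
  fix x :: "real ^ 5" assume "x \<noteq> 0"
  have "qf_eval (q5 p) x = (x $ 0)\<^sup>2 + (2 * x $ 1 + x $ 3)\<^sup>2 + (2 * x $ 2 + x $ 4)\<^sup>2
      + real p * (x $ 3)\<^sup>2 + real p * (x $ 4)\<^sup>2" (is "_ = ?s")
    by (simp add: qf_eval_q5 power2_eq_square algebra_simps)
  moreover have "?s > 0"
  proof (rule ccontr)
    have nonneg: "(x $ 0)\<^sup>2 \<ge> 0" "(2 * x $ 1 + x $ 3)\<^sup>2 \<ge> 0" "(2 * x $ 2 + x $ 4)\<^sup>2 \<ge> 0"
      "real p * (x $ 3)\<^sup>2 \<ge> 0" "real p * (x $ 4)\<^sup>2 \<ge> 0" by simp_all
    assume "\<not> ?s > 0"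
    then have "(x $ 0)\<^sup>2 = 0" "(2 * x $ 1 + x $ 3)\<^sup>2 = 0" "(2 * x $ 2 + x $ 4)\<^sup>2 = 0"
      "real p * (x $ 3)\<^sup>2 = 0" "real p * (x $ 4)\<^sup>2 = 0" using nonneg by linarith+
    then have "x $ 0 = 0" "x $ 1 = 0" "x $ 2 = 0" "x $ 3 = 0" "x $ 4 = 0"
      using assms by simp_all
    then have "x $ i = 0" for i using UNIV_I[of i, unfolded UNIV_5] by blast
    then show False using \<open>x \<noteq> 0\<close> by (simp add: Finite_Cartesian_Product.vec_eq_iff)
  qed
  ultimately show "qf_eval (q5 p) x > 0" by simp
qed

lemma fdet_polar_genus:
  assumes "p > 0" "c \<in> genus (q5 p)"
  shows "fdet 5 (polar c q5_index) = 2 ^ 9 * (int p)\<^sup>2"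
proof -
  have "fdet 5 (polar c q5_index) = fdet 5 (polar (q5 p) q5_index)"
    by (rule fdet_polar_eq[OF bij_betw_q5_index]) (use assms in \<open>auto simp: genus_def fdet_polar_q5\<close>)
  then show ?thesis by (simp add: fdet_polar_q5)
qed

lemma genus_represents_square:
  assumes "p > 0" "c \<in> genus (q5 p)"
  obtains x z where "z \<noteq> 0" "qval c x = z\<^sup>2"
proof -
  let ?a = "polar c q5_index" and ?d = "polar (q5 p) q5_index"
  define D where "D = 2 ^ 9 * (int p)\<^sup>2"
  have D0: "D > 0" using assms(1) by (simp add: D_def)
  have pc: "pos_def c" and loc: "\<And>\<nu>::nat. Factorial_Ring.prime \<nu> \<Longrightarrow> equivalent_over (padic_int \<nu>) c (q5 p)"
    using assms(2) by (auto simp: genus_def)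
  obtain m where m: "D\<^sup>2 = int m" "m > 0"
    using pos_int_cases[OF zero_less_power[OF D0, of 2]] by blast
  have "\<exists>U. (\<forall>x. 2 * D\<^sup>2 dvd form 5 ?a (mulv 5 U x) (mulv 5 U x) - form 5 ?d x x) \<and> coprime (fdet 5 U) (D\<^sup>2)"
    unfolding m(1) by (rule locally_equivalent_congruence[OF bij_betw_q5_index _ m(2)]) (rule loc)
  then obtain U where U: "\<forall>x. 2 * D\<^sup>2 dvd form 5 ?a (mulv 5 U x) (mulv 5 U x) - form 5 ?d x x"
    and cop: "coprime (fdet 5 U) (D\<^sup>2)" by (elim exE conjE)
  have cop': "coprime (fdet 5 U) D" using cop by simp
  \<comment> \<open>\<open>q5\<close> takes the value 1 at \<open>unit 0\<close>, so its polar form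
    takes the value 2 there, and the factor 2 cancels on both sides.\<close>
  obtain w t where t: "t \<noteq> 0" and w: "form 5 ?a w w = t\<^sup>2 * form 5 ?d (unit 0) (unit 0)"
  proof (rule glue_isometry[of 5 ?a ?d D U "unit 0"])
    show "even_form 5 ?a" "even_form 5 ?d" by (rule even_form_polar[OF bij_betw_q5_index])+
    show "0 < form 5 ?a x x" if "i < 5" "x i \<noteq> 0" for x i
      by (rule pos_def_polar[where z = x, OF pc bij_betw_q5_index that])
    show "0 < form 5 ?d x x" if "i < 5" "x i \<noteq> 0" for x i
      by (rule pos_def_polar[where z = x, OF pos_def_q5[OF assms(1)] bij_betw_q5_index that])
    show "fdet 5 ?a = D" unfolding D_def by (rule fdet_polar_genus[OF assms])
    show "fdet 5 ?d = D" unfolding D_def by (rule fdet_polar_q5)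
    show "D \<noteq> 0" using D0 by simp
    show "2 * D\<^sup>2 dvd form 5 ?a (mulv 5 U x) (mulv 5 U x) - form 5 ?d x x" for x using U by blast
    show "coprime (fdet 5 U) D" by (rule cop')
  qed auto
  obtain x where x: "\<And>i. i < 5 \<Longrightarrow> x (q5_index i) = w i"
    by (rule bij_betw_coordinates[where z = w, OF bij_betw_q5_index]) blast
  then have "form 5 ?a w w = form 5 ?a (\<lambda>i. x (q5_index i)) (\<lambda>i. x (q5_index i))"
    by (intro form_cong) auto
  moreover have "form 5 ?d (unit 0) (unit 0) = 2"
    by (simp add: form_unit polar_q5_entry)
  ultimately have "qval c x = t\<^sup>2" using w by (simp add: form_polar[OF bij_betw_q5_index])
  with t show thesis by (rule that)
qed

lemma gcd_vec_dvd: "gcd_vec x dvd x $ i"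
  by (simp add: gcd_vec_def)

text \<open>Dividing by the gcd g keeps the value a square: g^2 divides z^2, hence g divides
  z.\<close>

lemma genus_witness:
  assumes "p > 0" "c \<in> genus (q5 p)"
  obtains y where "witness c y"
proof -
  obtain x z where z: "z \<noteq> 0" and xz: "qval c x = z\<^sup>2"
    by (rule genus_represents_square[OF assms]) blast
  define X :: "int ^ 5" where "X = (\<chi> i. x i)"
  define g where "g = gcd_vec X"
  define y :: "int ^ 5" where "y = (\<chi> i. X $ i div g)"
  have Xy: "X $ i = g * y $ i" for i
    using gcd_vec_dvd[of X i] by (simp add: g_def y_def)
  have "qf_eval c X = g\<^sup>2 * qf_eval c y"
    unfolding qf_eval_def by (simp add: Xy sum_distrib_left power2_eq_square mult_ac)
  then have eq: "z\<^sup>2 = g\<^sup>2 * qf_eval c y"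
    using xz by (simp add: qf_eval_int X_def)
  then have "g\<^sup>2 dvd z\<^sup>2" by simp
  then have "g dvd z" by simp
  then obtain k where k: "z = g * k" by blast
  have g0: "g \<noteq> 0" using k z by auto
  have "qf_eval c y = k\<^sup>2" using eq g0 by (simp add: k power_mult_distrib)
  moreover have "gcd_vec y = 1"
  proof -
    have "g \<ge> 0" by (simp add: g_def gcd_vec_def)
    have "g * gcd_vec y dvd X $ i" for i
      unfolding Xy by (rule mult_dvd_mono[OF dvd_refl gcd_vec_dvd])
    then have "g * gcd_vec y dvd g"
      unfolding g_def[of] gcd_vec_def[of X] by (intro Gcd_greatest) auto
    then have "gcd_vec y dvd 1" using g0 by simp
    moreover have "gcd_vec y \<ge> 0" by (simp add: gcd_vec_def)
    ultimately show ?thesis by (metis zdvd1_eq abs_of_nonneg)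
  qed
  moreover have "\<bar>k\<bar> \<ge> 1" using k z by auto
  ultimately have "witness_for c \<bar>k\<bar> y" by (simp add: witness_for_def)
  then show thesis using that unfolding witness_def by blast
qed

section \<open>The six-dimensional form F and its Gram matrix\<close>

lemma sum_UNIV_plus_1: "(\<Sum>k\<in>(UNIV :: ('n::finite + 1) set). h k) = (\<Sum>i\<in>UNIV. h (Inl i)) + h (Inr 1)"
proof -
  have "(\<Sum>k\<in>(UNIV :: 'n set) <+> (UNIV :: 1 set). h k) = (\<Sum>i\<in>UNIV. h (Inl i)) + (\<Sum>i\<in>UNIV. h (Inr i))"
    by (subst sum.Plus) (auto simp: o_def)
  then show ?thesis by (simp only: UNIV_Plus_UNIV sum_1)
qed

lemma quad_direct_sum:
  fixes G :: "rat ^ 'n::finite ^ 'n" and v :: "rat ^ ('n + 1)"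
  shows "quad (direct_sum_mat (\<chi> i j. 2 * G $ i $ j) (mat (-2))) v
    = 2 * quad G (\<chi> i. v $ Inl i) - 2 * (v $ Inr 1)\<^sup>2"
  unfolding quad_def matrix_vector_mult_def sum_UNIV_plus_1
  by (simp add: direct_sum_mat_def sum_UNIV_plus_1 Finite_Cartesian_Product.mat_def
      sum_distrib_left power2_eq_square mult_ac)

lemma quad_axis_sum:
  fixes A :: "rat ^ 'n::finite ^ 'n"
  shows "quad A (rat_vec (axis i 1 + axis j 1)) = A $ i $ i + A $ i $ j + A $ j $ i + A $ j $ j"
    "quad A (rat_vec (axis i 1)) = A $ i $ i"
proof -
  have e: "rat_vec (axis i 1) $ k = (if k = i then 1 else 0)" for i k :: 'n
    by (simp add: rat_vec_def axis_def)
  have s: "rat_vec (axis i 1 + axis j 1) $ k = (if k = i then 1 else 0) + (if k = j then 1 else 0)" for k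
    by (simp add: rat_vec_def axis_def)
  have d: "(\<Sum>k\<in>UNIV. f k * (if k = i then 1 else 0)) = f i" "(\<Sum>k\<in>UNIV. (if k = i then 1 else 0) * f k) = f i"
    for f :: "'n \<Rightarrow> rat" and i
    by (simp_all add: if_distrib[of "\<lambda>z. z * _"] if_distrib[of "\<lambda>z. _ * z"] cong: if_cong)
  show "quad A (rat_vec (axis i 1)) = A $ i $ i"
    unfolding quad_def matrix_vector_mult_def by (simp only: e vec_lambda_beta d)
  show "quad A (rat_vec (axis i 1 + axis j 1)) = A $ i $ i + A $ i $ j + A $ j $ i + A $ j $ j"
    unfolding quad_def matrix_vector_mult_def
    by (simp only: s vec_lambda_beta distrib_left distrib_right sum.distrib d)
qed

text \<open>Polarization at pairs of basis vectors. \<open>G\<close> is rational because odd mixed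
  coefficients give half-integral entries; 2 G is integral.\<close>

lemma gram_matrix_entry:
  fixes q :: "'n::finite qform" and G :: "rat ^ 'n ^ 'n"
  assumes "transpose G = G" "\<And>x :: int ^ 'n. of_int (qf_eval q x) = quad G (rat_vec x)"
  shows "2 * G $ i $ j = of_int (q i j + q j i)"
proof -
  have e: "axis i 1 $ k = (if k = i then 1 else 0 :: int)" for i k :: 'n
    by (simp add: axis_def)
  have s: "(axis i 1 + axis j 1) $ k = (if k = i then 1 else 0) + (if k = j then 1 else 0 :: int)" for k
    by (simp add: axis_def)
  have d: "(\<Sum>k\<in>UNIV. f k * (if k = i then 1 else 0)) = f i" "(\<Sum>k\<in>UNIV. (if k = i then 1 else 0) * f k) = f i"
    for f :: "'n \<Rightarrow> int" and i
    by (simp_all add: if_distrib[of "\<lambda>z. z * _"] if_distrib[of "\<lambda>z. _ * z"] cong: if_cong)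
  have qf: "qf_eval q (x :: int ^ 'n) = (\<Sum>k\<in>UNIV. x $ k * (\<Sum>l\<in>UNIV. q k l * x $ l))" for x
    by (simp add: qf_eval_def sum_distrib_left mult_ac)
  have qi: "qf_eval q (axis i 1 :: int ^ 'n) = q i i" for i
    unfolding qf by (simp only: e d)
  have "qf_eval q (axis i 1 + axis j 1 :: int ^ 'n) = q i i + q i j + q j i + q j j"
    unfolding qf by (simp only: s distrib_left distrib_right sum.distrib d)
  then have "of_int (q i i + q i j + q j i + q j j) = G $ i $ i + G $ i $ j + G $ j $ i + G $ j $ j"
    using assms(2)[of "axis i 1 + axis j 1"] by (simp add: quad_axis_sum)
  moreover have "G $ k $ k = of_int (q k k)" for k
    using assms(2)[of "axis k 1"] by (simp add: quad_axis_sum qi)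
  moreover have "G $ j $ i = G $ i $ j"
    using assms(1) by (metis transpose_def vec_lambda_beta)
  ultimately show ?thesis by simp
qed

text \<open>Carries the identity between \<open>q\<close> and its Gram matrix, assumed at integer
  vectors, over to rational ones, where part (c) lives.\<close>

lemma quad_eq_qf_eval:
  fixes q :: "'n::finite qform" and G :: "rat ^ 'n ^ 'n"
  assumes "\<And>i j. 2 * G $ i $ j = of_int (q i j + q j i)"
  shows "quad G u = qf_eval q u"
proof -
  have "2 * quad G u = (\<Sum>i\<in>UNIV. \<Sum>j\<in>UNIV. (2 * G $ i $ j) * (u $ i * u $ j))"
    by (simp add: quad_def matrix_vector_mult_def sum_distrib_left mult_ac)
  also have "\<dots> = (\<Sum>i\<in>UNIV. \<Sum>j\<in>UNIV. of_int (q i j) * (u $ i * u $ j))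
      + (\<Sum>i\<in>UNIV. \<Sum>j\<in>UNIV. of_int (q j i) * (u $ j * u $ i))"
    unfolding assms by (simp add: ring_distribs sum.distrib mult_ac)
  also have "(\<Sum>i\<in>UNIV. \<Sum>j\<in>UNIV. of_int (q j i) * (u $ j * u $ i)) = qf_eval q u"
    unfolding qf_eval_def by (rule sum.swap)
  finally show ?thesis unfolding qf_eval_def by simp
qed

lemma pos_def_qf_eval_rat:
  fixes c :: "'n::finite qform" and u :: "rat ^ 'n"
  assumes "pos_def c" "u \<noteq> 0"
  shows "qf_eval c u > 0"
proof -
  let ?r = "\<chi> i. real_of_rat (u $ i)"
  have "?r \<noteq> 0" using assms(2) by (auto simp: Finite_Cartesian_Product.vec_eq_iff)
  then have "qf_eval c ?r > 0" using assms(1) unfolding pos_def_def by blast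
  moreover have "qf_eval c ?r = of_rat (qf_eval c u)"
    by (simp add: qf_eval_def of_rat_sum of_rat_mult)
  ultimately show ?thesis by simp
qed

lemma join_index [simp]: "join x z $ Inl i = x $ i" "join x z $ Inr j = z"
  by (simp_all add: join_def)

lemma join_eq_0_iff: "join x z = 0 \<longleftrightarrow> x = 0 \<and> z = 0"
  by (auto simp: Finite_Cartesian_Product.vec_eq_iff join_def split: sum.splits)

lemma rat_vec_eq_0_iff: "rat_vec x = 0 \<longleftrightarrow> x = 0"
  by (simp add: Finite_Cartesian_Product.vec_eq_iff rat_vec_def)

text \<open>If g divides x, then g^2 divides q(x) = z^2, so g divides z and the whole
  vector.\<close>

lemma gcd_vec_join_coprime:
  assumes "qf_eval q x = z\<^sup>2" "gcd_vec (join x z) = 1"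
  shows "gcd_vec x = 1"
proof -
  define g where "g = gcd_vec x"
  have gx: "g dvd x $ i" for i unfolding g_def by (rule gcd_vec_dvd)
  have "g\<^sup>2 dvd qf_eval q x"
    unfolding qf_eval_def power2_eq_square by (intro dvd_sum dvd_mult mult_dvd_mono gx)
  then have "g dvd z" using assms(1) by simp
  then have "g dvd join x z $ k" for k using gx by (cases k) auto
  then have "g dvd gcd_vec (join x z)" unfolding gcd_vec_def by (intro Gcd_greatest) auto
  then have "g dvd 1" using assms(2) by simp
  moreover have "g \<ge> 0" by (simp add: g_def gcd_vec_def)
  ultimately show ?thesis unfolding g_def[symmetric] by (metis zdvd1_eq abs_of_nonneg)
qed

definition F_index :: "nat \<Rightarrow> 5 + 1" where
  "F_index k = (if k < 5 then Inl (q5_index k) else Inr 1)"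

lemma bij_betw_F_index: "bij_betw F_index {0..<6} UNIV"
proof -
  have "{0..<6} = insert 5 {..<5 :: nat}" by auto
  then have "F_index ` {0..<6} = insert (Inr 1) (Inl ` q5_index ` {..<5})"
    by (auto simp: F_index_def image_iff)
  also have "\<dots> = UNIV"
  proof -
    have "k \<in> insert (Inr 1) (range Inl)" for k :: "5 + 1"
      by (cases k) (auto intro: num1_eq1)
    then show ?thesis using bij_betw_imp_surj_on[OF bij_betw_q5_index] by blast
  qed
  finally show ?thesis
    unfolding bij_betw_def by (auto intro!: eq_card_imp_inj_on)
qed

lemma det_direct_sum:
  fixes G :: "rat ^ 5 ^ 5"
  assumes "\<And>i j. 2 * G $ i $ j = of_int (q i j + q j i)"
  shows "det (direct_sum_mat (\<chi> i j. 2 * G $ i $ j) (mat (-2) :: rat ^ 1 ^ 1)) = - 2 * of_int (fdet 5 (polar q q5_index))"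
proof -
  let ?F = "direct_sum_mat (\<chi> i j. 2 * G $ i $ j) (mat (-2) :: rat ^ 1 ^ 1)"
  let ?A = "\<lambda>i j. ?F $ F_index i $ F_index j"
  have "fdet (5 + 1) ?A = fdet 5 ?A * fdet 1 (\<lambda>i j. ?A (5 + i) (5 + j))"
    by (rule fdet_block_upper) (simp add: F_index_def direct_sum_mat_def)
  also have "fdet 5 ?A = fdet 5 (\<lambda>i j. of_int (polar q q5_index i j))"
    by (rule fdet_cong) (simp add: F_index_def direct_sum_mat_def assms polar_def)
  also have "fdet 1 (\<lambda>i j. ?A (5 + i) (5 + j)) = -2"
    by (simp add: F_index_def direct_sum_mat_def Finite_Cartesian_Product.mat_def)
  finally show ?thesis
    using det_eq_fdet[OF bij_betw_F_index, of ?F] by (simp add: fdet_of_int)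
qed

theorem proposition3p4:
  fixes p :: nat
    and q :: "5 qform"
    and G :: "rat ^ 5 ^ 5"
    and F :: "rat ^ (5 + 1) ^ (5 + 1)"
  assumes "Factorial_Ring.prime p" and "p mod 12 = 11"
    and "q \<in> genus (q5 p)"
    and "transpose G = G" and "\<And>x :: int ^ 5. of_int (qf_eval q x) = quad G (rat_vec x)"
    and "F = direct_sum_mat (\<chi> i j. 2 * G $ i $ j) (mat (-2))"
  shows "det F = - (2 ^ 10) * of_nat p ^ 2
    \<and> (\<forall>(x :: int ^ 5) z. quad F (rat_vec (join x z)) = 2 * (of_int (qf_eval q x) - of_int z ^ 2))
    \<and> \<comment> \<open>(a)\<close>
      (\<forall>(x :: int ^ 5) z. join x z \<noteq> 0 \<longrightarrow>
         (isotropic F (rat_vec (join x z)) \<longleftrightarrow> qf_eval q x = z ^ 2) \<and>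
         (isotropic F (rat_vec (join x z)) \<longrightarrow> z \<noteq> 0))
    \<and> \<comment> \<open>(b)\<close>
      (\<forall>(x :: int ^ 5) z.
         isotropic F (rat_vec (join x z)) \<and> gcd_vec (join x z) = 1 \<longrightarrow>
         gcd_vec x = 1 \<and> witness_for q \<bar>z\<bar> x)
    \<and> \<comment> \<open>(c)\<close>
      (\<forall>W. totally_isotropic F W \<longrightarrow> vec.dim W \<le> 1)
    \<and> \<comment> \<open>(d)\<close>
      (\<exists>(x :: int ^ 5) z. isotropic F (rat_vec (join x z)))
    \<and> (\<forall>C \<in> genus_classes (q5 p). \<forall>c \<in> C. \<exists>x. witness c x)"
proof -
  have p: "p > 0" using assms(1) by (rule prime_gt_0_nat)
  have pos: "pos_def q" using assms(3) by (simp add: genus_def)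
  have G: "2 * G $ i $ j = of_int (q i j + q j i)" for i j
    by (rule gram_matrix_entry[OF assms(4,5)])
  have F: "quad F v = 2 * qf_eval q (\<chi> i. v $ Inl i) - 2 * (v $ Inr 1)\<^sup>2" for v
    unfolding assms(6) quad_direct_sum quad_eq_qf_eval[OF G] ..
  have int_eval: "qf_eval q (\<chi> i. rat_vec (join x z) $ Inl i) = of_int (qf_eval q x)" for x :: "int ^ 5" and z
  proof -
    have "(\<chi> i. rat_vec (join x z) $ Inl i) = rat_vec x"
      by (simp add: Finite_Cartesian_Product.vec_eq_iff rat_vec_def)
    then show ?thesis using quad_eq_qf_eval[OF G, of "rat_vec x"] assms(5)[of x] by simp
  qed
  have det: "det F = - (2 ^ 10) * of_nat p ^ 2"
    unfolding assms(6) det_direct_sum[OF G] fdet_polar_genus[OF p assms(3)] by simp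
  have quad: "quad F (rat_vec (join x z)) = 2 * (of_int (qf_eval q x) - of_int z ^ 2)" for x :: "int ^ 5" and z
    unfolding F int_eval by (simp add: rat_vec_def)
  have iso: "isotropic F (rat_vec (join x z)) \<longleftrightarrow> join x z \<noteq> 0 \<and> qf_eval q x = z ^ 2" for x :: "int ^ 5" and z
  proof -
    have "quad F (rat_vec (join x z)) = 0 \<longleftrightarrow> (of_int (qf_eval q x) :: rat) = of_int (z ^ 2)"
      unfolding quad by simp
    then show ?thesis unfolding isotropic_def rat_vec_eq_0_iff of_int_eq_iff by blast
  qed
  have z0: "z \<noteq> 0" if iso': "isotropic F (rat_vec (join x z))" for x :: "int ^ 5" and z
  proof
    assume "z = 0"
    then have "qval q (\<lambda>i. x $ i) = 0" "x \<noteq> 0"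
      using iso' by (simp_all add: iso qf_eval_int join_eq_0_iff)
    moreover obtain i where "x $ i \<noteq> 0" using \<open>x \<noteq> 0\<close> by (auto simp: Finite_Cartesian_Product.vec_eq_iff)
    ultimately show False using pos_def_qval[OF pos, of "\<lambda>i. x $ i" i] by simp
  qed
  have b: "gcd_vec x = 1 \<and> witness_for q \<bar>z\<bar> x"
    if "isotropic F (rat_vec (join x z)) \<and> gcd_vec (join x z) = 1" for x :: "int ^ 5" and z
  proof -
    have "qf_eval q x = z\<^sup>2" "z \<noteq> 0" using that iso z0 by blast+
    moreover have "gcd_vec x = 1" using gcd_vec_join_coprime that calculation(1) by blast
    ultimately show ?thesis by (simp add: witness_for_def)
  qed
  have c: "vec.dim W \<le> 1" if "totally_isotropic F W" for W
  proof -
    have W: "vec.subspace W" and zero: "\<And>v. v \<in> W \<Longrightarrow> quad F v = 0"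
      using that by (auto simp: totally_isotropic_def)
    \<comment> \<open>By definiteness W meets the hyperplane z = 0 only in 0, so the last coordinate
      maps W injectively to the rationals.\<close>
    have hyp: "v = 0" if "v \<in> W" "v $ Inr 1 = 0" for v
    proof -
      have "qf_eval q (\<chi> i. v $ Inl i) = 0" using zero[OF that(1)] that(2) by (simp add: F)
      then have "(\<chi> i. v $ Inl i) = 0" using pos_def_qf_eval_rat[OF pos] by (metis less_irrefl)
      then have "v $ Inl i = 0" for i by (simp add: Finite_Cartesian_Product.vec_eq_iff)
      moreover have "v $ Inr j = 0" for j using that(2) by (metis num1_eq1)
      ultimately have "v $ k = 0" for k by (cases k) auto
      then show ?thesis by (simp add: Finite_Cartesian_Product.vec_eq_iff)
    qed
    show ?thesis
    proof (cases "W \<subseteq> {0}")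
      case True
      then have "vec.dim W = 0" by (simp only: vec.dim_eq_0)
      then show ?thesis by linarith
    next
      case False
      then obtain w where w: "w \<in> W" "w \<noteq> 0" by blast
      then have w1: "w $ Inr 1 \<noteq> 0" using hyp by blast
      have "W \<subseteq> vec.span {w}"
      proof
        fix v assume v: "v \<in> W"
        let ?k = "v $ Inr 1 / w $ Inr 1"
        have "v - ?k *s w \<in> W" by (intro vec.subspace_diff vec.subspace_scale W v w)
        moreover have "(v - ?k *s w) $ Inr 1 = 0" using w1 by simp
        ultimately have "v - ?k *s w = 0" by (rule hyp)
        then have "v = ?k *s w" by simp
        then show "v \<in> vec.span {w}" by (metis vec.span_base vec.span_scale singletonI)
      qed
      from vec.dim_le_card[OF this] show ?thesis by simp
    qed
  qed
  have d: "\<exists>(x :: int ^ 5) z. isotropic F (rat_vec (join x z))"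
  proof -
    obtain y where "witness q y" by (rule genus_witness[OF p assms(3)])
    then obtain N where "N \<ge> 1" "qf_eval q y = N ^ 2" by (auto simp: witness_def witness_for_def)
    then have "isotropic F (rat_vec (join y N))" by (simp add: iso join_eq_0_iff)
    then show ?thesis by blast
  qed
  have e: "\<exists>x. witness c x" if C: "C \<in> genus_classes (q5 p)" "c \<in> C" for C c
  proof -
    have "c \<in> genus (q5 p)" using C unfolding genus_classes_def quotient_def by blast
    then obtain y where "witness c y" by (rule genus_witness[OF p])
    then show ?thesis by blast
  qed
  show ?thesis
    using det quad iso z0 b c d e by blast
qed

end
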